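(* For every integer $n\geq 1$ there exists a constant $c_n>0$, depending only on $n$, such that the following holds. Let $\mu$ be an orthogonally invariant probability measure on $\mathrm{GL}_n(\mathbb{R})$ such that the functions $A\mapsto \log^{+}(\|A\|)$ and $A\mapsto\log^{+}(\|A^{-1}\|)$ belong to $L^1(\mathrm{GL}_n(\mathbb{R}),\mu)$, and let $r_1\geq r_2\geq\cdots\geq r_n$ be the random Lyapunov exponents of $\mu$. Then for every $k$ with $1\leq k\leq n$, $$ \int_{A\in \mathrm{GL}_n(\mathbb{R})} \left(\sum_{i=1}^k\log|\lambda_i(A)|\right)^{+}\,d\mu(A)\;\geq\; c_n\left(\sum_{i=1}^k r_i\right)^+ . $$
   Context: For a real number or real-valued function $f$, $f^+=\max\{f,0\}$, and $\log^+ x=\max\{\log x,0\}$. $\|A\|$ is the operator norm with respect to the Euclidean norm $\|\cdot\|$ on $\mathbb{R}^n$. For $A\in \mathrm{GL}_n(\mathbb{R})$, $\lambda_1(A),\dots,\lambda_n(A)$ are the (complex) eigenvalues of $A$, listed according to algebraic multiplicity and ordered so that $|\lambda_1(A)|\geq\cdots\geq|\lambda_n(A)|$. A measure $\mu$ on $\mathrm{GL}_n(\mathbb{R})$ is orthogonally invariant if it is invariant under left multiplication by every element of the orthogonal group $\mathrm{O}_n(\mathbb{R})$. Random Lyapunov exponents: under the integrability condition in the claim, Oseledets' theorem gives real numbers $r_1\geq\cdots\geq r_n$ such that for almost every sequence $g_1,g_2,\ldots$ of i.i.d. matrices drawn from $\mu$, the limit $\lim_{m\to\infty}\frac1m\log\|g_m\cdots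 g_1v\|$ exists for every nonzero $v\in\mathbb{R}^n$ and equals one of the $r_i$. The $r_i$ are counted with multiplicity, i.e. $r_i$ is the almost sure limit of $\frac1m\log\sigma_i(g_m\cdots g_1)$, where $\sigma_1\geq\cdots\geq\sigma_n$ denote singular values. *)

theory Defs
  imports "HOL-Probability.Probability" "HOL-Computational_Algebra.Computational_Algebra"
begin

definition pos_part :: "real \<Rightarrow> real" where
  "pos_part x = max x 0"

definition log_plus :: "real \<Rightarrow> real" where
  "log_plus x = pos_part (ln x)"

definition GL :: "(real ^ 'n ^ 'n) set" where
  "GL = {A. invertible A}"

definition complex_charpoly :: "real ^ 'n ^ 'n \<Rightarrow> complex poly" where
  "complex_charpoly A = det (mat [:0, 1:] - (\<chi> i j. [:complex_of_real (A $ i $ j):]))"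

(* The choice fixes only an arbitrary order of the roots before sorting; the resulting
   moduli do not depend on it. *)
definition eigenvalue_list :: "real ^ 'n ^ 'n \<Rightarrow> complex list" where
  "eigenvalue_list A =
     sort_key (\<lambda>z. - cmod z) (SOME zs. mset zs = proots (complex_charpoly A))"

(* Indices are 1-based: meaningful for 1 \<le> i \<le> CARD('n). *)
definition eigenvalue :: "nat \<Rightarrow> real ^ 'n ^ 'n \<Rightarrow> complex" where
  "eigenvalue i A = eigenvalue_list A ! (i - 1)"

(* The eigenvalues of the Gram matrix are real and nonnegative, so taking the real part
   loses nothing and sorting by modulus sorts by value. *)
definition singular_value :: "nat \<Rightarrow> real ^ 'n ^ 'n \<Rightarrow> real" where
  "singular_value i A = sqrt (Re (eigenvalue i (transpose A ** A)))"

definition measure_on_GL :: "(real ^ 'n ^ 'n) measure \<Rightarrow> bool" where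
  "measure_on_GL M \<longleftrightarrow> sets M = sets (restrict_space borel GL)"

definition orthogonally_invariant :: "(real ^ 'n ^ 'n) measure \<Rightarrow> bool" where
  "orthogonally_invariant M \<longleftrightarrow>
     (\<forall>Q. orthogonal_matrix Q \<longrightarrow> distr M M (\<lambda>A. Q ** A) = M)"

(* Sequences are 0-based: left_product g m = g (m - 1) ** ... ** g 0. *)
primrec left_product :: "(nat \<Rightarrow> real ^ 'n ^ 'n) \<Rightarrow> nat \<Rightarrow> real ^ 'n ^ 'n" where
  "left_product g 0 = mat 1"
| "left_product g (Suc m) = g m ** left_product g m"

(* r 1, ..., r CARD('n) are the exponents counted with multiplicity. They are determined
   uniquely by M, and r 1 \<ge> r 2 \<ge> ... holds because singular values are listed in
   decreasing order. *)
definition random_Lyapunov_exponents :: "(real ^ 'n ^ 'n) measure \<Rightarrow> (nat \<Rightarrow> real) \<Rightarrow> bool" where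
  "random_Lyapunov_exponents M r \<longleftrightarrow>
     (AE g in (\<Pi>\<^sub>M j\<in>(UNIV :: nat set). M). \<forall>i\<in>{1..CARD('n)}.
        (\<lambda>m. ln (singular_value i (left_product g m)) / real m) \<longlonglongrightarrow> r i)"

end

(* Proof idea. Write P(k, A) for the product of the k largest eigenvalue moduli of A, and
   Phi(k, A) = 1/2 log (e_k(A^T A) / (n choose k)), where e_k is the k-th elementary symmetric function
   of the eigenvalues, i.e. the sum of the principal k x k minors.

   Upper bound for the exponents: (r_1 + ... + r_k)^+ is at most the integral of Phi(k, .)^+. By
   orthogonal invariance, e_k(P_m^T P_m) divided by the product of the factors exp (2 Phi(k, g_j)) has
   constant expectation in m, where P_m is the product of the first m matrices; take logarithms and
   apply Fatou's lemma.

   Lower bound for the eigenvalues: there are a finite set S of orthogonal matrices and c > 0 such that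
   every invertible A has some Q in S with (log P(k, Q A))^+ >= c Phi(k, A)^+; then average over S,
   using the invariance of the measure under each Q. Here S is a fine net of the orthogonal group. With
   singular values d_i, let N be the product of the k largest ones. Choosing Q A close to a positive
   semidefinite matrix gives P(k, Q A) >= t N with t close to 1, which suffices unless N is close to 1.
   In that case Phi > 0 forces A to be nearly orthogonal (for k < n), with determinant at least 1 up to
   second order. If all P(k, Q A) were close to 1, every eigenvalue of every Q A would be close to the
   unit circle, so tr (Q A) would be close to tr ((Q A)^-1); their difference is linear in Q and
   controls all |d_i - 1/d_i|. *)

theory Submission imports Defs begin

no_notation fps_nth (infixl \<open>$\<close> 75)

section \<open>Elementary symmetric functions and maximal products\<close>

text \<open>The lower bound has to be linear in Phi with one constant all the way down to Phi = 0,
  and this shapes the proof. A fixed relative loss t in P(k, Q A) is harmless once log N exceeds a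
  fixed \<delta>, but for smaller N it could exceed Phi itself. There the trace argument takes over:
  it controls the ln d_i linearly, while the possible deficit of the determinant is only quadratic
  in them and is absorbed by keeping all |ln d_i| below a small bound X0.

  Eigenvalues are never followed as functions of the matrix. They enter through their elementary
  symmetric functions, which are polynomials in the entries. Since e_k determines the largest k-fold
  product only up to a binomial factor, the comparison is made for high powers of the eigenvalues,
  reached by repeated root squaring, and the factor fades when the root is taken.

  The divisor (n choose k) makes Phi vanish on orthogonal matrices. The constant expectation comes
  without Haar measure: it rests on the invariance under permutation matrices and under one
  orthogonal matrix that diagonalizes a Gram matrix.\<close>

definition esym :: "nat \<Rightarrow> ('n::finite \<Rightarrow> 'a::comm_semiring_1) \<Rightarrow> 'a" where
  "esym k z = (\<Sum>I | card I = k. \<Prod>i\<in>I. z i)"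

(* Meaningful only for k \<le> CARD('n); otherwise it is Max of the empty set. *)
definition top_prod :: "nat \<Rightarrow> ('n::finite \<Rightarrow> real) \<Rightarrow> real" where
  "top_prod k f = Max ((\<lambda>I. \<Prod>i\<in>I. f i) ` {I. card I = k})"

lemma card_subsets_type: "card {I :: 'n::finite set. card I = k} = CARD('n) choose k"
  using n_subsets[of "UNIV :: 'n set" k] by simp

lemma exists_subset_card:
  assumes "k \<le> CARD('n::finite)"
  shows "\<exists>I :: 'n set. card I = k"
  using obtain_subset_with_card_n[OF assms] by metis

lemma top_prod_ge: "card I = k \<Longrightarrow> (\<Prod>i\<in>I. f i) \<le> top_prod k f"
  unfolding top_prod_def by (intro Max_ge) auto

lemma top_prod_attained:
  fixes f :: "'n::finite \<Rightarrow> real"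
  assumes "k \<le> CARD('n)"
  obtains I where "card I = k" "top_prod k f = (\<Prod>i\<in>I. f i)"
proof -
  have "(\<lambda>I. \<Prod>i\<in>I. f i) ` {I. card I = k} \<noteq> {}"
    using exists_subset_card[OF assms] by auto
  hence "top_prod k f \<in> (\<lambda>I. \<Prod>i\<in>I. f i) ` {I. card I = k}"
    unfolding top_prod_def by (intro Max_in) auto
  thus ?thesis using that by auto
qed

lemma top_prod_le_iff:
  fixes f :: "'n::finite \<Rightarrow> real"
  assumes "k \<le> CARD('n)"
  shows "top_prod k f \<le> c \<longleftrightarrow> (\<forall>I. card I = k \<longrightarrow> (\<Prod>i\<in>I. f i) \<le> c)"
  by (metis assms order_trans top_prod_attained top_prod_ge)

lemma top_prod_nonneg:
  fixes f :: "'n::finite \<Rightarrow> real"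
  assumes "k \<le> CARD('n)" "\<And>i. f i \<ge> 0"
  shows "top_prod k f \<ge> 0"
  by (metis assms prod_nonneg top_prod_attained)

lemma top_prod_pos:
  fixes f :: "'n::finite \<Rightarrow> real"
  assumes "k \<le> CARD('n)" "\<And>i. f i > 0"
  shows "top_prod k f > 0"
  by (metis assms prod_pos top_prod_attained)

lemma top_prod_power:
  fixes f :: "'n::finite \<Rightarrow> real"
  assumes "k \<le> CARD('n)" "\<And>i. f i \<ge> 0"
  shows "top_prod k (\<lambda>i. f i ^ m) = top_prod k f ^ m"
proof (rule antisym)
  obtain I where I: "card I = k" "top_prod k (\<lambda>i. f i ^ m) = (\<Prod>i\<in>I. f i ^ m)"
    using top_prod_attained[OF assms(1)] .
  show "top_prod k (\<lambda>i. f i ^ m) \<le> top_prod k f ^ m"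
    unfolding I(2) prod_power_distrib[symmetric]
    by (intro power_mono top_prod_ge I prod_nonneg) (use assms in auto)
  obtain J where J: "card J = k" "top_prod k f = (\<Prod>i\<in>J. f i)"
    using top_prod_attained[OF assms(1)] .
  show "top_prod k f ^ m \<le> top_prod k (\<lambda>i. f i ^ m)"
    unfolding J(2) prod_power_distrib by (rule top_prod_ge[OF J(1)])
qed

lemma norm_esym_le:
  fixes z :: "'n::finite \<Rightarrow> 'a::{real_normed_div_algebra, comm_semiring_1}"
  shows "norm (esym k z) \<le> real (CARD('n) choose k) * top_prod k (\<lambda>i. norm (z i))"
proof -
  have "norm (esym k z) \<le> (\<Sum>I | card I = k. norm (\<Prod>i\<in>I. z i))"
    unfolding esym_def by (rule norm_sum)
  also have "\<dots> \<le> (\<Sum>I | card (I::'n set) = k. top_prod k (\<lambda>i. norm (z i)))"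
    by (intro sum_mono) (auto intro!: top_prod_ge order_trans[OF norm_prod_le])
  also have "\<dots> = real (CARD('n) choose k) * top_prod k (\<lambda>i. norm (z i))"
    by (simp add: card_subsets_type)
  finally show ?thesis .
qed

lemma top_prod_le_esym:
  fixes f :: "'n::finite \<Rightarrow> real"
  assumes "k \<le> CARD('n)" "\<And>i. f i \<ge> 0"
  shows "top_prod k f \<le> esym k f"
proof -
  obtain I where I: "card I = k" "top_prod k f = (\<Prod>i\<in>I. f i)"
    using top_prod_attained[OF assms(1)] .
  show ?thesis unfolding I(2) esym_def
    by (rule member_le_sum) (use I assms in \<open>auto intro: prod_nonneg\<close>)
qed

lemma esym_of_real: "esym k (\<lambda>i. of_real (f i) :: 'a::{real_algebra_1,comm_ring_1}) = of_real (esym k f)"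
  by (simp add: esym_def)

lemma esym_eq_0:
  assumes "k > CARD('n)"
  shows "esym k (z :: 'n::finite \<Rightarrow> 'a::comm_semiring_1) = 0"
proof -
  have "{I :: 'n set. card I = k} = {}"
    using assms card_mono[of "UNIV :: 'n set"] by (auto simp: not_le[symmetric])
  thus ?thesis by (simp add: esym_def)
qed

text \<open>An exchange argument: for optimal sets I and J of sizes i and j, moving k - i elements
  of J - I from J to I leaves two sets of size k with the same total product.\<close>

lemma top_prod_log_concave_aux:
  fixes f :: "'n::finite \<Rightarrow> real"
  assumes "\<And>i. f i \<ge> 0" "i + j = 2 * k" "i \<le> j" "j \<le> CARD('n)"
  shows "top_prod i f * top_prod j f \<le> top_prod k f ^ 2"
proof -
  obtain I where I: "card I = i" "top_prod i f = prod f I"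
    using top_prod_attained[of i f] assms by auto
  obtain J where J: "card J = j" "top_prod j f = prod f J"
    using top_prod_attained[of j f] assms by auto
  have "card (J - I) \<ge> card J - card I" by (rule diff_card_le_card_Diff) auto
  hence "k - i \<le> card (J - I)" using I J assms by auto
  then obtain T where T: "T \<subseteq> J - I" "card T = k - i" "finite T"
    by (rule obtain_subset_with_card_n)
  have "card (I \<union> T) = k" using T I assms by (subst card_Un_disjoint) auto
  have "card (J - T) = k" using T J assms by (subst card_Diff_subset) auto
  have "prod f I * prod f J = prod f I * (prod f T * prod f (J - T))"
    using T by (subst prod.subset_diff[of T J]) (auto simp: mult.commute)
  also have "\<dots> = prod f (I \<union> T) * prod f (J - T)"
    using T by (subst prod.union_disjoint) auto
  also have "\<dots> \<le> top_prod k f * top_prod k f"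
    by (intro mult_mono top_prod_ge prod_nonneg top_prod_nonneg) 
       (use assms \<open>card (I \<union> T) = k\<close> \<open>card (J - T) = k\<close> in auto)
  finally show ?thesis using I J by (simp add: power2_eq_square)
qed

lemma top_prod_log_concave:
  fixes f :: "'n::finite \<Rightarrow> real"
  assumes "\<And>i. f i \<ge> 0" "i + j = 2 * k" "i \<le> CARD('n)" "j \<le> CARD('n)"
  shows "top_prod i f * top_prod j f \<le> top_prod k f ^ 2"
  using top_prod_log_concave_aux[of f i j k] top_prod_log_concave_aux[of f j i k] assms
  by (cases "i \<le> j") (auto simp: mult.commute)

lemma prod_one_plus_smult_esym:
  fixes z :: "'n::finite \<Rightarrow> 'a::comm_ring_1"
  shows "(\<Prod>i\<in>UNIV. 1 + c * z i) = (\<Sum>k\<le>CARD('n). esym k z * c ^ k)"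
proof -
  have "(\<Prod>i\<in>UNIV. 1 + c * z i) = (\<Prod>i\<in>UNIV. c * z i + 1)" by (simp add: add.commute)
  also have "\<dots> = (\<Sum>I\<in>Pow UNIV. (\<Prod>i\<in>I. c * z i) * (\<Prod>i\<in>UNIV - I. 1))"
    by (rule prod_add) simp
  also have "\<dots> = (\<Sum>I\<in>UNIV. (\<Prod>i\<in>I. z i) * c ^ card I)"
    by (intro sum.cong) (auto simp: prod.distrib mult.commute)
  also have "\<dots> = (\<Sum>k\<le>CARD('n). \<Sum>I | I \<in> UNIV \<and> card I = k. (\<Prod>i\<in>I. z i) * c ^ card I)"
    by (rule sum.group[symmetric]) (auto intro: card_mono)
  also have "\<dots> = (\<Sum>k\<le>CARD('n). esym k z * c ^ k)"
    by (intro sum.cong) (auto simp: esym_def sum_distrib_right)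
  finally show ?thesis .
qed

text \<open>Root squaring in the manner of Graeffe: compare coefficients in $p(t) p(-t) = \prod_i (1 - z_i^2 t^2)$,
  where $p(t) = \prod_i (1 + z_i t)$.\<close>

lemma esym_squares:
  fixes z :: "'n::finite \<Rightarrow> 'a::{idom, ring_char_0}"
  shows "(-1) ^ k * esym k (\<lambda>i. z i ^ 2) =
    (\<Sum>i\<le>2*k. esym i z * ((-1) ^ (2*k-i) * esym (2*k-i) z))"
proof -
  let ?n = "CARD('n)"
  define P where "P = (\<Sum>j\<le>?n. monom (esym j z) j)"
  define P' where "P' = (\<Sum>j\<le>?n. monom ((-1) ^ j * esym j z) j)"
  define S where "S = (\<Sum>j\<le>?n. monom ((-1) ^ j * esym j (\<lambda>i. z i ^ 2)) (2 * j))"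
  have "poly (P * P') t = poly S t" for t
  proof -
    have P: "poly P t = (\<Prod>i\<in>UNIV. 1 + t * z i)"
      by (simp add: P_def poly_sum poly_monom prod_one_plus_smult_esym)
    have P': "poly P' t = (\<Prod>i\<in>UNIV. 1 + (-t) * z i)"
      unfolding prod_one_plus_smult_esym
      by (simp add: P'_def poly_sum poly_monom power_minus[of t] ac_simps)
    have S: "poly S t = (\<Prod>i\<in>UNIV. 1 + (-(t^2)) * z i ^ 2)"
      unfolding prod_one_plus_smult_esym
      by (simp add: S_def poly_sum poly_monom power_minus[of "t^2"] ac_simps flip: power_mult)
    show ?thesis
      unfolding poly_mult P P' S prod.distrib[symmetric]
      by (intro prod.cong) (auto simp: algebra_simps power2_eq_square)
  qed
  hence "P * P' = S" by (intro poly_ext) auto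
  hence eq: "coeff (P * P') (2*k) = coeff S (2*k)" by simp
  have P: "coeff P j = esym j z" for j
    by (cases "j \<le> ?n") (auto simp: P_def coeff_sum esym_eq_0)
  have P': "coeff P' j = (-1) ^ j * esym j z" for j
    by (cases "j \<le> ?n") (auto simp: P'_def coeff_sum esym_eq_0)
  have S: "coeff S (2*k) = (-1) ^ k * esym k (\<lambda>i. z i ^ 2)"
    by (cases "k \<le> ?n") (auto simp: S_def coeff_sum esym_eq_0)
  show ?thesis using eq unfolding S coeff_mult P P' by simp
qed

text \<open>The error in each e_j is measured against the largest term of e_j(d), which makes the
  notion independent of the scale of d. All j appear at once because root squaring mixes the
  indices.\<close>

definition esym_close :: "real \<Rightarrow> ('n::finite \<Rightarrow> complex) \<Rightarrow> ('n \<Rightarrow> real) \<Rightarrow> bool" where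
  "esym_close e z d \<longleftrightarrow>
     (\<forall>j\<le>CARD('n). norm (esym j z - of_real (esym j d)) \<le> e * top_prod j d)"

text \<open>Subtracting the root-squaring identities for z and d leaves errors of size
  \<open>e * top_prod i d * top_prod j d\<close> with i + j = 2k. Log-concavity bounds them by
  \<open>e * top_prod k d ^ 2\<close>, the scale that belongs to the squares, so the error stays
  relative. The constant counts at most 2n + 1 summands, each with the factor
  \<open>2 * 2 ^ n + 1\<close>.\<close>

lemma esym_close_square:
  fixes z :: "'n::finite \<Rightarrow> complex" and d :: "'n \<Rightarrow> real"
  assumes d: "\<And>i. d i \<ge> 0" and e: "0 \<le> e" "e \<le> 1" and close: "esym_close e z d"
  shows "esym_close ((2 * real CARD('n) + 1) * (2 * 2 ^ CARD('n) + 1) * e) (\<lambda>i. z i ^ 2) (\<lambda>i. d i ^ 2)"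
  unfolding esym_close_def
proof (intro allI impI)
  let ?n = "CARD('n)" and ?d = "\<lambda>i. complex_of_real (d i)"
  let ?C = "2 ^ ?n :: real" and ?N = "\<lambda>j. top_prod j d"
  fix k assume k: "k \<le> ?n"
  have N0: "?N j \<ge> 0" if "j \<le> ?n" for j using top_prod_nonneg[OF that] d by auto
  have D: "norm (esym j ?d) \<le> ?C * ?N j" if "j \<le> ?n" for j
  proof -
    have "norm (esym j ?d) \<le> real (?n choose j) * ?N j"
      using norm_esym_le[of j ?d] d by simp
    also have "\<dots> \<le> ?C * ?N j"
    proof (intro mult_right_mono N0 that)
      have "?n choose j \<le> 2 ^ ?n" by (rule binomial_le_pow2)
      thus "real (?n choose j) \<le> ?C" by (metis of_nat_le_iff of_nat_numeral of_nat_power)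
    qed
    finally show ?thesis .
  qed
  have E: "norm (esym j z - esym j ?d) \<le> e * ?N j" if "j \<le> ?n" for j
    using close that unfolding esym_close_def by (simp add: esym_of_real)
  have bound: "norm (esym i z * ((-1) ^ j * esym j z) - esym i ?d * ((-1) ^ j * esym j ?d))
        \<le> (2 * ?C + 1) * e * ?N k ^ 2" if ij: "i + j = 2 * k" for i j
  proof (cases "i \<le> ?n \<and> j \<le> ?n")
    case True
    have zj: "norm (esym j z) \<le> (?C + 1) * ?N j"
    proof -
      have "norm (esym j z) \<le> norm (esym j z - esym j ?d) + norm (esym j ?d)"
        by (metis diff_add_cancel norm_triangle_ineq)
      also have "\<dots> \<le> e * ?N j + ?C * ?N j" using E[of j] D[of j] True by auto
      also have "\<dots> \<le> (?C + 1) * ?N j"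
        using mult_right_mono[OF e(2) N0[of j]] True by (simp add: algebra_simps)
      finally show ?thesis .
    qed
    have "esym i z * ((-1) ^ j * esym j z) - esym i ?d * ((-1) ^ j * esym j ?d)
        = (-1) ^ j * ((esym i z - esym i ?d) * esym j z + esym i ?d * (esym j z - esym j ?d))"
      by (simp add: algebra_simps)
    hence "norm (esym i z * ((-1) ^ j * esym j z) - esym i ?d * ((-1) ^ j * esym j ?d))
       = norm ((esym i z - esym i ?d) * esym j z + esym i ?d * (esym j z - esym j ?d))"
      by (simp add: norm_mult norm_power)
    also have "\<dots> \<le> norm (esym i z - esym i ?d) * norm (esym j z)
                  + norm (esym i ?d) * norm (esym j z - esym j ?d)"
      by (metis norm_mult norm_triangle_ineq)
    also have "\<dots> \<le> (e * ?N i) * ((?C + 1) * ?N j) + (?C * ?N i) * (e * ?N j)"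
      by (intro add_mono mult_mono E D zj) (use True N0 e in auto)
    also have "\<dots> = (2 * ?C + 1) * e * (?N i * ?N j)" by (simp add: algebra_simps)
    also have "\<dots> \<le> (2 * ?C + 1) * e * ?N k ^ 2"
      by (intro mult_left_mono top_prod_log_concave) (use True d ij e in auto)
    finally show ?thesis .
  next
    case False
    hence "esym i z * esym j z = 0" "esym i ?d * esym j ?d = 0"
      by (auto simp: esym_eq_0)
    thus ?thesis using e by auto
  qed
  have "norm (esym k (\<lambda>i. z i ^ 2) - esym k (\<lambda>i. ?d i ^ 2))
      = norm ((-1) ^ k * esym k (\<lambda>i. z i ^ 2) - (-1) ^ k * esym k (\<lambda>i. ?d i ^ 2))"
    by (simp add: norm_mult norm_power flip: right_diff_distrib)
  also have "\<dots> = norm (\<Sum>i\<le>2*k. esym i z * ((-1) ^ (2*k-i) * esym (2*k-i) z)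
                           - esym i ?d * ((-1) ^ (2*k-i) * esym (2*k-i) ?d))"
    by (simp add: esym_squares sum_subtractf)
  also have "\<dots> \<le> (\<Sum>i\<le>2*k. (2 * ?C + 1) * e * ?N k ^ 2)"
    by (intro order_trans[OF norm_sum] sum_mono bound) auto
  also have "\<dots> = real (2*k+1) * ((2 * ?C + 1) * e * ?N k ^ 2)" by simp
  also have "\<dots> \<le> real (2*?n+1) * ((2 * ?C + 1) * e * ?N k ^ 2)"
    using k e by (intro mult_right_mono) auto
  also have "\<dots> = (2 * real ?n + 1) * (2 * ?C + 1) * e * top_prod k (\<lambda>i. d i ^ 2)"
    using k d by (simp add: top_prod_power)
  finally show "norm (esym k (\<lambda>i. z i ^ 2) - of_real (esym k (\<lambda>i. d i ^ 2)))
      \<le> (2 * real ?n + 1) * (2 * ?C + 1) * e * top_prod k (\<lambda>i. d i ^ 2)"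
    by (simp flip: esym_of_real)
qed

lemma esym_close_mono:
  assumes "esym_close e z d" "e \<le> e'" "\<And>i. d i \<ge> 0"
  shows "esym_close e' z d"
  using assms unfolding esym_close_def
  by (meson mult_right_mono order_trans top_prod_nonneg)

lemma esym_close_iterated_square:
  fixes e :: real
  assumes "e > 0"
  shows "\<exists>e0>0. \<forall>(z :: 'n::finite \<Rightarrow> complex) d. (\<forall>i. d i \<ge> 0) \<longrightarrow> esym_close e0 z d \<longrightarrow>
           esym_close e (\<lambda>i. z i ^ (2 ^ p)) (\<lambda>i. d i ^ (2 ^ p))"
  using assms
proof (induction p arbitrary: e)
  case 0
  thus ?case by auto
next
  case (Suc p)
  let ?K = "(2 * real CARD('n) + 1) * (2 * 2 ^ CARD('n) + 1)"
  \<comment> \<open>The cap at 1 serves the squaring step, where e \<le> 1 absorbs the terms of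
    second order in e.\<close>
  define e1 where "e1 = min 1 (e / ?K)"
  have K: "?K > 0" by (simp add: add_pos_pos)
  have e1: "e1 > 0" "e1 \<le> 1" using Suc.prems K by (auto simp: e1_def)
  have "?K * e1 \<le> ?K * (e / ?K)" using K by (intro mult_left_mono) (auto simp: e1_def)
  also have "\<dots> = e" by (metis K less_irrefl times_divide_eq_right nonzero_mult_div_cancel_left)
  finally have Ke: "?K * e1 \<le> e" .
  obtain e0 where e0: "e0 > 0" "\<And>(z :: 'n \<Rightarrow> complex) d. (\<And>i. d i \<ge> 0) \<Longrightarrow> esym_close e0 z d \<Longrightarrow>
           esym_close e1 (\<lambda>i. z i ^ (2 ^ p)) (\<lambda>i. d i ^ (2 ^ p))"
    using Suc.IH[OF e1(1)] by blast
  show ?case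
  proof (intro exI[of _ e0] conjI allI impI e0(1))
    fix z :: "'n \<Rightarrow> complex" and d assume d: "\<forall>i. d i \<ge> 0" and cl: "esym_close e0 z d"
    have "esym_close e1 (\<lambda>i. z i ^ (2 ^ p)) (\<lambda>i. d i ^ (2 ^ p))" using e0(2) d cl by blast
    hence "esym_close (?K * e1) (\<lambda>i. (z i ^ (2 ^ p)) ^ 2) (\<lambda>i. (d i ^ (2 ^ p)) ^ 2)"
      using d e1 by (intro esym_close_square) auto
    hence "esym_close e (\<lambda>i. (z i ^ (2 ^ p)) ^ 2) (\<lambda>i. (d i ^ (2 ^ p)) ^ 2)"
      using Ke by (rule esym_close_mono) auto
    thus "esym_close e (\<lambda>i. z i ^ 2 ^ Suc p) (\<lambda>i. d i ^ 2 ^ Suc p)"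
      by (simp add: mult.commute flip: power_mult)
  qed
qed

text \<open>For the m-th powers, e_k gives the comparison of the largest products up to a constant
  factor independent of m. Taking m-th roots brings that factor as close to 1 as desired; m is a
  power of 2 because it is reached by squaring.\<close>

lemma top_prod_perturbation:
  fixes t :: real
  assumes "0 < t" "t < 1"
  shows "\<exists>e>0. \<forall>(z :: 'n::finite \<Rightarrow> complex) d k. (\<forall>i. d i \<ge> 0) \<longrightarrow> esym_close e z d \<longrightarrow>
           k \<le> CARD('n) \<longrightarrow> t * top_prod k d \<le> top_prod k (\<lambda>i. norm (z i))"
proof -
  let ?n = "CARD('n)"
  let ?C = "2 ^ ?n :: real"
  \<comment> \<open>The power of t has to outweigh \<open>?C\<close>, which bounds the number of
    terms of e_k, and a factor 2 from the error 1/2 allowed for the m-th powers.\<close>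
  have "\<exists>m. t ^ m < 1 / (2 * ?C)" using assms by (intro real_arch_pow_inv) auto
  then obtain p where p: "t ^ p < 1 / (2 * ?C)" by blast
  define m where "m = (2::nat) ^ p"
  have "p \<le> m" by (simp add: m_def less_imp_le)
  hence "t ^ m \<le> t ^ p" using assms by (intro power_decreasing) auto
  hence "t ^ m \<le> 1 / (2 * ?C)" using p by simp
  hence tm: "t ^ m * (2 * ?C) \<le> 1" by (simp add: field_simps)
  obtain e where e: "e > 0" "\<And>(z :: 'n \<Rightarrow> complex) d. (\<And>i. d i \<ge> 0) \<Longrightarrow> esym_close e z d \<Longrightarrow>
           esym_close (1/2) (\<lambda>i. z i ^ m) (\<lambda>i. d i ^ m)"
    using esym_close_iterated_square[of "1/2" p] unfolding m_def by auto
  show ?thesis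
  proof (intro exI[of _ e] conjI allI impI e(1))
    fix z :: "'n \<Rightarrow> complex" and d k
    assume d: "\<forall>i. d i \<ge> (0::real)" and cl: "esym_close e z d" and k: "k \<le> ?n"
    let ?N = "top_prod k d" and ?R = "top_prod k (\<lambda>i. norm (z i))"
    have N0: "?N \<ge> 0" "?R \<ge> 0" using d k by (auto intro!: top_prod_nonneg)
    have cl': "norm (esym k (\<lambda>i. z i ^ m) - of_real (esym k (\<lambda>i. d i ^ m))) \<le> 1/2 * ?N ^ m"
      using e(2)[of d z] d cl k unfolding esym_close_def by (auto simp: top_prod_power)
    have "?N ^ m \<le> esym k (\<lambda>i. d i ^ m)"
      using top_prod_le_esym[of k "\<lambda>i. d i ^ m"] d k by (auto simp: top_prod_power)
    also have "\<dots> \<le> norm (of_real (esym k (\<lambda>i. d i ^ m)) :: complex)" by simp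
    also have "\<dots> \<le> norm (esym k (\<lambda>i. z i ^ m)) + 1/2 * ?N ^ m"
      using cl' norm_triangle_ineq2[of "of_real (esym k (\<lambda>i. d i ^ m))" "esym k (\<lambda>i. z i ^ m)"]
      by (simp add: norm_minus_commute)
    finally have "1/2 * ?N ^ m \<le> norm (esym k (\<lambda>i. z i ^ m))" by simp
    also have "\<dots> \<le> real (?n choose k) * ?R ^ m"
      using norm_esym_le[of k "\<lambda>i. z i ^ m"] k by (simp add: norm_power top_prod_power)
    also have "\<dots> \<le> ?C * ?R ^ m"
    proof (intro mult_right_mono)
      have "?n choose k \<le> 2 ^ ?n" by (rule binomial_le_pow2)
      thus "real (?n choose k) \<le> ?C" by (metis of_nat_le_iff of_nat_numeral of_nat_power)
    qed (use N0 in auto)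
    finally have 1: "?N ^ m \<le> (2 * ?C) * ?R ^ m" by simp
    have "(t * ?N) ^ m = t ^ m * ?N ^ m" by (simp add: power_mult_distrib)
    also have "\<dots> \<le> t ^ m * ((2 * ?C) * ?R ^ m)" using 1 assms by (intro mult_left_mono) auto
    also have "\<dots> = (t ^ m * (2 * ?C)) * ?R ^ m" by simp
    also have "\<dots> \<le> 1 * ?R ^ m" using tm N0 by (intro mult_right_mono) auto
    finally have "(t * ?N) ^ m \<le> ?R ^ m" by simp
    thus "t * ?N \<le> ?R"
      using N0 assms by (subst (asm) power_mono_iff) (auto simp: m_def)
  qed
qed

section \<open>Principal minors and the characteristic polynomial\<close>

lemma matrix_add_rdistrib:
  fixes A B :: "'a::semiring_1 ^ 'm ^ 'n" and C :: "'a ^ 'k ^ 'm"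
  shows "(A + B) ** C = A ** C + B ** C"
  by (simp add: vec_eq_iff matrix_matrix_mult_def sum.distrib distrib_right)

definition diag_mat :: "('n \<Rightarrow> 'a::zero) \<Rightarrow> 'a ^ 'n ^ 'n" where
  "diag_mat d = (\<chi> i j. if i = j then d i else 0)"

text \<open>The principal minor with index set I, written as a determinant of full size with
  identity rows and columns outside I. All minors thus live on the same index type.\<close>

definition pminor :: "'a::comm_ring_1 ^ 'n ^ 'n \<Rightarrow> 'n set \<Rightarrow> 'a" where
  "pminor A I = det (\<chi> i j. if i \<in> I \<and> j \<in> I then A $ i $ j else if i = j then 1 else 0)"

definition pminor_sum :: "nat \<Rightarrow> 'a::comm_ring_1 ^ 'n ^ 'n \<Rightarrow> 'a" where
  "pminor_sum k A = (\<Sum>I | card I = k. pminor A I)"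

text \<open>Only permutations that fix the complement of I pointwise contribute to the Leibniz sum.
  They map I to itself, so the condition on the columns may be dropped; this is the form in which an
  expansion by rows produces minors.\<close>

lemma pminor_eq_row_mask:
  fixes A :: "'a::comm_ring_1 ^ 'n ^ 'n"
  shows "pminor A I = (\<Sum>p | p permutes UNIV. of_int (sign p) *
           ((\<Prod>i\<in>I. A $ i $ p i) * (\<Prod>i\<in>-I. if i = p i then 1 else 0)))"
  unfolding pminor_def det_def
proof (intro sum.cong refl arg_cong2[of _ _ _ _ "(*)"])
  fix p :: "'n \<Rightarrow> 'n" assume "p \<in> {p. p permutes UNIV}"
  hence p: "p permutes UNIV" by simp
  let ?m = "\<lambda>i j. if i \<in> I \<and> j \<in> I then A $ i $ j else if i = j then 1 else 0"
  have "(\<Prod>i\<in>UNIV. (\<chi> i j. ?m i j) $ i $ p i) = (\<Prod>i\<in>UNIV. ?m i (p i))" by simp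
  also have "\<dots> = (\<Prod>i\<in>I. ?m i (p i)) * (\<Prod>i\<in>-I. ?m i (p i))"
    using prod.union_disjoint[of I "-I" "\<lambda>i. ?m i (p i)"] by (simp add: Compl_partition)
  also have "(\<Prod>i\<in>-I. ?m i (p i)) = (\<Prod>i\<in>-I. if i = p i then 1 else 0)"
    by (intro prod.cong) auto
  also have "(\<Prod>i\<in>I. ?m i (p i)) * (\<Prod>i\<in>-I. if i = p i then 1 else 0)
      = (\<Prod>i\<in>I. A $ i $ p i) * (\<Prod>i\<in>-I. if i = p i then 1 else 0)"
  proof (cases "\<forall>i\<in>-I. p i = i")
    case True
    have "p i \<in> I" if "i \<in> I" for i
      using True that permutes_inj[OF p] by (metis ComplI injD)
    thus ?thesis by simp
  next
    case False
    hence "(\<Prod>i\<in>-I. if i = p i then 1 else 0 :: 'a) = 0"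
      by (intro prod_zero) (auto, metis ComplI)
    thus ?thesis by simp
  qed
  finally show "(\<Prod>i\<in>UNIV. (\<chi> i j. ?m i j) $ i $ p i) = \<dots>" .
qed

text \<open>Each factor of a Leibniz product is a sum of two terms; I collects the rows that
  contribute the entry of A. The version with both a and b covers det(1 + t A), det(A + t) and the
  characteristic polynomial.\<close>

lemma det_scalar_plus:
  fixes A :: "'a::comm_ring_1 ^ 'n ^ 'n"
  shows "det (\<chi> i j. (if i = j then a else 0) + b * A $ i $ j) =
         (\<Sum>k\<le>CARD('n). a ^ (CARD('n) - k) * b ^ k * pminor_sum k A)"
proof -
  have expand: "(\<Prod>i\<in>UNIV. (if i = p i then a else 0) + b * A $ i $ p i)
     = (\<Sum>I\<in>UNIV. a ^ (CARD('n) - card I) * b ^ card I *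
          ((\<Prod>i\<in>I. A $ i $ p i) * (\<Prod>i\<in>-I. if i = p i then 1 else 0)))" for p :: "'n \<Rightarrow> 'n"
  proof -
    have "(\<Prod>i\<in>UNIV. (if i = p i then a else 0) + b * A $ i $ p i)
        = (\<Prod>i\<in>UNIV. b * A $ i $ p i + (if i = p i then a else 0))" by (simp add: add.commute)
    also have "\<dots> = (\<Sum>I\<in>Pow UNIV. (\<Prod>i\<in>I. b * A $ i $ p i) * (\<Prod>i\<in>UNIV-I. if i = p i then a else 0))"
      by (rule prod_add) simp
    also have "\<dots> = (\<Sum>I\<in>UNIV. a ^ (CARD('n) - card I) * b ^ card I *
          ((\<Prod>i\<in>I. A $ i $ p i) * (\<Prod>i\<in>-I. if i = p i then 1 else 0)))"
    proof (intro sum.cong)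
      fix I :: "'n set"
      have "(\<Prod>i\<in>UNIV-I. if i = p i then a else 0) = (\<Prod>i\<in>-I. a * (if i = p i then 1 else 0))"
        by (intro prod.cong) auto
      also have "\<dots> = a ^ (CARD('n) - card I) * (\<Prod>i\<in>-I. if i = p i then 1 else 0)"
        by (simp add: prod.distrib Compl_eq_Diff_UNIV card_Diff_subset)
      finally show "(\<Prod>i\<in>I. b * A $ i $ p i) * (\<Prod>i\<in>UNIV-I. if i = p i then a else 0)
          = a ^ (CARD('n) - card I) * b ^ card I *
          ((\<Prod>i\<in>I. A $ i $ p i) * (\<Prod>i\<in>-I. if i = p i then 1 else 0))"
        by (simp add: prod.distrib ac_simps)
    qed auto
    finally show ?thesis .
  qed
  have "det (\<chi> i j. (if i = j then a else 0) + b * A $ i $ j) =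
     (\<Sum>p | p permutes UNIV. \<Sum>I\<in>UNIV. a ^ (CARD('n) - card I) * b ^ card I *
       (of_int (sign p) * ((\<Prod>i\<in>I. A $ i $ p i) * (\<Prod>i\<in>-I. if i = p i then 1 else 0))))"
    unfolding det_def
  proof (rule sum.cong[OF refl])
    fix p :: "'n \<Rightarrow> 'n"
    have "(\<Prod>i\<in>UNIV. (\<chi> i j. (if i = j then a else 0) + b * A $ i $ j) $ i $ p i)
        = (\<Prod>i\<in>UNIV. (if i = p i then a else 0) + b * A $ i $ p i)" by simp
    thus "of_int (sign p) * (\<Prod>i\<in>UNIV. (\<chi> i j. (if i = j then a else 0) + b * A $ i $ j) $ i $ p i)
      = (\<Sum>I\<in>UNIV. a ^ (CARD('n) - card I) * b ^ card I *
       (of_int (sign p) * ((\<Prod>i\<in>I. A $ i $ p i) * (\<Prod>i\<in>-I. if i = p i then 1 else 0))))"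
      by (simp add: expand sum_distrib_left mult.left_commute[of "of_int (sign p)"])
  qed
  also have "\<dots> = (\<Sum>I\<in>UNIV. a ^ (CARD('n) - card I) * b ^ card I * pminor A I)"
    by (subst sum.swap) (simp add: pminor_eq_row_mask sum_distrib_left)
  also have "\<dots> = (\<Sum>k\<le>CARD('n). \<Sum>I | I \<in> UNIV \<and> card I = k.
       a ^ (CARD('n) - card I) * b ^ card I * pminor A I)"
    by (rule sum.group[symmetric]) (auto intro: card_mono)
  also have "\<dots> = (\<Sum>k\<le>CARD('n). a ^ (CARD('n) - k) * b ^ k * pminor_sum k A)"
    by (intro sum.cong) (auto simp: pminor_sum_def sum_distrib_left)
  finally show ?thesis .
qed

text \<open>Minors are integer polynomials in the entries. The maps in question are the embedding of
  the reals and the constant polynomials, as needed for the complex characteristic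
  polynomial.\<close>

lemma pminor_hom:
  fixes A :: "'a::comm_ring_1 ^ 'n ^ 'n" and h :: "'a \<Rightarrow> 'b::comm_ring_1"
  assumes h: "\<And>x y. h (x + y) = h x + h y" "\<And>x y. h (x * y) = h x * h y" "h 1 = 1"
  shows "pminor (\<chi> i j. h (A $ i $ j)) I = h (pminor A I)"
proof -
  have h0: "h 0 = 0" using h(1)[of 0 0] by simp
  have hm: "h (- x) = - h x" for x
    using h(1)[of x "-x"] h0 by (simp add: eq_neg_iff_add_eq_0 add.commute)
  have hsum: "h (sum f S) = (\<Sum>x\<in>S. h (f x))" for f :: "'c \<Rightarrow> 'a" and S
    by (induction S rule: infinite_finite_induct) (auto simp: h h0)
  have hprod: "h (prod f S) = (\<Prod>x\<in>S. h (f x))" for f :: "'c \<Rightarrow> 'a" and S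
    by (induction S rule: infinite_finite_induct) (auto simp: h h0)
  have hsign: "h (of_int (sign p)) = of_int (sign p)" for p :: "'n \<Rightarrow> 'n"
    by (cases p rule: sign_cases) (auto simp: h hm)
  have hif: "h (if P then x else y) = (if P then h x else h y)" for P x y by simp
  show ?thesis
    unfolding pminor_eq_row_mask hsum h(2) hprod hsign hif h(3) h0 by simp
qed

lemma pminor_sum_of_real:
  fixes A :: "real ^ 'n ^ 'n"
  shows "pminor_sum k (\<chi> i j. (of_real (A $ i $ j) :: 'a::{real_algebra_1,comm_ring_1})) = of_real (pminor_sum k A)"
proof -
  have "pminor (\<chi> i j. (of_real (A $ i $ j) :: 'a)) I = of_real (pminor A I)" for I
    by (rule pminor_hom) auto
  thus ?thesis by (simp add: pminor_sum_def)
qed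

lemma pminor_sum_const_poly:
  fixes A :: "'a::comm_ring_1 ^ 'n ^ 'n"
  shows "pminor_sum k (\<chi> i j. [:A $ i $ j:]) = [:pminor_sum k A:]"
proof -
  have "pminor (\<chi> i j. [:A $ i $ j:]) I = [:pminor A I:]" for I
    by (rule pminor_hom) (auto simp: one_pCons)
  hence "pminor_sum k (\<chi> i j. [:A $ i $ j:]) = (\<Sum>I | card I = k. [:pminor A I:])"
    by (simp add: pminor_sum_def)
  also have "\<dots> = [:pminor_sum k A:]"
    unfolding pminor_sum_def by (induction rule: infinite_finite_induct) auto
  finally show ?thesis .
qed

lemma pminor_sum_eq_0:
  assumes "k > CARD('n)"
  shows "pminor_sum k (A :: 'a::comm_ring_1 ^ 'n ^ 'n) = 0"
proof -
  have "{I :: 'n set. card I = k} = {}"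
    using assms card_mono[of "UNIV :: 'n set"] by (auto simp: not_le[symmetric])
  thus ?thesis by (simp add: pminor_sum_def)
qed

lemma det_one_plus:
  fixes A :: "real ^ 'n ^ 'n"
  shows "det (mat 1 + t *\<^sub>R A) = (\<Sum>k\<le>CARD('n). pminor_sum k A * t ^ k)"
proof -
  have "mat 1 + t *\<^sub>R A = (\<chi> i j. (if i = j then 1 else 0) + t * A $ i $ j)"
    by (simp add: vec_eq_iff mat_def)
  thus ?thesis using det_scalar_plus[of 1 t A] by (simp add: ac_simps)
qed

lemma det_plus_scalar:
  fixes A :: "real ^ 'n ^ 'n"
  shows "det (A + t *\<^sub>R mat 1) = (\<Sum>k\<le>CARD('n). pminor_sum k A * t ^ (CARD('n) - k))"
proof -
  have "A + t *\<^sub>R mat 1 = (\<chi> i j. (if i = j then t else 0) + 1 * A $ i $ j)"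
    by (simp add: vec_eq_iff mat_def)
  thus ?thesis using det_scalar_plus[of t 1 A] by (simp add: ac_simps)
qed

lemma pminor_sum_eqI:
  fixes A B :: "real ^ 'n ^ 'n"
  assumes "\<And>t. det (mat 1 + t *\<^sub>R A) = det (mat 1 + t *\<^sub>R B)"
  shows "pminor_sum k A = pminor_sum k B"
proof (cases "k \<le> CARD('n)")
  case True
  have "\<forall>t. (\<Sum>k\<le>CARD('n). pminor_sum k A * t ^ k) = (\<Sum>k\<le>CARD('n). pminor_sum k B * t ^ k)"
    using assms unfolding det_one_plus by blast
  thus ?thesis using True unfolding polyfun_eq_coeffs by blast
qed (simp add: pminor_sum_eq_0)

lemma pminor_sum_similar:
  fixes A V W :: "real ^ 'n ^ 'n"
  assumes "V ** W = mat 1"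
  shows "pminor_sum k (W ** A ** V) = pminor_sum k A"
proof (rule pminor_sum_eqI)
  fix t
  have WV: "W ** V = mat 1" using assms matrix_left_right_inverse by blast
  have "W ** (mat 1 + t *\<^sub>R A) ** V = mat 1 + t *\<^sub>R (W ** A ** V)"
    by (simp add: matrix_add_ldistrib matrix_add_rdistrib WV matrix_scalar_ac scalar_matrix_assoc)
  hence "det (mat 1 + t *\<^sub>R (W ** A ** V)) = det W * det (mat 1 + t *\<^sub>R A) * det V"
    by (metis det_mul)
  also have "\<dots> = det (W ** V) * det (mat 1 + t *\<^sub>R A)" by (simp add: det_mul)
  finally show "det (mat 1 + t *\<^sub>R (W ** A ** V)) = det (mat 1 + t *\<^sub>R A)" by (simp add: WV)
qed

lemma pminor_sum_commute:
  fixes A B :: "real ^ 'n ^ 'n"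
  assumes "invertible A"
  shows "pminor_sum k (A ** B) = pminor_sum k (B ** A)"
proof -
  obtain A' where A': "A ** A' = mat 1" "A' ** A = mat 1" using assms by (auto simp: invertible_def)
  have "pminor_sum k (A ** B) = pminor_sum k (A' ** (A ** B) ** A)"
    by (rule pminor_sum_similar[symmetric]) (rule A')
  also have "A' ** (A ** B) ** A = B ** A" by (simp add: matrix_mul_assoc A')
  finally show ?thesis .
qed

text \<open>Masking the product with \<open>diag_mat d\<close> gives the masked matrix of A times a
  diagonal matrix that carries 1 outside I; then the determinant is multiplicative.\<close>

lemma pminor_diag_right:
  fixes A :: "'a::comm_ring_1 ^ 'n ^ 'n"
  shows "pminor (A ** diag_mat d) I = pminor A I * (\<Prod>i\<in>I. d i)"
proof -
  let ?d = "\<lambda>i. if i \<in> I then d i else 1"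
  let ?M = "\<chi> i j. if i \<in> I \<and> j \<in> I then A $ i $ j else if i = j then 1 else 0"
  have mul: "(B ** diag_mat e) $ i $ j = B $ i $ j * e j" for B :: "'a ^ 'n ^ 'n" and e i j
    by (simp add: matrix_matrix_mult_def diag_mat_def if_distrib[of "\<lambda>x. _ * x"] cong: if_cong)
  have "pminor (A ** diag_mat d) I = det (?M ** diag_mat ?d)"
    unfolding pminor_def by (intro arg_cong[of _ _ det]) (auto simp: vec_eq_iff mul)
  also have "\<dots> = pminor A I * det (diag_mat ?d)" by (simp add: det_mul pminor_def)
  also have "det (diag_mat ?d) = (\<Prod>i\<in>UNIV. ?d i)"
    by (subst det_diagonal) (auto simp: diag_mat_def)
  also have "\<dots> = (\<Prod>i\<in>I. d i)" by (simp add: prod.If_cases)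
  finally show ?thesis .
qed

lemma pminor_mat_1 [simp]: "pminor (mat 1 :: 'a::comm_ring_1 ^ 'n ^ 'n) I = 1"
proof -
  have "(\<chi> i j. if i \<in> I \<and> j \<in> I then (mat 1 :: 'a ^ 'n ^ 'n) $ i $ j else if i = j then 1 else 0) = mat 1"
    by (auto simp: vec_eq_iff mat_def)
  thus ?thesis by (simp add: pminor_def)
qed

lemma pminor_sum_diag_right:
  "pminor_sum k (A ** diag_mat d) = (\<Sum>I | card I = k. pminor A I * (\<Prod>i\<in>I. d i))"
  by (simp add: pminor_sum_def pminor_diag_right)

lemma pminor_sum_diag: "pminor_sum k (diag_mat d) = esym k d"
  using pminor_sum_diag_right[of k "mat 1" d] by (simp add: esym_def)

lemma pminor_sum_CARD: "pminor_sum CARD('n) (A :: 'a::comm_ring_1 ^ 'n ^ 'n) = det A"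
proof -
  have "{I :: 'n set. card I = CARD('n)} = {UNIV}" 
    using card_subset_eq[of "UNIV :: 'n set"] by (metis (mono_tags) Collect_cong finite subset_UNIV singleton_conv)
  moreover have "pminor A UNIV = det A" by (simp add: pminor_def)
  ultimately show ?thesis by (simp add: pminor_sum_def)
qed

lemma esym_CARD: "esym CARD('n) (z :: 'n::finite \<Rightarrow> 'a::comm_semiring_1) = (\<Prod>i\<in>UNIV. z i)"
proof -
  have "{I :: 'n set. card I = CARD('n)} = {UNIV}" 
    using card_subset_eq[of "UNIV :: 'n set"] by (metis (mono_tags) Collect_cong finite subset_UNIV singleton_conv)
  thus ?thesis by (simp add: esym_def)
qed

lemma sum_card_1: "(\<Sum>I | card (I :: 'n::finite set) = 1. f I) = (\<Sum>i\<in>UNIV. f {i})"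
proof -
  have "{I :: 'n set. card I = 1} = range (\<lambda>i. {i})" by (auto simp: card_1_singleton_iff)
  thus ?thesis by (simp add: sum.reindex inj_on_def)
qed

lemma pminor_sum_1: "pminor_sum 1 (A :: 'a::comm_ring_1 ^ 'n ^ 'n) = trace A"
proof -
  have "pminor A {i} = A $ i $ i" for i
  proof -
    let ?M = "\<chi> j k. if j \<in> {i} \<and> k \<in> {i} then A $ j $ k else if j = k then 1 else 0"
    have "pminor A {i} = (\<Prod>j\<in>UNIV. ?M $ j $ j)"
      unfolding pminor_def by (rule det_diagonal) auto
    also have "\<dots> = (\<Prod>j\<in>UNIV. if j = i then A $ j $ j else 1)"
      by (rule prod.cong) auto
    also have "\<dots> = A $ i $ i" by simp
    finally show ?thesis .
  qed
  thus ?thesis by (simp only: pminor_sum_def sum_card_1 trace_def)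
qed

lemma esym_1: "esym 1 (z :: 'n::finite \<Rightarrow> 'a::comm_semiring_1) = (\<Sum>i\<in>UNIV. z i)"
  by (simp only: esym_def sum_card_1) simp

text \<open>With B the inverse of A, compare coefficients of t in det(1 + t A) = det A * det(B + t).
  The case k = 1 expresses the trace of the inverse.\<close>

lemma pminor_sum_inverse:
  fixes A B :: "real ^ 'n ^ 'n"
  assumes "A ** B = mat 1" "k \<le> CARD('n)"
  shows "pminor_sum (CARD('n) - k) A = det A * pminor_sum k B"
proof -
  have "(\<Sum>j\<le>CARD('n). pminor_sum j A * t ^ j)
      = (\<Sum>j\<le>CARD('n). det A * pminor_sum (CARD('n) - j) B * t ^ j)" for t
  proof -
    have "mat 1 + t *\<^sub>R A = A ** (B + t *\<^sub>R mat 1)"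
      by (simp add: matrix_add_ldistrib assms(1) matrix_scalar_ac)
    hence "det (mat 1 + t *\<^sub>R A) = det A * det (B + t *\<^sub>R mat 1)" by (simp only: det_mul)
    also have "\<dots> = (\<Sum>j\<le>CARD('n). det A * pminor_sum j B * t ^ (CARD('n) - j))"
      by (simp add: det_plus_scalar sum_distrib_left ac_simps)
    also have "\<dots> = (\<Sum>j\<le>CARD('n). det A * pminor_sum (CARD('n) - j) B * t ^ j)"
      by (rule sum.reindex_bij_witness[of _ "\<lambda>j. CARD('n) - j" "\<lambda>j. CARD('n) - j"]) auto
    finally show ?thesis unfolding det_one_plus .
  qed
  hence "\<forall>j\<le>CARD('n). pminor_sum j A = det A * pminor_sum (CARD('n) - j) B"
    by (subst polyfun_eq_coeffs[symmetric]) auto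
  thus ?thesis using assms(2) by simp
qed

text \<open>The eigenvalues with multiplicity as an unordered family over the index type, described
  by Vieta's relations. These are polynomial equations between z and the entries of A, which gives
  both stability under perturbation and a closed graph.\<close>

definition eigvals :: "real ^ 'n ^ 'n \<Rightarrow> ('n \<Rightarrow> complex) \<Rightarrow> bool" where
  "eigvals A z \<longleftrightarrow> (\<forall>k. esym k z = of_real (pminor_sum k A))"

lemma complex_charpoly_eq:
  fixes A :: "real ^ 'n ^ 'n"
  shows "complex_charpoly A = (\<Sum>k\<le>CARD('n). monom ((-1) ^ k * of_real (pminor_sum k A)) (CARD('n) - k))"
proof -
  let ?X = "[:0, 1:] :: complex poly"
  let ?C = "\<chi> i j. complex_of_real (A $ i $ j)"
  have "mat ?X - (\<chi> i j. [:complex_of_real (A $ i $ j):])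
      = (\<chi> i j. (if i = j then ?X else 0) + (-1) * (\<chi> i j. [:?C $ i $ j:]) $ i $ j)"
    by (simp add: vec_eq_iff mat_def)
  hence "complex_charpoly A = (\<Sum>k\<le>CARD('n). ?X ^ (CARD('n) - k) * (-1) ^ k *
            pminor_sum k (\<chi> i j. [:?C $ i $ j:]))"
    unfolding complex_charpoly_def by (simp only: det_scalar_plus)
  also have "\<dots> = (\<Sum>k\<le>CARD('n). monom ((-1) ^ k * of_real (pminor_sum k A)) (CARD('n) - k))"
  proof (intro sum.cong refl)
    fix k
    have c: "(-1) ^ k = [:(-1) ^ k :: complex:]" by (induction k) (auto simp: one_pCons)
    show "?X ^ (CARD('n) - k) * (-1) ^ k * pminor_sum k (\<chi> i j. [:?C $ i $ j:])
        = monom ((-1) ^ k * of_real (pminor_sum k A)) (CARD('n) - k)"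
      unfolding pminor_sum_const_poly pminor_sum_of_real c
      by (simp add: monom_altdef mult.commute)
  qed
  finally show ?thesis .
qed

lemma prod_linear_esym:
  fixes z :: "'n::finite \<Rightarrow> complex"
  shows "(\<Prod>i\<in>UNIV. [:- z i, 1:]) = (\<Sum>k\<le>CARD('n). monom ((-1) ^ k * esym k z) (CARD('n) - k))"
proof -
  let ?X = "[:0, 1:] :: complex poly"
  have "(\<Prod>i\<in>UNIV. [:- z i, 1:]) = (\<Prod>i\<in>UNIV. [:- z i:] + ?X)" by simp
  also have "\<dots> = (\<Sum>I\<in>Pow UNIV. (\<Prod>i\<in>I. [:- z i:]) * (\<Prod>i\<in>UNIV - I. ?X))"
    by (rule prod_add) simp
  also have "\<dots> = (\<Sum>I\<in>UNIV. monom (\<Prod>i\<in>I. - z i) (CARD('n) - card I))"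
  proof (intro sum.cong)
    fix I :: "'n set"
    have c: "(\<Prod>i\<in>I. [:- z i:]) = [:\<Prod>i\<in>I. - z i:]"
      by (induction I rule: infinite_finite_induct) (auto simp: one_pCons)
    have "card (UNIV - I) = CARD('n) - card I" by (simp add: card_Diff_subset)
    thus "(\<Prod>i\<in>I. [:- z i:]) * (\<Prod>i\<in>UNIV - I. ?X) = monom (\<Prod>i\<in>I. - z i) (CARD('n) - card I)"
      unfolding c by (simp add: monom_altdef)
  qed auto
  also have "\<dots> = (\<Sum>k\<le>CARD('n). \<Sum>I | I \<in> UNIV \<and> card I = k. monom (\<Prod>i\<in>I. - z i) (CARD('n) - card I))"
    by (rule sum.group[symmetric]) (auto intro: card_mono)
  also have "\<dots> = (\<Sum>k\<le>CARD('n). monom ((-1) ^ k * esym k z) (CARD('n) - k))"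
    by (intro sum.cong) (auto simp: esym_def prod_uminus monom_sum sum_distrib_left)
  finally show ?thesis .
qed

lemma eigvals_iff_charpoly:
  fixes A :: "real ^ 'n ^ 'n"
  shows "eigvals A z \<longleftrightarrow> complex_charpoly A = (\<Prod>i\<in>UNIV. [:- z i, 1:])"
proof
  assume "eigvals A z"
  thus "complex_charpoly A = (\<Prod>i\<in>UNIV. [:- z i, 1:])"
    by (simp add: eigvals_def complex_charpoly_eq prod_linear_esym)
next
  assume eq: "complex_charpoly A = (\<Prod>i\<in>UNIV. [:- z i, 1:])"
  have coeff: "coeff (\<Sum>k\<le>CARD('n). monom (c k) (CARD('n) - k)) (CARD('n) - j) = c j"
    if "j \<le> CARD('n)" for j and c :: "nat \<Rightarrow> complex"
  proof -
    have "coeff (\<Sum>k\<le>CARD('n). monom (c k) (CARD('n) - k)) (CARD('n) - j)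
        = (\<Sum>k\<le>CARD('n). if k = j then c k else 0)"
      unfolding coeff_sum coeff_monom using that by (intro sum.cong) auto
    thus ?thesis using that by simp
  qed
  show "eigvals A z"
    unfolding eigvals_def
  proof
    fix k show "esym k z = of_real (pminor_sum k A)"
    proof (cases "k \<le> CARD('n)")
      case True
      have "(-1) ^ k * complex_of_real (pminor_sum k A) = (-1) ^ k * esym k z"
        using arg_cong[OF eq, of "\<lambda>p. coeff p (CARD('n) - k)"]
        unfolding complex_charpoly_eq prod_linear_esym coeff[OF True] .
      thus ?thesis by simp
    qed (simp add: esym_eq_0 pminor_sum_eq_0)
  qed
qed

lemma proots_prod_linear:
  fixes z :: "'n::finite \<Rightarrow> complex"
  shows "proots (\<Prod>i\<in>UNIV. [:- z i, 1:]) = image_mset z (mset_set UNIV)"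
proof -
  have "proots (\<Prod>i\<in>UNIV. [:- z i, 1:]) = (\<Sum>i\<in>UNIV. proots [:- z i, 1:])"
    by (rule proots_prod) auto
  also have "\<dots> = (\<Sum>i\<in>UNIV. {#z i#})" by simp
  also have "\<dots> = image_mset z (mset_set UNIV)"
    by (simp add: sum_unfold_sum_mset)
  finally show ?thesis .
qed

lemma degree_complex_charpoly:
  fixes A :: "real ^ 'n ^ 'n"
  shows "degree (complex_charpoly A) = CARD('n)" "lead_coeff (complex_charpoly A) = 1"
proof -
  let ?n = "CARD('n)"
  have c: "coeff (complex_charpoly A) ?n = 1"
  proof -
    have "coeff (complex_charpoly A) ?n
        = (\<Sum>k\<le>?n. if k = 0 then (-1) ^ k * of_real (pminor_sum k A) else 0)"
      unfolding complex_charpoly_eq coeff_sum coeff_monom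
      by (intro sum.cong refl) auto
    also have "\<dots> = of_real (pminor_sum 0 A)" by simp
    also have "pminor_sum 0 A = 1" 
    proof -
      have "{I :: 'n set. card I = 0} = {{}}" by auto
      moreover have "(\<chi> i j. (if i = j then 1 else 0)) = (mat 1 :: real^'n^'n)"
        by (simp add: vec_eq_iff mat_def)
      ultimately show ?thesis by (simp add: pminor_sum_def pminor_def)
    qed
    finally show ?thesis by simp
  qed
  have "degree (complex_charpoly A) \<le> ?n"
    unfolding complex_charpoly_eq
    by (intro degree_sum_le) (auto intro: order_trans[OF degree_monom_le])
  moreover have "?n \<le> degree (complex_charpoly A)" by (rule le_degree) (simp add: c)
  ultimately show "degree (complex_charpoly A) = ?n" by simp
  thus "lead_coeff (complex_charpoly A) = 1" by (simp add: c)
qed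

lemma eigvals_exist:
  fixes A :: "real ^ 'n ^ 'n"
  shows "\<exists>z. eigvals A z"
proof -
  let ?p = "complex_charpoly A" and ?n = "CARD('n)"
  obtain zs where zs: "mset zs = proots ?p" using ex_mset by blast
  have len: "length zs = ?n"
    using zs size_proots_complex[of ?p] degree_complex_charpoly(1)[of A] by (metis size_mset)
  obtain h where h: "bij_betw h (UNIV :: 'n set) {0..<?n}"
    using ex_bij_betw_finite_nat[of "UNIV :: 'n set"] by auto
  have "(\<Prod>i\<in>UNIV. [:- (zs ! h i), 1:]) = (\<Prod>j\<in>{0..<?n}. [:- (zs ! j), 1:])"
    by (rule prod.reindex_bij_betw[OF h, of "\<lambda>j. [:- (zs ! j), 1:]"])
  also have "\<dots> = (\<Prod>x\<leftarrow>zs. [:- x, 1:])"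
    by (simp add: prod.list_conv_set_nth len)
  also have "\<dots> = (\<Prod>x\<in>#mset zs. [:- x, 1:])"
    by (simp flip: prod_mset_prod_list)
  also have "\<dots> = ?p"
    using complex_poly_decompose_multiset[of ?p] degree_complex_charpoly(2)[of A] by (simp add: zs)
  finally show ?thesis unfolding eigvals_iff_charpoly by metis
qed

section \<open>Singular values and the orthogonal group\<close>

lemma diag_mat_nth: "diag_mat d $ i $ j = (if i = j then d i else 0)"
  by (simp add: diag_mat_def)

lemma diag_mat_mult: "diag_mat a ** diag_mat b = diag_mat (\<lambda>i. a i * b i :: 'a::semiring_1)"
  by (simp add: vec_eq_iff matrix_matrix_mult_def diag_mat_nth if_distrib[of "\<lambda>x. _ * x"] cong: if_cong)

lemma diag_mat_one: "diag_mat (\<lambda>i. 1) = mat 1"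
  by (simp add: vec_eq_iff diag_mat_nth mat_def)

lemma transpose_diag_mat [simp]: "transpose (diag_mat d) = diag_mat d"
  by (auto simp: vec_eq_iff diag_mat_nth transpose_def)

lemma diag_mat_mult_nth: "(diag_mat d ** A) $ i $ j = d i * (A $ i $ j :: 'a::semiring_1)"
proof -
  have "(diag_mat d ** A) $ i $ j = (\<Sum>k\<in>UNIV. if i = k then d i * A $ k $ j else 0)"
    by (simp add: matrix_matrix_mult_def diag_mat_nth if_distrib[of "\<lambda>x. x * _"] cong: if_cong)
  thus ?thesis by simp
qed

lemma mult_diag_mat_nth: "(A ** diag_mat d) $ i $ j = (A $ i $ j :: 'a::semiring_1) * d j"
proof -
  have "(A ** diag_mat d) $ i $ j = (\<Sum>k\<in>UNIV. if k = j then A $ i $ k * d j else 0)"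
  proof -
    have "(A ** diag_mat d) $ i $ j = (\<Sum>k\<in>UNIV. A $ i $ k * diag_mat d $ k $ j)"
      by (simp add: matrix_matrix_mult_def)
    also have "\<dots> = (\<Sum>k\<in>UNIV. if k = j then A $ i $ k * d j else 0)"
      by (intro sum.cong) (auto simp: diag_mat_nth)
    finally show ?thesis .
  qed
  thus ?thesis by simp
qed

lemma det_diag_mat: "det (diag_mat d :: 'a::comm_ring_1 ^ 'n ^ 'n) = (\<Prod>i\<in>UNIV. d i)"
  by (subst det_diagonal) (auto simp: diag_mat_nth)

section \<open>The spectral theorem for real symmetric matrices\<close>

lemma inner_symmetric_matrix:
  fixes A :: "real ^ 'n ^ 'n"
  assumes "transpose A = A"
  shows "x \<bullet> (A *v y) = (A *v x) \<bullet> y"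
  by (metis assms dot_lmul_matrix transpose_matrix_vector)

lemma linear_coeff_zero:
  fixes b c :: real
  assumes "\<And>t. 2 * t * b + t^2 * c \<le> 0"
  shows "b = 0"
proof (rule ccontr)
  assume b: "b \<noteq> 0"
  \<comment> \<open>With t = b / s the linear term dominates: the expression becomes
    \<open>(b^2 / s) * (2 + c / s)\<close>, where c / s \<ge> -1.\<close>
  define s where "s = \<bar>c\<bar> + 1"
  have s: "s > 0" "- s \<le> c" by (auto simp: s_def)
  define t where "t = b / s"
  have "2 * t * b + t^2 * c = (b^2 / s) * (2 + c / s)"
    using s(1) by (simp add: t_def power2_eq_square field_simps)
  moreover have "c / s \<ge> -1" using s by (simp add: field_simps)
  hence "2 + c / s > 0" by linarith
  moreover have "b^2 / s > 0" using b s by simp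
  ultimately show False using assms[of t] by (metis mult_pos_pos not_less)
qed

text \<open>A maximizer x of the quadratic form on the compact unit sphere of S is an eigenvector.
  The first variation in every direction of S vanishes, so \<open>A *v x - l *\<^sub>R x\<close> is
  orthogonal to S; by invariance it also lies in S.\<close>

lemma symmetric_eigenvector_in_subspace:
  fixes A :: "real ^ 'n ^ 'n"
  assumes A: "transpose A = A" and S: "subspace S" "S \<noteq> {0}" "\<And>x. x \<in> S \<Longrightarrow> A *v x \<in> S"
  shows "\<exists>x\<in>S. \<exists>l. norm x = 1 \<and> A *v x = l *\<^sub>R x"
proof -
  let ?q = "\<lambda>x. x \<bullet> (A *v x)"
  have "0 \<in> S" using S(1) by (rule subspace_0)
  then obtain v where v: "v \<in> S" "v \<noteq> 0" using S(2) by auto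
  let ?K = "S \<inter> sphere 0 1"
  have "(1 / norm v) *\<^sub>R v \<in> ?K" using v S(1) by (auto intro: subspace_scale)
  hence "?K \<noteq> {}" by blast
  moreover have "compact ?K"
    using closed_subspace[OF S(1)] by (intro closed_Int_compact) auto
  moreover have "continuous_on ?K ?q"
    by (intro continuous_intros linear_continuous_on matrix_vector_mul_bounded_linear)
  ultimately obtain x where x: "x \<in> ?K" "\<And>y. y \<in> ?K \<Longrightarrow> ?q y \<le> ?q x"
    using continuous_attains_sup[of ?K ?q] by blast
  define l where "l = ?q x"
  have le: "?q y \<le> l * (y \<bullet> y)" if "y \<in> S" for y
  proof (cases "y = 0")
    case False
    let ?y = "(1 / norm y) *\<^sub>R y"
    have "?y \<in> ?K" using False that S(1) by (auto intro: subspace_scale)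
    hence "?q ?y \<le> l" using x(2) l_def by blast
    moreover have "?q (c *\<^sub>R y) = c^2 * ?q y" for c
      by (simp add: matrix_vector_mult_scaleR power2_eq_square)
    ultimately have "(1 / norm y)^2 * ?q y \<le> l" by metis
    thus ?thesis using False
      by (simp add: field_simps dot_square_norm power_divide)
  qed simp
  have ort: "y \<bullet> (A *v x - l *\<^sub>R x) = 0" if y: "y \<in> S" for y
  proof -
    have "2 * t * (y \<bullet> (A *v x - l *\<^sub>R x)) + t^2 * (?q y - l * (y \<bullet> y)) \<le> 0" for t
    proof -
      have "x + t *\<^sub>R y \<in> S" using x y S(1) by (auto intro: subspace_add subspace_scale)
      note le = le[OF this]
      have q: "?q (x + t *\<^sub>R y) = ?q x + 2 * t * (y \<bullet> (A *v x)) + t^2 * ?q y"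
        using inner_symmetric_matrix[OF A, of x y]
        by (simp add: matrix_vector_right_distrib matrix_vector_mult_scaleR inner_add_left
              inner_add_right power2_eq_square inner_commute algebra_simps)
      have n: "(x + t *\<^sub>R y) \<bullet> (x + t *\<^sub>R y) = 1 + 2 * t * (y \<bullet> x) + t^2 * (y \<bullet> y)"
      proof -
        have "x \<bullet> x = 1" using x(1) by (simp add: dot_square_norm)
        thus ?thesis
          by (simp add: inner_add_left inner_add_right power2_eq_square inner_commute algebra_simps)
      qed
      have "l + 2 * t * (y \<bullet> (A *v x)) + t^2 * ?q y \<le> l * (1 + 2 * t * (y \<bullet> x) + t^2 * (y \<bullet> y))"
        using le unfolding q n l_def[symmetric] .
      thus ?thesis by (simp add: inner_diff_right algebra_simps)
    qed
    thus ?thesis by (rule linear_coeff_zero)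
  qed
  have "A *v x - l *\<^sub>R x \<in> S" using x S by (auto intro: subspace_diff subspace_scale)
  from ort[OF this] have "A *v x - l *\<^sub>R x = 0" by simp
  hence "A *v x = l *\<^sub>R x" by simp
  thus ?thesis using x(1) by auto
qed

text \<open>Induction on the dimension: by symmetry, the vectors of S orthogonal to an eigenvector
  again form an invariant subspace.\<close>

lemma symmetric_orthonormal_eigenbasis:
  fixes A :: "real ^ 'n ^ 'n"
  assumes A: "transpose A = A" and "subspace S" "\<And>x. x \<in> S \<Longrightarrow> A *v x \<in> S"
  shows "\<exists>B. pairwise orthogonal B \<and> (\<forall>b\<in>B. norm b = 1 \<and> (\<exists>l. A *v b = l *\<^sub>R b)) \<and> span B = S"
  using assms(2,3)
proof (induction "dim S" arbitrary: S rule: less_induct)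
  case less
  show ?case
  proof (cases "S = {0}")
    case True
    thus ?thesis by (intro exI[of _ "{}"]) auto
  next
    case False
    obtain x l where x: "x \<in> S" "norm x = 1" "A *v x = l *\<^sub>R x"
      using symmetric_eigenvector_in_subspace[OF A less.prems(1) False less.prems(2)] by blast
    have xx: "x \<bullet> x = 1" using x(2) by (simp add: dot_square_norm)
    let ?T = "{y \<in> S. x \<bullet> y = 0}"
    have T: "subspace ?T"
      using less.prems(1) by (auto simp: subspace_def inner_add_right)
    have AT: "A *v y \<in> ?T" if "y \<in> ?T" for y
      using that less.prems(2) by (simp add: inner_symmetric_matrix[OF A] x(3))
    have "x \<notin> ?T" using xx by auto
    hence "?T \<subset> S" using x(1) by blast
    hence "dim ?T < dim S"
      using T less.prems(1) by (intro dim_psubset) (simp add: span_eq_iff[THEN iffD2])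
    from less.hyps[OF this T AT] obtain B where
      B: "pairwise orthogonal B" "\<And>b. b \<in> B \<Longrightarrow> norm b = 1 \<and> (\<exists>l. A *v b = l *\<^sub>R b)" "span B = ?T"
      by blast
    have BT: "B \<subseteq> ?T" using B(3) span_superset by metis
    show ?thesis
    proof (intro exI[of _ "insert x B"] conjI)
      show "pairwise orthogonal (insert x B)"
        using B(1) BT by (auto simp: pairwise_insert orthogonal_def inner_commute)
      show "\<forall>b\<in>insert x B. norm b = 1 \<and> (\<exists>l. A *v b = l *\<^sub>R b)"
        using B(2) x by auto
      have "insert x B \<subseteq> S" using BT x(1) by auto
      hence "span (insert x B) \<subseteq> S" using less.prems(1) by (rule span_minimal)
      moreover have "y \<in> span (insert x B)" if y: "y \<in> S" for y
      proof -
        have "y - (x \<bullet> y) *\<^sub>R x \<in> ?T"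
          using y x(1) less.prems(1) xx by (auto simp: inner_diff_right intro: subspace_diff subspace_scale)
        hence "y - (x \<bullet> y) *\<^sub>R x \<in> span B" by (simp add: B(3))
        thus ?thesis by (auto simp: span_insert)
      qed
      ultimately show "span (insert x B) = S" by blast
    qed
  qed
qed

theorem symmetric_matrix_diagonalization:
  fixes A :: "real ^ 'n ^ 'n"
  assumes A: "transpose A = A"
  obtains V h where "orthogonal_matrix V" "A = transpose V ** diag_mat h ** V"
proof -
  obtain B where B: "pairwise orthogonal B" "\<And>b. b \<in> B \<Longrightarrow> norm b = 1 \<and> (\<exists>l. A *v b = l *\<^sub>R b)" "span B = UNIV"
    using symmetric_orthonormal_eigenbasis[OF A subspace_UNIV] by blast
  have "0 \<notin> B" using B(2) by force
  hence ind: "independent B" using B(1) by (intro pairwise_orthogonal_independent)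
  have "card B = CARD('n)"
    using dim_span_eq_card_independent[OF ind] B(3) by simp
  moreover have "finite B" using ind by (rule independent_imp_finite)
  ultimately obtain f :: "'n \<Rightarrow> _" where f: "bij_betw f UNIV B"
    by (metis finite_same_card_bij finite_class.finite_UNIV)
  have fB: "f i \<in> B" for i using f by (auto simp: bij_betw_def)
  have "\<forall>i. \<exists>l. A *v f i = l *\<^sub>R f i" using B(2) fB by blast
  then obtain h where h: "\<And>i. A *v f i = h i *\<^sub>R f i" by metis
  define V where "V = (\<chi> i. f i)"
  have rowV: "row i V = f i" for i by (simp add: V_def row_def vec_eq_iff)
  have "orthogonal (f i) (f j)" if "i \<noteq> j" for i j
    using B(1) fB that bij_betw_imp_inj_on[OF f] unfolding pairwise_def inj_on_def by (metis UNIV_I)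
  hence ortV: "orthogonal_matrix V"
    unfolding orthogonal_matrix_orthonormal_rows rowV using B(2) fB by auto
  have "V ** A = diag_mat h ** V"
  proof -
    have "(V ** A) $ i $ j = (diag_mat h ** V) $ i $ j" for i j
    proof -
      have "(V ** A) $ i $ j = (\<Sum>k\<in>UNIV. A $ j $ k * f i $ k)"
        using A by (simp add: matrix_matrix_mult_def V_def transpose_def vec_eq_iff mult.commute)
      also have "\<dots> = (A *v f i) $ j" by (simp add: matrix_vector_mult_def)
      also have "\<dots> = (diag_mat h ** V) $ i $ j" by (simp add: h diag_mat_mult_nth V_def)
      finally show ?thesis .
    qed
    thus ?thesis by (simp add: vec_eq_iff)
  qed
  hence "transpose V ** (V ** A) = transpose V ** (diag_mat h ** V)" by simp
  hence "A = transpose V ** diag_mat h ** V"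
    using ortV by (simp add: matrix_mul_assoc orthogonal_matrix)
  with ortV show ?thesis by (rule that)
qed

lemma orthogonal_matrixD:
  assumes "orthogonal_matrix (Q :: real ^ 'n ^ 'n)"
  shows "transpose Q ** Q = mat 1" "Q ** transpose Q = mat 1"
  using assms by (auto simp: orthogonal_matrix_def)

lemma transpose_mult_self_nth: "(transpose C ** C) $ i $ i = (\<Sum>k\<in>UNIV. (C $ k $ i)^2)"
  for C :: "real ^ 'n ^ 'm"
  by (simp add: matrix_matrix_mult_def transpose_def power2_eq_square)

text \<open>The entry \<open>h i\<close> is the squared norm of column i of
  \<open>G ** transpose V\<close>, hence nonnegative.\<close>

lemma gram_diagonalization:
  fixes G :: "real ^ 'n ^ 'n"
  shows "\<exists>V h. orthogonal_matrix V \<and> (\<forall>i. h i \<ge> 0) \<and>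
    transpose G ** G = transpose V ** diag_mat h ** V"
proof -
  have "transpose (transpose G ** G) = transpose G ** G" by (simp add: matrix_transpose_mul)
  then obtain V h where V: "orthogonal_matrix V" and eq: "transpose G ** G = transpose V ** diag_mat h ** V"
    by (rule symmetric_matrix_diagonalization)
  let ?C = "G ** transpose V"
  have "transpose ?C ** ?C = V ** (transpose G ** G) ** transpose V"
    by (simp add: matrix_transpose_mul matrix_mul_assoc)
  also have "\<dots> = (V ** transpose V) ** diag_mat h ** (V ** transpose V)"
    unfolding eq by (simp add: matrix_mul_assoc)
  also have "\<dots> = diag_mat h" by (simp add: orthogonal_matrixD[OF V])
  finally have C: "transpose ?C ** ?C = diag_mat h" .
  have "h i \<ge> 0" for i
  proof -
    have "h i = (transpose ?C ** ?C) $ i $ i" by (simp add: C diag_mat_nth)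
    also have "\<dots> = (\<Sum>k\<in>UNIV. (?C $ k $ i)^2)" by (rule transpose_mult_self_nth)
    finally show ?thesis by (simp add: sum_nonneg)
  qed
  with V eq show ?thesis by metis
qed

lemma singular_value_decomposition:
  fixes A :: "real ^ 'n ^ 'n"
  assumes "invertible A"
  obtains U V d where "orthogonal_matrix U" "orthogonal_matrix V" "\<And>i. d i > 0"
    "A = U ** diag_mat d ** V"
proof -
  obtain V h where V: "orthogonal_matrix V" and h0: "\<And>i. h i \<ge> 0"
    and eq: "transpose A ** A = transpose V ** diag_mat h ** V"
    using gram_diagonalization[of A] by metis
  have dV: "det V * det V = 1" 
    using orthogonal_matrixD(1)[OF V] by (metis det_I det_mul det_transpose)
  have "det A * det A = det V * det V * (\<Prod>i\<in>UNIV. h i)"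
    using arg_cong[OF eq, of det] by (simp add: det_mul det_diag_mat)
  hence "(\<Prod>i\<in>UNIV. h i) = det A * det A" unfolding dV by simp
  hence "(\<Prod>i\<in>UNIV. h i) \<noteq> 0"
    using assms by (simp only: invertible_det_nz mult_eq_0_iff) simp
  hence "h i \<noteq> 0" for i by auto
  hence h: "h i > 0" for i using h0[of i] by (simp add: order_less_le)
  define d where "d = (\<lambda>i. sqrt (h i))"
  have d: "d i > 0" "d i * d i = h i" "d i \<noteq> 0" for i 
    using h[of i] by (auto simp: d_def order_less_imp_le)
  \<comment> \<open>The only choice compatible with \<open>A = U ** diag_mat d ** V\<close>; it is
    orthogonal because \<open>d i * d i = h i\<close>.\<close>
  define U where "U = A ** transpose V ** diag_mat (\<lambda>i. 1 / d i)"
  have "transpose U ** U = diag_mat (\<lambda>i. 1 / d i) ** V ** (transpose A ** A) ** transpose V ** diag_mat (\<lambda>i. 1 / d i)"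
    by (simp add: U_def matrix_transpose_mul matrix_mul_assoc)
  also have "\<dots> = diag_mat (\<lambda>i. 1 / d i) ** (V ** transpose V) ** diag_mat h ** (V ** transpose V) ** diag_mat (\<lambda>i. 1 / d i)"
    unfolding eq by (simp add: matrix_mul_assoc)
  also have "\<dots> = diag_mat (\<lambda>i. 1 / d i) ** diag_mat h ** diag_mat (\<lambda>i. 1 / d i)"
    by (simp add: orthogonal_matrixD[OF V])
  also have "\<dots> = mat 1"
    using d by (simp add: diag_mat_mult diag_mat_one flip: d(2))
  finally have U: "orthogonal_matrix U" by (simp add: orthogonal_matrix)
  have "U ** diag_mat d ** V = A ** transpose V ** (diag_mat (\<lambda>i. 1 / d i) ** diag_mat d) ** V"
    by (simp add: U_def matrix_mul_assoc)
  also have "\<dots> = A ** (transpose V ** V)"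
    using d by (simp add: diag_mat_mult diag_mat_one matrix_mul_assoc)
  also have "\<dots> = A" by (simp add: orthogonal_matrixD[OF V])
  finally show ?thesis by (intro that[of U V d]) (use U V d(1) in auto)
qed

lemma pminor_sum_orthogonal_conj:
  fixes A V :: "real ^ 'n ^ 'n"
  assumes "orthogonal_matrix V"
  shows "pminor_sum k (transpose V ** A ** V) = pminor_sum k A"
  by (rule pminor_sum_similar) (rule orthogonal_matrixD(2)[OF assms])

lemma pminor_sum_gram_nonneg:
  fixes G :: "real ^ 'n ^ 'n"
  shows "pminor_sum k (transpose G ** G) \<ge> 0"
proof -
  obtain V h where V: "orthogonal_matrix V" and h: "\<And>i. h i \<ge> 0"
    and eq: "transpose G ** G = transpose V ** diag_mat h ** V"
    using gram_diagonalization[of G] by metis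
  show ?thesis
    unfolding eq pminor_sum_orthogonal_conj[OF V] pminor_sum_diag esym_def
    by (intro sum_nonneg prod_nonneg) (use h in auto)
qed

text \<open>Let E be the coordinate projection onto I. Among the minors of size |I|, only the one at
  I survives in \<open>B ** transpose B ** E\<close>. Moving B cyclically to the end turns this
  matrix into the Gram matrix of \<open>E ** B\<close>, whose symmetric functions are
  nonnegative.\<close>

lemma pminor_gram_nonneg:
  fixes B :: "real ^ 'n ^ 'n"
  assumes "invertible B"
  shows "pminor (B ** transpose B) I \<ge> 0"
proof -
  let ?E = "diag_mat (\<lambda>i. if i \<in> I then 1 else 0 :: real)"
  have EE: "?E ** ?E = ?E" unfolding diag_mat_mult by (intro arg_cong[of _ _ diag_mat]) auto
  have "pminor_sum (card I) (B ** transpose B ** ?E)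
      = (\<Sum>J | card J = card I. if J = I then pminor (B ** transpose B) J else 0)"
    unfolding pminor_sum_diag_right
  proof (intro sum.cong refl)
    fix J :: "'n set" assume "J \<in> {J. card J = card I}"
    hence J: "card J = card I" by simp
    show "pminor (B ** transpose B) J * (\<Prod>i\<in>J. if i \<in> I then 1 else 0)
        = (if J = I then pminor (B ** transpose B) J else 0)"
    proof (cases "J = I")
      case False
      then obtain i where "i \<in> J" "i \<notin> I" using card_subset_eq[of I J] J by auto
      hence "(\<Prod>i\<in>J. if i \<in> I then 1 else 0 :: real) = 0" by (intro prod_zero) auto
      thus ?thesis using False by simp
    qed simp
  qed
  hence "pminor (B ** transpose B) I = pminor_sum (card I) (B ** (transpose B ** ?E))"
    by (simp add: matrix_mul_assoc)
  also have "\<dots> = pminor_sum (card I) (transpose B ** ?E ** B)"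
    by (rule pminor_sum_commute[OF assms])
  also have "transpose B ** ?E ** B = transpose (?E ** B) ** (?E ** B)"
    by (metis EE matrix_mul_assoc matrix_transpose_mul transpose_diag_mat)
  also have "pminor_sum (card I) \<dots> \<ge> 0" by (rule pminor_sum_gram_nonneg)
  finally show ?thesis .
qed

text \<open>The norm of the type \<open>real ^ 'n ^ 'm\<close> is the Frobenius norm, not the
  operator norm. Its expression as a trace gives invariance under orthogonal factors on either
  side.\<close>

lemma norm_matrix_square: "(norm (X :: real ^ 'n ^ 'm))^2 = trace (transpose X ** X)"
proof -
  have "(norm X)^2 = X \<bullet> X" by (simp add: dot_square_norm)
  also have "\<dots> = (\<Sum>i\<in>UNIV. \<Sum>j\<in>UNIV. X $ i $ j * X $ i $ j)" by (simp add: inner_vec_def)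
  also have "\<dots> = trace (transpose X ** X)"
    by (subst sum.swap) (simp add: trace_def matrix_matrix_mult_def transpose_def)
  finally show ?thesis .
qed

lemma norm_orthogonal_mult_left:
  fixes X :: "real ^ 'n ^ 'n"
  assumes "orthogonal_matrix V"
  shows "norm (V ** X) = norm X"
proof -
  have "transpose (V ** X) ** (V ** X) = transpose X ** (transpose V ** V) ** X"
    by (simp add: matrix_transpose_mul matrix_mul_assoc)
  hence "(norm (V ** X))^2 = (norm X)^2"
    by (simp add: norm_matrix_square orthogonal_matrixD[OF assms])
  thus ?thesis by simp
qed

lemma norm_orthogonal_mult_right:
  fixes X :: "real ^ 'n ^ 'n"
  assumes "orthogonal_matrix V"
  shows "norm (X ** V) = norm X"
proof -
  have "transpose (X ** V) ** (X ** V) = transpose V ** (transpose X ** X) ** V"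
    by (simp add: matrix_transpose_mul matrix_mul_assoc)
  hence "(norm (X ** V))^2 = pminor_sum 1 (transpose V ** (transpose X ** X) ** V)"
    by (simp only: norm_matrix_square pminor_sum_1)
  also have "\<dots> = (norm X)^2"
    unfolding pminor_sum_orthogonal_conj[OF assms] by (simp only: norm_matrix_square pminor_sum_1)
  finally show ?thesis by simp
qed

lemma compact_orthogonal_matrices: "compact {Q :: real ^ 'n ^ 'n. orthogonal_matrix Q}"
proof -
  have "{Q :: real ^ 'n ^ 'n. orthogonal_matrix Q}
      = {Q. \<forall>i j. (\<Sum>k\<in>UNIV. Q $ k $ i * Q $ k $ j) = (if i = j then 1 else 0)}"
    by (auto simp: orthogonal_matrix vec_eq_iff matrix_matrix_mult_def transpose_def mat_def)
  also have "closed \<dots>"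
    by (intro closed_Collect_all closed_Collect_eq continuous_intros)
  finally have "closed {Q :: real ^ 'n ^ 'n. orthogonal_matrix Q}" .
  moreover have "norm Q \<le> norm (mat 1 :: real ^ 'n ^ 'n)" if "orthogonal_matrix Q" for Q :: "real ^ 'n ^ 'n"
    using norm_orthogonal_mult_left[OF that, of "mat 1"] by simp
  hence "bounded {Q :: real ^ 'n ^ 'n. orthogonal_matrix Q}" by (auto simp: bounded_iff)
  ultimately show ?thesis by (simp add: compact_eq_bounded_closed)
qed

lemma matrix_diff_ldistrib: "(A :: real ^ 'n ^ 'n) ** (B - C) = A ** B - A ** C"
  by (simp add: vec_eq_iff matrix_matrix_mult_def sum_subtractf right_diff_distrib)

lemma matrix_diff_rdistrib: "((A :: real ^ 'n ^ 'n) - B) ** C = A ** C - B ** C"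
  by (simp add: vec_eq_iff matrix_matrix_mult_def sum_subtractf left_diff_distrib)

text \<open>By the invariance of the Frobenius norm, V Q U is as close to T as Q is to V^T T U^T. A
  single finite net of the compact orthogonal group therefore serves all U, V and T; this uniformity
  is what later makes the constant independent of the matrix A.\<close>

lemma orthogonal_net:
  fixes r :: real
  assumes "r > 0"
  obtains S :: "(real ^ 'n ^ 'n) set" where "finite S" "\<And>Q. Q \<in> S \<Longrightarrow> orthogonal_matrix Q"
    "\<And>U V T. orthogonal_matrix U \<Longrightarrow> orthogonal_matrix V \<Longrightarrow> orthogonal_matrix T \<Longrightarrow>
        \<exists>Q\<in>S. norm (V ** Q ** U - T) < r"
proof -
  let ?O = "{Q :: real ^ 'n ^ 'n. orthogonal_matrix Q}"
  obtain S where S: "S \<subseteq> ?O" "finite S" "?O \<subseteq> (\<Union>Q\<in>S. ball Q r)"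
    using compactE_image[OF compact_orthogonal_matrices, of ?O "\<lambda>Q. ball Q r"] assms
    by (metis UN_I centre_in_ball open_ball subsetI)
  show ?thesis
  proof (rule that[of S])
    fix U V T :: "real ^ 'n ^ 'n"
    assume O: "orthogonal_matrix U" "orthogonal_matrix V" "orthogonal_matrix T"
    let ?R = "transpose V ** T ** transpose U"
    have "?R \<in> ?O" using O by (simp add: orthogonal_matrix_mul)
    then obtain Q where Q: "Q \<in> S" "dist Q ?R < r" using S(3) by (auto simp: dist_commute)
    have "V ** ?R ** U = (V ** transpose V) ** T ** (transpose U ** U)" by (simp add: matrix_mul_assoc)
    hence "V ** ?R ** U = T" by (simp add: orthogonal_matrixD[OF O(1)] orthogonal_matrixD[OF O(2)])
    hence "V ** Q ** U - T = V ** (Q - ?R) ** U"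
      by (simp add: matrix_diff_ldistrib matrix_diff_rdistrib)
    hence "norm (V ** Q ** U - T) = norm (Q - ?R)"
      by (simp add: norm_orthogonal_mult_left norm_orthogonal_mult_right O)
    thus "\<exists>Q\<in>S. norm (V ** Q ** U - T) < r" using Q unfolding dist_norm by metis
  qed (use S in auto)
qed

lemma continuous_pminor [continuous_intros]:
  "continuous_on A f \<Longrightarrow> continuous_on A (\<lambda>x. pminor (f x :: real ^ 'n ^ 'n) I)"
  unfolding pminor_eq_row_mask by (intro continuous_intros)

lemma continuous_pminor_sum [continuous_intros]:
  "continuous_on A f \<Longrightarrow> continuous_on A (\<lambda>x. pminor_sum k (f x :: real ^ 'n ^ 'n))"
  unfolding pminor_sum_def by (intro continuous_intros)

section \<open>Products of eigenvalue moduli\<close>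

text \<open>Remove the largest index m of J. A set of k + 1 indices up to m forces m \<ge> k, so
  \<open>g m \<le> g k\<close>, and induction handles the rest.\<close>

lemma prod_le_prod_initial:
  fixes g :: "nat \<Rightarrow> real"
  assumes "\<And>i j. i \<le> j \<Longrightarrow> j < n \<Longrightarrow> g j \<le> g i" "\<And>i. i < n \<Longrightarrow> g i \<ge> 0"
    and "J \<subseteq> {..<n}" "card J = k"
  shows "prod g J \<le> (\<Prod>i<k. g i)"
  using assms(3,4)
proof (induction k arbitrary: J)
  case 0
  have "finite J" using 0 by (auto intro: finite_subset)
  thus ?case using 0 by auto
next
  case (Suc k)
  have fin: "finite J" and ne: "J \<noteq> {}" using Suc.prems by (auto intro: finite_subset)
  define m where "m = Max J"
  have m: "m \<in> J" unfolding m_def using fin ne by (rule Max_in)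
  have "J \<subseteq> {..m}" using fin by (auto simp: m_def)
  hence "card J \<le> Suc m" using card_mono[of "{..m}" J] by simp
  hence km: "k \<le> m" using Suc.prems by simp
  have mn: "m < n" using m Suc.prems by auto
  have "prod g J = g m * prod g (J - {m})" using fin m by (rule prod.remove)
  also have "\<dots> \<le> g k * (\<Prod>i<k. g i)"
  proof (intro mult_mono assms(1) km mn Suc.IH prod_nonneg)
    show "card (J - {m}) = k" using Suc.prems fin m by simp
  qed (use Suc.prems assms km mn in auto)
  finally show ?case by (simp add: mult.commute)
qed

lemma mset_eigenvalue_list:
  assumes "eigvals A z"
  shows "mset (eigenvalue_list A) = image_mset z (mset_set UNIV)"
proof -
  have "\<exists>zs. mset zs = proots (complex_charpoly A)" by (rule ex_mset)
  hence "mset (SOME zs. mset zs = proots (complex_charpoly A)) = proots (complex_charpoly A)"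
    by (rule someI_ex)
  thus ?thesis using assms
    by (simp add: eigenvalue_list_def eigvals_iff_charpoly proots_prod_linear)
qed

lemma eigenvalue_list_enum:
  fixes A :: "real ^ 'n ^ 'n"
  assumes "eigvals A z"
  obtains h where "bij_betw h {..<CARD('n)} UNIV"
    "\<And>i. i < CARD('n) \<Longrightarrow> eigenvalue_list A ! i = z (h i)"
    "length (eigenvalue_list A) = CARD('n)"
proof -
  let ?zs = "eigenvalue_list A"
  obtain xs :: "'n list" where xs: "mset xs = mset_set UNIV" using ex_mset by blast
  have "mset ?zs = mset (map z xs)" using mset_eigenvalue_list[OF assms] xs by simp
  then obtain p where p: "p permutes {..<length (map z xs)}" "permute_list p (map z xs) = ?zs"
    by (rule mset_eq_permutation)
  define ys where "ys = permute_list p xs"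
  have zs: "?zs = map z ys" using p by (simp add: ys_def permute_list_map)
  have mys: "mset ys = mset_set UNIV" using p xs by (simp add: ys_def)
  have set: "set ys = UNIV" using mys by (metis finite_class.finite_UNIV finite_set_mset_mset_set set_mset_mset)
  have len: "length ys = CARD('n)" using arg_cong[OF mys, of size] by simp
  have dist: "distinct ys" using card_distinct[of ys] set len by simp
  show ?thesis
  proof (rule that[of "\<lambda>i. ys ! i"])
    show "bij_betw ((!) ys) {..<CARD('n)} UNIV"
      using bij_betw_nth[OF dist, of "{..<CARD('n)}" UNIV] len set by simp
  qed (auto simp: zs len)
qed

text \<open>The list is sorted by decreasing modulus, so its first k entries realize the maximum
  over all k-subsets. This trades the sorted list for a maximum, which needs no ordering of the
  eigenvalues.\<close>

lemma prod_cmod_eigenvalue: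
  fixes A :: "real ^ 'n ^ 'n"
  assumes z: "eigvals A z" and k: "k \<le> CARD('n)"
  shows "(\<Prod>i=1..k. cmod (eigenvalue i A)) = top_prod k (\<lambda>i. cmod (z i))"
proof -
  let ?zs = "eigenvalue_list A"
  obtain h where h: "bij_betw h {..<CARD('n)} UNIV"
    "\<And>i. i < CARD('n) \<Longrightarrow> ?zs ! i = z (h i)" "length ?zs = CARD('n)"
    using eigenvalue_list_enum[OF z] by blast
  have inj: "inj_on h {..<CARD('n)}" and surj: "h ` {..<CARD('n)} = UNIV"
    using h(1) by (auto simp: bij_betw_def)
  have "sorted (map (\<lambda>z. - cmod z) ?zs)" by (simp add: eigenvalue_list_def)
  hence anti: "cmod (?zs ! j) \<le> cmod (?zs ! i)" if "i \<le> j" "j < CARD('n)" for i j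
    using that h(3) by (auto simp: sorted_iff_nth_mono)
  have "(\<Prod>i=1..k. cmod (eigenvalue i A)) = (\<Prod>i<k. cmod (?zs ! i))"
    by (simp add: eigenvalue_def prod.atLeast1_atMost_eq)
  also have "\<dots> = top_prod k (\<lambda>i. cmod (z i))"
  proof (rule antisym)
    have sub: "{..<k} \<subseteq> {..<CARD('n)}" using k by auto
    have "(\<Prod>i<k. cmod (?zs ! i)) = (\<Prod>i<k. cmod (z (h i)))"
      using sub by (intro prod.cong) (auto simp: h)
    also have "\<dots> = (\<Prod>i\<in>h ` {..<k}. cmod (z i))"
      using inj_on_subset[OF inj sub] by (simp add: prod.reindex)
    also have "\<dots> \<le> top_prod k (\<lambda>i. cmod (z i))"
      using inj_on_subset[OF inj sub] by (intro top_prod_ge) (simp add: card_image)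
    finally show "(\<Prod>i<k. cmod (?zs ! i)) \<le> top_prod k (\<lambda>i. cmod (z i))" .
    obtain I where I: "card I = k" "top_prod k (\<lambda>i. cmod (z i)) = (\<Prod>i\<in>I. cmod (z i))"
      using top_prod_attained[OF k, of "\<lambda>i. cmod (z i)"] .
    define J where "J = {j. j < CARD('n) \<and> h j \<in> I}"
    have hJ: "h ` J = I" using surj by (auto simp: J_def image_iff)
    have injJ: "inj_on h J" using inj by (rule inj_on_subset) (auto simp: J_def)
    have "card J = k" using card_image[OF injJ] hJ I by simp
    have "(\<Prod>i\<in>I. cmod (z i)) = (\<Prod>j\<in>J. cmod (z (h j)))"
      using injJ by (simp add: prod.reindex flip: hJ)
    also have "\<dots> = (\<Prod>j\<in>J. cmod (?zs ! j))" by (intro prod.cong) (auto simp: J_def h)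
    also have "\<dots> \<le> (\<Prod>i<k. cmod (?zs ! i))"
      by (rule prod_le_prod_initial[where n = "CARD('n)"]) (use anti \<open>card J = k\<close> in \<open>auto simp: J_def\<close>)
    finally show "top_prod k (\<lambda>i. cmod (z i)) \<le> (\<Prod>i<k. cmod (?zs ! i))" using I by simp
  qed
  finally show ?thesis .
qed

text \<open>The quantity P(k, A) of the overview.\<close>

definition eig_prod :: "nat \<Rightarrow> real ^ 'n ^ 'n \<Rightarrow> real" where
  "eig_prod k A = (\<Prod>i=1..k. cmod (eigenvalue i A))"

lemma eig_prod_eq:
  fixes A :: "real ^ 'n ^ 'n"
  shows "eigvals A z \<Longrightarrow> k \<le> CARD('n) \<Longrightarrow> eig_prod k A = top_prod k (\<lambda>i. cmod (z i))"
  unfolding eig_prod_def by (rule prod_cmod_eigenvalue)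

lemma eigvals_prod:
  fixes A :: "real ^ 'n ^ 'n"
  assumes "eigvals A z"
  shows "(\<Prod>i\<in>UNIV. z i) = of_real (det A)"
  using assms unfolding eigvals_def by (metis esym_CARD pminor_sum_CARD)

lemma eigvals_nonzero:
  fixes A :: "real ^ 'n ^ 'n"
  assumes "eigvals A z" "invertible A"
  shows "z i \<noteq> 0"
proof
  assume "z i = 0"
  hence "(\<Prod>i\<in>UNIV. z i) = 0" by (intro prod_zero) auto
  thus False using eigvals_prod[OF assms(1)] assms(2) by (simp add: invertible_det_nz)
qed

lemma eigenvalue_in_eigvals:
  fixes A :: "real ^ 'n ^ 'n"
  assumes "eigvals A z" "1 \<le> i" "i \<le> CARD('n)"
  shows "\<exists>j. eigenvalue i A = z j"
proof -
  obtain h where h: "\<And>i. i < CARD('n) \<Longrightarrow> eigenvalue_list A ! i = z (h i)"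
    using eigenvalue_list_enum[OF assms(1)] by blast
  show ?thesis using h[of "i - 1"] assms by (auto simp: eigenvalue_def)
qed

lemma sum_ln_cmod_eigenvalue:
  fixes A :: "real ^ 'n ^ 'n"
  assumes "invertible A" "k \<le> CARD('n)"
  shows "(\<Sum>i=1..k. ln (cmod (eigenvalue i A))) = ln (eig_prod k A)"
proof -
  obtain z where z: "eigvals A z" using eigvals_exist by blast
  have "cmod (eigenvalue i A) > 0" if i: "i \<in> {1..k}" for i
    using eigenvalue_in_eigvals[OF z, of i] eigvals_nonzero[OF z assms(1)] i assms(2) by auto
  thus ?thesis unfolding eig_prod_def by (subst ln_prod) auto
qed

lemma eig_prod_pos:
  fixes A :: "real ^ 'n ^ 'n"
  assumes "invertible A" "k \<le> CARD('n)"
  shows "eig_prod k A > 0"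
proof -
  obtain z where z: "eigvals A z" using eigvals_exist by blast
  show ?thesis
    unfolding eig_prod_eq[OF z assms(2)]
    by (rule top_prod_pos[OF assms(2)]) (use eigvals_nonzero[OF z assms(1)] in auto)
qed

lemma eigvals_diag: "eigvals (diag_mat d) (\<lambda>i. of_real (d i))"
  by (simp add: eigvals_def pminor_sum_diag esym_of_real)

lemma eigvals_orthogonal_conj:
  assumes "orthogonal_matrix V"
  shows "eigvals (transpose V ** A ** V) z \<longleftrightarrow> eigvals A z"
  by (simp add: eigvals_def pminor_sum_orthogonal_conj[OF assms])

lemma invertible_gram:
  fixes A :: "real ^ 'n ^ 'n"
  shows "invertible A \<Longrightarrow> invertible (transpose A ** A)"
  by (simp add: invertible_det_nz det_mul)

text \<open>The squared singular values are the eigenvalues of the Gram matrix, and the product of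
  the k largest is a single term of their e_k. An inequality suffices because the exponents are to
  be bounded from above.\<close>

lemma sum_ln_singular_value_le:
  fixes A :: "real ^ 'n ^ 'n"
  assumes A: "invertible A" and k: "k \<le> CARD('n)"
  shows "(\<Sum>i=1..k. ln (singular_value i A)) \<le> ln (pminor_sum k (transpose A ** A)) / 2"
proof -
  let ?H = "transpose A ** A"
  obtain V h where V: "orthogonal_matrix V" and h0: "\<And>i. h i \<ge> 0"
    and eq: "?H = transpose V ** diag_mat h ** V"
    using gram_diagonalization[of A] by metis
  have z: "eigvals ?H (\<lambda>i. of_real (h i))"
    unfolding eq eigvals_orthogonal_conj[OF V] by (rule eigvals_diag)
  have "ln (singular_value i A) = ln (cmod (eigenvalue i ?H)) / 2" if i: "i \<in> {1..k}" for i
  proof -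
    obtain j where j: "eigenvalue i ?H = of_real (h j)"
      using eigenvalue_in_eigvals[OF z, of i] i k by auto
    have "h j \<noteq> 0" using eigvals_nonzero[OF z invertible_gram[OF A], of j] by simp
    thus ?thesis using h0[of j] by (simp add: singular_value_def j ln_sqrt)
  qed
  hence "(\<Sum>i=1..k. ln (singular_value i A)) = (\<Sum>i=1..k. ln (cmod (eigenvalue i ?H))) / 2"
    unfolding sum_divide_distrib by (intro sum.cong refl)
  also have "\<dots> = ln (eig_prod k ?H) / 2"
    using sum_ln_cmod_eigenvalue[OF invertible_gram[OF A] k] by simp
  also have "\<dots> \<le> ln (pminor_sum k ?H) / 2"
  proof -
    have "eig_prod k ?H \<le> esym k h"
      using eig_prod_eq[OF z k] top_prod_le_esym[OF k, of h] h0 by simp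
    also have "esym k h = pminor_sum k ?H"
      unfolding eq pminor_sum_orthogonal_conj[OF V] pminor_sum_diag ..
    finally show ?thesis
      using eig_prod_pos[OF invertible_gram[OF A] k] by simp
  qed
  finally show ?thesis .
qed

text \<open>The pairs of a matrix and a family of its eigenvalues form a closed set
  \<open>T\<close>. A superlevel set of \<open>eig_prod k\<close> is the projection of the part of
  \<open>T\<close> where some k-fold product of moduli is at least a. With the family confined to a
  ball of radius R the projection runs along a compact set and is closed; the union over R and I is
  countable.\<close>

lemma eig_prod_measurable:
  assumes k: "k \<le> CARD('n)"
  shows "(eig_prod k :: real ^ 'n ^ 'n \<Rightarrow> real) \<in> borel_measurable borel"
proof -
  define T :: "((complex ^ 'n) \<times> (real ^ 'n ^ 'n)) set" where
    "T = {p. \<forall>j. esym j (\<lambda>i. fst p $ i) = of_real (pminor_sum j (snd p))}"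
  define K :: "real \<Rightarrow> nat \<Rightarrow> 'n set \<Rightarrow> (complex ^ 'n) set" where
    "K = (\<lambda>a R I. cball 0 (real R) \<inter> {z. a \<le> (\<Prod>i\<in>I. cmod (z $ i))})"
  have closedT: "closed T"
    unfolding T_def esym_def
    by (intro closed_Collect_all closed_Collect_eq continuous_intros)
  have compactK: "compact (K a R I)" for a R I
    unfolding K_def
    by (intro compact_Int_closed compact_cball closed_Collect_le continuous_intros)
  have eigT: "(z, A) \<in> T \<longleftrightarrow> eigvals A (\<lambda>i. z $ i)" for z A
    by (simp add: T_def eigvals_def)
  have "{A. a \<le> eig_prod k A} = (\<Union>R::nat. \<Union>I\<in>{I. card I = k}. {A. \<exists>z. z \<in> K a R I \<and> (z, A) \<in> T})"
    for a
  proof (intro set_eqI iffI)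
    fix A :: "real ^ 'n ^ 'n" assume "A \<in> {A. a \<le> eig_prod k A}"
    hence a: "a \<le> eig_prod k A" by simp
    obtain z where z: "eigvals A z" using eigvals_exist by blast
    obtain I where I: "card I = k" "top_prod k (\<lambda>i. cmod (z i)) = (\<Prod>i\<in>I. cmod (z i))"
      using top_prod_attained[OF k, of "\<lambda>i. cmod (z i)"] .
    let ?z = "\<chi> i. z i"
    obtain R :: nat where R: "norm ?z \<le> real R" using real_arch_simple by blast
    have "?z \<in> K a R I" using a R I eig_prod_eq[OF z k] by (simp add: K_def)
    moreover have "(?z, A) \<in> T" using z by (simp add: eigT)
    ultimately show "A \<in> (\<Union>R::nat. \<Union>I\<in>{I. card I = k}. {A. \<exists>z. z \<in> K a R I \<and> (z, A) \<in> T})"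
      using I(1) by blast
  next
    fix A :: "real ^ 'n ^ 'n"
    assume "A \<in> (\<Union>R::nat. \<Union>I\<in>{I. card I = k}. {A. \<exists>z. z \<in> K a R I \<and> (z, A) \<in> T})"
    then obtain R I z where I: "card I = k" and z: "z \<in> K a R I" "(z, A) \<in> T" by blast
    have "a \<le> (\<Prod>i\<in>I. cmod (z $ i))" using z(1) by (simp add: K_def)
    also have "\<dots> \<le> eig_prod k A"
      using z(2) I unfolding eigT by (simp add: eig_prod_eq[OF _ k] top_prod_ge)
    finally show "A \<in> {A. a \<le> eig_prod k A}" by simp
  qed
  moreover have "{A. \<exists>z. z \<in> K a R I \<and> (z, A) \<in> T} \<in> sets borel" for a R I
    by (rule borel_closed[OF closed_compact_projection[OF compactK closedT]])
  ultimately have "{A. a \<le> eig_prod k A} \<in> sets (borel :: (real ^ 'n ^ 'n) measure)" for a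
    by (auto intro!: sets.countable_UN sets.finite_UN)
  thus ?thesis by (simp add: borel_measurable_iff_ge)
qed

text \<open>A real matrix acts separately on the real part x and the imaginary part y of a complex
  eigenvector. Since the squared norm of the eigenvector is the sum of those of x and y, the real
  operator norm also bounds complex eigenvalues.\<close>

lemma cmod_eigval_le_onorm:
  fixes A :: "real ^ 'n ^ 'n"
  assumes z: "eigvals A z"
  shows "cmod (z i) \<le> onorm ((*v) A)"
proof -
  let ?n = "CARD('n)" and ?c = "z i"
  let ?A = "\<chi> i j. complex_of_real (A $ i $ j)"
  let ?M = "\<chi> i j. (if i = j then ?c else 0) + (-1) * ?A $ i $ j"
  have "det ?M = (\<Sum>k\<le>?n. ?c ^ (?n - k) * (-1) ^ k * esym k z)"
    unfolding det_scalar_plus pminor_sum_of_real using z by (simp add: eigvals_def)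
  also have "\<dots> = poly (\<Prod>i\<in>UNIV. [:- z i, 1:]) ?c"
    unfolding prod_linear_esym by (simp add: poly_sum poly_monom ac_simps)
  also have "\<dots> = 0" unfolding poly_prod by (rule prod_zero) (auto intro!: bexI[of _ i])
  finally have "\<not> invertible ?M" by (simp add: invertible_det_nz)
  hence "\<exists>v. ?M *v v = 0 \<and> v \<noteq> 0"
    using matrix_left_invertible_ker[of ?M] invertible_left_inverse[of ?M] by auto
  then obtain v where v: "?M *v v = 0" "v \<noteq> 0" by blast
  define x y :: "real ^ 'n" where "x = (\<chi> j. Re (v $ j))" and "y = (\<chi> j. Im (v $ j))"
  have nv: "(norm w)^2 = (\<Sum>j\<in>UNIV. (cmod (w $ j))^2)" for w :: "complex ^ 'n"
    by (simp add: norm_vec_def L2_set_def sum_nonneg)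
  have nr: "(norm w)^2 = (\<Sum>j\<in>UNIV. (w $ j)^2)" for w :: "real ^ 'n"
    by (simp add: norm_vec_def L2_set_def sum_nonneg)
  have split: "(norm v)^2 = (norm x)^2 + (norm y)^2"
    by (simp add: nv nr x_def y_def cmod_power2 sum.distrib)
  have ev: "?c * v $ j = Complex ((A *v x) $ j) ((A *v y) $ j)" for j
  proof -
    have "(\<Sum>k\<in>UNIV. ((if j = k then ?c else 0) - of_real (A $ j $ k)) * v $ k) = 0"
      using arg_cong[OF v(1), of "\<lambda>w. w $ j"] by (simp add: matrix_vector_mult_def)
    hence "(\<Sum>k\<in>UNIV. (if j = k then ?c else 0) * v $ k) = (\<Sum>k\<in>UNIV. of_real (A $ j $ k) * v $ k)"
      by (simp add: left_diff_distrib sum_subtractf)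
    moreover have "(\<Sum>k\<in>UNIV. (if j = k then ?c else 0) * v $ k) = (\<Sum>k\<in>UNIV. if j = k then ?c * v $ k else 0)"
      by (intro sum.cong) auto
    ultimately have "?c * v $ j = (\<Sum>k\<in>UNIV. of_real (A $ j $ k) * v $ k)" by simp
    thus ?thesis
      by (simp add: complex_eq_iff matrix_vector_mult_def x_def y_def)
  qed
  let ?o = "onorm ((*v) A)"
  have o: "norm (A *v w) \<le> ?o * norm w" for w
    by (rule onorm[OF matrix_vector_mul_bounded_linear])
  have o0: "?o \<ge> 0" by (rule onorm_pos_le[OF matrix_vector_mul_bounded_linear])
  have "(cmod ?c)^2 * (norm v)^2 = (\<Sum>j\<in>UNIV. (cmod (?c * v $ j))^2)"
    by (simp add: nv sum_distrib_left norm_mult power_mult_distrib)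
  also have "\<dots> = (norm (A *v x))^2 + (norm (A *v y))^2"
    by (simp add: ev cmod_power2 sum.distrib nr)
  also have "\<dots> \<le> (?o * norm x)^2 + (?o * norm y)^2"
    by (intro add_mono power_mono o) auto
  also have "\<dots> = ?o^2 * (norm v)^2" by (simp add: split power_mult_distrib distrib_left)
  finally have "(cmod ?c)^2 \<le> ?o^2" using v(2) by simp
  thus ?thesis using o0 by (rule power2_le_imp_le)
qed

lemma eig_prod_le_onorm:
  fixes A :: "real ^ 'n ^ 'n"
  assumes k: "k \<le> CARD('n)"
  shows "eig_prod k A \<le> onorm ((*v) A) ^ k"
proof -
  obtain z where z: "eigvals A z" using eigvals_exist by blast
  have "(\<Prod>i\<in>I. cmod (z i)) \<le> onorm ((*v) A) ^ card I" for I :: "'n set"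
    using prod_mono[of I "\<lambda>i. cmod (z i)" "\<lambda>_. onorm ((*v) A)"] cmod_eigval_le_onorm[OF z] by simp
  thus ?thesis unfolding eig_prod_eq[OF z k] top_prod_le_iff[OF k] by auto
qed

section \<open>Comparison of eigenvalues and singular values\<close>

lemma card_subsets_containing:
  assumes "finite T" "i \<in> T" "1 \<le> k"
  shows "card {I. I \<subseteq> T \<and> card I = k \<and> i \<in> I} = (card T - 1) choose (k - 1)"
proof -
  have "bij_betw (insert i) {J. J \<subseteq> T - {i} \<and> card J = k - 1} {I. I \<subseteq> T \<and> card I = k \<and> i \<in> I}"
  proof (rule bij_betw_byWitness[where f' = "\<lambda>I. I - {i}"])
    show "insert i ` {J. J \<subseteq> T - {i} \<and> card J = k - 1} \<subseteq> {I. I \<subseteq> T \<and> card I = k \<and> i \<in> I}"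
    proof clarify
      fix J assume J: "J \<subseteq> T - {i}" "card J = k - 1"
      have "finite J" using J assms by (auto intro: finite_subset)
      thus "insert i J \<subseteq> T \<and> card (insert i J) = k \<and> i \<in> insert i J"
        using J assms by (subst card_insert_disjoint) auto
    qed
    show "(\<lambda>I. I - {i}) ` {I. I \<subseteq> T \<and> card I = k \<and> i \<in> I} \<subseteq> {J. J \<subseteq> T - {i} \<and> card J = k - 1}"
      using assms by auto
  qed (use assms in auto)
  hence "card {I. I \<subseteq> T \<and> card I = k \<and> i \<in> I} = card {J. J \<subseteq> T - {i} \<and> card J = k - 1}"
    by (simp add: bij_betw_same_card)
  also have "\<dots> = (card T - 1) choose (k - 1)"
    using assms n_subsets[of "T - {i}" "k - 1"] by simp
  finally show ?thesis .
qed

lemma sum_over_subsets: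
  fixes f :: "'b \<Rightarrow> real"
  assumes "finite T" "1 \<le> k"
  shows "(\<Sum>I | I \<subseteq> T \<and> card I = k. \<Sum>i\<in>I. f i) = real ((card T - 1) choose (k - 1)) * (\<Sum>i\<in>T. f i)"
proof -
  let ?F = "{I. I \<subseteq> T \<and> card I = k}"
  have finF: "finite ?F" using assms(1) by simp
  have "(\<Sum>I\<in>?F. \<Sum>i\<in>I. f i) = (\<Sum>I\<in>?F. \<Sum>i | i \<in> T \<and> i \<in> I. f i)"
    by (intro sum.cong refl) (auto intro!: sum.cong)
  also have "\<dots> = (\<Sum>i\<in>T. \<Sum>I | I \<in> ?F \<and> i \<in> I. f i)"
    by (rule sum.swap_restrict[OF finF assms(1)])
  also have "\<dots> = (\<Sum>i\<in>T. real ((card T - 1) choose (k - 1)) * f i)"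
  proof (intro sum.cong refl)
    fix i assume i: "i \<in> T"
    have "{I. I \<in> ?F \<and> i \<in> I} = {I. I \<subseteq> T \<and> card I = k \<and> i \<in> I}" by auto
    thus "(\<Sum>I | I \<in> ?F \<and> i \<in> I. f i) = real ((card T - 1) choose (k - 1)) * f i"
      using card_subsets_containing[OF assms(1) i assms(2)] by simp
  qed
  finally show ?thesis by (simp add: sum_distrib_left)
qed

text \<open>Sum the hypothesis over all k-subsets I: every element of T is counted (card T - 1)
  choose (k - 1) times, and the ratio of the two binomial coefficients is card T / k.\<close>

lemma sum_le_of_subset_sums:
  fixes f :: "'b \<Rightarrow> real"
  assumes T: "finite T" and k: "1 \<le> k" "k \<le> card T"
    and le: "\<And>I. I \<subseteq> T \<Longrightarrow> card I = k \<Longrightarrow> (\<Sum>i\<in>I. f i) \<le> c"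
  shows "real k * (\<Sum>i\<in>T. f i) \<le> real (card T) * c"
proof -
  let ?b = "real ((card T - 1) choose (k - 1))"
  have b: "?b > 0" using k by (simp add: binomial_eq_0_iff)
  have "?b * (\<Sum>i\<in>T. f i) \<le> real (card {I. I \<subseteq> T \<and> card I = k}) * c"
    unfolding sum_over_subsets[OF T k(1), symmetric] by (rule sum_bounded_above) (auto intro: le)
  also have "\<dots> = real (card T choose k) * c" by (simp add: n_subsets[OF T])
  finally have "real k * (?b * (\<Sum>i\<in>T. f i)) \<le> (real k * real (card T choose k)) * c"
    by (simp add: mult_left_mono mult.assoc)
  also have "real k * real (card T choose k) = real (card T) * ?b"
  proof -
    have "k * (card T choose k) = card T * ((card T - 1) choose (k - 1))"
      using binomial_absorption[of "k - 1" "card T"] k by simp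
    thus ?thesis by (metis of_nat_mult)
  qed
  finally have "?b * (real k * (\<Sum>i\<in>T. f i)) \<le> ?b * (real (card T) * c)" by (simp add: ac_simps)
  thus ?thesis using b by simp
qed

text \<open>For R near the identity and D the diagonal matrix of d, e_j(R D) is the sum of the terms
  of e_j(d), each weighted by a minor of R close to 1. The error is therefore relative to the
  largest term, and r does not depend on d, however spread out its entries are.\<close>

lemma top_prod_of_eigvals_close:
  fixes t :: real
  assumes "0 < t" "t < 1"
  shows "\<exists>r>0. \<forall>(R :: real ^ 'n ^ 'n) d z k. norm (R - mat 1) < r \<longrightarrow> (\<forall>i. d i > 0) \<longrightarrow>
      eigvals (R ** diag_mat d) z \<longrightarrow> k \<le> CARD('n) \<longrightarrow> t * top_prod k d \<le> top_prod k (\<lambda>i. cmod (z i))"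
proof -
  let ?n = "CARD('n)"
  obtain e where e: "e > 0" "\<And>(z :: 'n \<Rightarrow> complex) d k. (\<And>i. d i \<ge> 0) \<Longrightarrow> esym_close e z d \<Longrightarrow>
           k \<le> ?n \<Longrightarrow> t * top_prod k d \<le> top_prod k (\<lambda>i. norm (z i))"
    using top_prod_perturbation[OF assms, where 'n = 'n] by metis
  \<comment> \<open>At most 2^n minors contribute to each e_j.\<close>
  define e' where "e' = e / 2 ^ ?n"
  have e': "e' > 0" using e(1) by (simp add: e'_def)
  have "eventually (\<lambda>R. \<forall>I\<in>UNIV. \<bar>pminor R I - 1\<bar> < e') (nhds (mat 1 :: real ^ 'n ^ 'n))"
  proof (rule eventually_ball_finite)
    show "\<forall>I\<in>UNIV. \<forall>\<^sub>F R in nhds (mat 1 :: real ^ 'n ^ 'n). \<bar>pminor R I - 1\<bar> < e'"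
    proof
      fix I :: "'n set"
      have "continuous_on UNIV (\<lambda>R :: real ^ 'n ^ 'n. pminor R I)" by (intro continuous_intros)
      hence "isCont (\<lambda>R :: real ^ 'n ^ 'n. pminor R I) (mat 1)"
        by (simp add: continuous_on_eq_continuous_at)
      hence "((\<lambda>R :: real ^ 'n ^ 'n. pminor R I) \<longlongrightarrow> pminor (mat 1 :: real ^ 'n ^ 'n) I) (nhds (mat 1))"
        unfolding isCont_def by (rule tendsto_at_iff_tendsto_nhds[of "\<lambda>R :: real ^ 'n ^ 'n. pminor R I", THEN iffD1])
      hence "((\<lambda>R :: real ^ 'n ^ 'n. pminor R I) \<longlongrightarrow> 1) (nhds (mat 1))" by simp
      thus "\<forall>\<^sub>F R in nhds (mat 1 :: real ^ 'n ^ 'n). \<bar>pminor R I - 1\<bar> < e'"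
        using e' unfolding tendsto_iff dist_real_def by blast
    qed
  qed auto
  then obtain r where r: "r > 0" "\<And>R :: real ^ 'n ^ 'n. norm (R - mat 1) < r \<Longrightarrow> (\<forall>I. \<bar>pminor R I - 1\<bar> < e')"
    unfolding eventually_nhds_metric dist_norm by auto
  show ?thesis
  proof (intro exI[of _ r] conjI allI impI r(1))
    fix R :: "real ^ 'n ^ 'n" and d z k
    assume R: "norm (R - mat 1) < r" and d: "\<forall>i. d i > (0::real)" and z: "eigvals (R ** diag_mat d) z"
      and k: "k \<le> ?n"
    have "esym_close e z d"
      unfolding esym_close_def
    proof (intro allI impI)
      fix j assume j: "j \<le> ?n"
      have t0: "top_prod j d \<ge> 0" using top_prod_nonneg[OF j, of d] d by (simp add: order_less_imp_le)
      have "esym j z - of_real (esym j d) = of_real (\<Sum>I | card I = j. (pminor R I - 1) * (\<Prod>i\<in>I. d i))"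
        using z unfolding eigvals_def pminor_sum_diag_right
        by (simp add: esym_def sum_subtractf left_diff_distrib)
      hence "norm (esym j z - of_real (esym j d)) = \<bar>\<Sum>I | card I = j. (pminor R I - 1) * (\<Prod>i\<in>I. d i)\<bar>"
        by (simp only: norm_of_real)
      also have "\<dots> \<le> (\<Sum>I | card I = j. \<bar>(pminor R I - 1) * (\<Prod>i\<in>I. d i)\<bar>)" by (rule sum_abs)
      also have "\<dots> \<le> (\<Sum>I | card (I :: 'n set) = j. e' * top_prod j d)"
      proof (rule sum_mono)
        fix I :: "'n set" assume "I \<in> {I. card I = j}"
        hence I: "card I = j" by simp
        have p: "(\<Prod>i\<in>I. d i) \<ge> 0" using d by (intro prod_nonneg) (auto simp: order_less_imp_le)
        have "\<bar>(pminor R I - 1) * (\<Prod>i\<in>I. d i)\<bar> = \<bar>pminor R I - 1\<bar> * (\<Prod>i\<in>I. d i)"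
          using p by (simp add: abs_mult)
        also have "\<dots> \<le> e' * top_prod j d"
          by (intro mult_mono top_prod_ge I p) (use r(2)[OF R] e' in \<open>auto simp: order_less_imp_le\<close>)
        finally show "\<bar>(pminor R I - 1) * (\<Prod>i\<in>I. d i)\<bar> \<le> e' * top_prod j d" .
      qed
      also have "\<dots> = real (?n choose j) * (e' * top_prod j d)" by (simp add: card_subsets_type)
      also have "\<dots> \<le> 2 ^ ?n * (e' * top_prod j d)"
      proof (intro mult_right_mono)
        have "?n choose j \<le> 2 ^ ?n" by (rule binomial_le_pow2)
        thus "real (?n choose j) \<le> 2 ^ ?n" by (metis of_nat_le_iff of_nat_numeral of_nat_power)
      qed (use e' t0 in auto)
      also have "\<dots> = e * top_prod j d" by (simp add: e'_def)
      finally show "norm (esym j z - of_real (esym j d)) \<le> e * top_prod j d" .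
    qed
    thus "t * top_prod k d \<le> top_prod k (\<lambda>i. cmod (z i))"
      using e(2)[of d z k] d k by (simp add: order_less_imp_le)
  qed
qed

lemma ln_top_prod_le:
  fixes d :: "'n::finite \<Rightarrow> real"
  assumes d: "\<And>i. d i > 0" and k: "k \<le> CARD('n)" and X: "\<And>i. \<bar>ln (d i)\<bar> \<le> X"
  shows "ln (top_prod k d) \<le> real k * X"
proof -
  obtain I where I: "card I = k" "top_prod k d = (\<Prod>i\<in>I. d i)" using top_prod_attained[OF k] .
  have "ln (top_prod k d) = (\<Sum>i\<in>I. ln (d i))"
    unfolding I(2) by (rule ln_prod[OF finite]) (metis d less_irrefl)
  also have "\<dots> \<le> real (card I) * X" using X by (intro sum_bounded_above) (meson abs_le_D1)
  finally show ?thesis using I by simp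
qed

text \<open>Let y_I be the sum of ln d over a k-set I. The hypothesis on e_k says that exp(2 y_I)
  has mean at least 1 over all I; if no y_I exceeds a small \<delta>, then none can lie far below 0.
  Exchanging one index of I shows that the ln d_i are nearly equal, hence all nearly 0.\<close>

lemma esym_squares_close_imp_near_one:
  fixes X0 :: real
  assumes k: "1 \<le> k" "k < CARD('n::finite)" and X0: "X0 > 0"
  shows "\<exists>\<delta>>0. \<forall>d :: 'n \<Rightarrow> real. (\<forall>i. d i > 0) \<longrightarrow> real (CARD('n) choose k) \<le> esym k (\<lambda>i. d i ^ 2) \<longrightarrow>
      ln (top_prod k d) \<le> \<delta> \<longrightarrow> (\<forall>i. \<bar>ln (d i)\<bar> \<le> X0)"
proof -
  let ?m = "real (CARD('n) choose k)"
  have m: "?m \<ge> 1" using k by (simp add: Suc_le_eq)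
  \<comment> \<open>One \<epsilon> is spent on the sum over a k-set and two on the difference of two
    logarithms.\<close>
  define \<epsilon> where "\<epsilon> = X0 / 3"
  have \<epsilon>: "\<epsilon> > 0" using X0 by (simp add: \<epsilon>_def)
  define g where "g = 1 - exp (- 2 * \<epsilon>)"
  have g: "g > 0" using \<epsilon> by (simp add: g_def)
  \<comment> \<open>A set with y_I < -\<epsilon> would lower the sum of the exponentials by more
    than g. The second bound on \<delta> ensures that the other sets together cannot make up for
    that.\<close>
  define \<delta> where "\<delta> = min \<epsilon> (ln (1 + g / ?m) / 2)"
  have "?m > 0" using m by linarith
  with g have gm: "g / ?m > 0" by (rule divide_pos_pos)
  have \<delta>: "\<delta> > 0" "\<delta> \<le> \<epsilon>" using \<epsilon> gm by (auto simp: \<delta>_def)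
  have "exp (2 * \<delta>) \<le> exp (ln (1 + g / ?m))" unfolding exp_le_cancel_iff by (simp add: \<delta>_def)
  hence e\<delta>: "exp (2 * \<delta>) \<le> 1 + g / ?m" using gm by simp
  show ?thesis
  proof (intro exI[of _ \<delta>] conjI allI impI \<delta>(1))
    fix d :: "'n \<Rightarrow> real" and i
    assume d: "\<forall>i. d i > 0" and es: "?m \<le> esym k (\<lambda>i. d i ^ 2)" and top: "ln (top_prod k d) \<le> \<delta>"
    define y where "y = (\<lambda>I. \<Sum>i\<in>I. ln (d i))"
    have P: "(\<Prod>i\<in>I. d i) = exp (y I)" for I
      using d by (simp add: y_def exp_sum)
    have P2: "(\<Prod>i\<in>I. d i ^ 2) = exp (2 * y I)" for I
      unfolding prod_power_distrib[symmetric] P by (simp add: exp_double)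
    have tp: "top_prod k d > 0" using top_prod_pos[of k d] d k by auto
    have yle: "y I \<le> \<delta>" if "card I = k" for I
    proof -
      have "exp (y I) \<le> top_prod k d" using top_prod_ge[OF that, of d] by (simp add: P)
      hence "y I \<le> ln (top_prod k d)" using tp by (metis ln_exp ln_le_cancel_iff exp_gt_zero)
      thus ?thesis using top by simp
    qed
    have yge: "y I \<ge> - \<epsilon>" if I: "card I = k" for I
    proof -
      let ?F = "{J :: 'n set. card J = k}"
      have "?m \<le> (\<Sum>J\<in>?F. exp (2 * y J))" using es by (simp add: esym_def P2)
      also have "\<dots> = exp (2 * y I) + (\<Sum>J\<in>?F - {I}. exp (2 * y J))"
        using I by (intro sum.remove) auto
      also have "(\<Sum>J\<in>?F - {I}. exp (2 * y J)) \<le> real (card (?F - {I})) * exp (2 * \<delta>)"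
        by (rule sum_bounded_above) (auto intro: yle)
      also have "real (card (?F - {I})) = ?m - 1"
        using I m by (simp add: card_subsets_type card_Diff_singleton of_nat_diff)
      also have "(?m - 1) * exp (2 * \<delta>) \<le> (?m - 1) * (1 + g / ?m)"
        using m by (intro mult_left_mono e\<delta>) auto
      also have "\<dots> \<le> ?m - 1 + g"
      proof -
        have "(?m - 1) * (g / ?m) \<le> ?m * (g / ?m)" using gm by (intro mult_right_mono) auto
        also have "\<dots> = g" using \<open>?m > 0\<close>
          by (metis less_irrefl nonzero_mult_div_cancel_left times_divide_eq_right)
        finally show ?thesis by (simp add: distrib_left)
      qed
      finally have "exp (- 2 * \<epsilon>) \<le> exp (2 * y I)" by (simp add: g_def)
      thus ?thesis by simp
    qed
    have diff: "ln (d i) - ln (d j) \<le> 2 * \<epsilon>" for i j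
    proof (cases "i = j")
      case False
      have "card (UNIV - {i, j}) = CARD('n) - 2" using False by (simp add: card_Diff_subset)
      hence "k - 1 \<le> card (UNIV - {i, j})" using k by simp
      \<comment> \<open>A common set of k - 1 indices that completes both i and j to a k-set; it
        exists because k < n.\<close>
      then obtain T where T: "T \<subseteq> UNIV - {i, j}" "card T = k - 1" "finite T"
        by (rule obtain_subset_with_card_n)
      have "i \<notin> T" "j \<notin> T" using T by auto
      hence c: "card (insert i T) = k" "card (insert j T) = k" using T k by auto
      have "ln (d i) - ln (d j) = y (insert i T) - y (insert j T)"
        using T \<open>i \<notin> T\<close> \<open>j \<notin> T\<close> by (simp add: y_def)
      thus ?thesis using yle[OF c(1)] yge[OF c(2)] \<delta>(2) by linarith
    qed (use \<epsilon> in simp)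
    have "k \<le> CARD('n)" using k by simp
    then obtain I :: "'n set" where I: "card I = k" using exists_subset_card by blast
    have kx: "real k * ln (d i) = y I + (\<Sum>j\<in>I. ln (d i) - ln (d j))"
      using I by (simp add: y_def sum_subtractf)
    have "(\<Sum>j\<in>I. ln (d i) - ln (d j)) \<le> real (card I) * (2 * \<epsilon>)"
      by (rule sum_bounded_above) (rule diff)
    moreover have "real (card I) * (- (2 * \<epsilon>)) \<le> (\<Sum>j\<in>I. ln (d i) - ln (d j))"
      by (rule sum_bounded_below) (use diff in \<open>smt (verit)\<close>)
    moreover have "\<epsilon> \<le> real k * \<epsilon>" using k \<epsilon> by simp
    ultimately have "real k * ln (d i) \<le> real k * X0" "real k * (- X0) \<le> real k * ln (d i)"
      using kx yle[OF I] yge[OF I] \<delta>(2) I by (auto simp: \<epsilon>_def)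
    moreover have "real k > 0" using k by simp
    ultimately have "ln (d i) \<le> X0" "- X0 \<le> ln (d i)" by (simp_all only: mult_le_cancel_left_pos)
    thus "\<bar>ln (d i)\<bar> \<le> X0" by linarith
  qed
qed

lemma exp_le_quadratic:
  fixes u :: real
  assumes "\<bar>u\<bar> \<le> 1"
  shows "exp u \<le> 1 + u + u^2"
proof (cases "u \<ge> 0")
  case True
  thus ?thesis using exp_bound[of u] assms by auto
next
  case False
  define v where "v = - u"
  have v: "v > 0" using False by (simp add: v_def)
  have "exp u = 1 / exp v" by (simp add: v_def exp_minus field_simps)
  also have "\<dots> \<le> 1 / (1 + v)" using v by (intro divide_left_mono exp_ge_add_one_self) auto
  also have "\<dots> \<le> 1 - v + v^2"
  proof -
    have "1 \<le> (1 - v + v^2) * (1 + v)" using v by (simp add: algebra_simps power2_eq_square)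
    thus ?thesis using v by (simp add: field_simps)
  qed
  finally show ?thesis by (simp add: v_def)
qed

text \<open>Expand the exponentials in e_k(d^2) to second order. The constant terms cancel against
  the binomial coefficient, the linear terms add up to a multiple of the sum of all ln d_i, and the
  remainder is quadratic in X. Thus ln |det A| can be negative only to second order. The condition
  \<open>2 * real k * X \<le> 1\<close> keeps the arguments in the range of the quadratic bound for
  exp.\<close>

lemma sum_ln_ge:
  fixes d :: "'n::finite \<Rightarrow> real"
  assumes k: "1 \<le> k" "k \<le> CARD('n)" and d: "\<And>i. d i > 0"
    and es: "real (CARD('n) choose k) \<le> esym k (\<lambda>i. d i ^ 2)"
    and X: "\<And>i. \<bar>ln (d i)\<bar> \<le> X" "2 * real k * X \<le> 1"
  shows "(\<Sum>i\<in>UNIV. ln (d i)) \<ge> - (2 * real CARD('n) * real k * X^2)"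
proof -
  let ?m = "real (CARD('n) choose k)" and ?F = "{J :: 'n set. card J = k}" and ?n = "CARD('n)"
  define y where "y = (\<lambda>I. \<Sum>i\<in>I. ln (d i))"
  have P: "(\<Prod>i\<in>I. d i) = exp (y I)" for I
    using d by (simp add: y_def exp_sum)
  have P2: "(\<Prod>i\<in>I. d i ^ 2) = exp (2 * y I)" for I
    unfolding prod_power_distrib[symmetric] P by (simp add: exp_double)
  have X0: "X \<ge> 0" using X(1) abs_ge_zero order_trans by blast
  have yb: "\<bar>y I\<bar> \<le> real k * X" if "card I = k" for I
  proof -
    have "\<bar>y I\<bar> \<le> (\<Sum>i\<in>I. \<bar>ln (d i)\<bar>)" unfolding y_def by (rule sum_abs)
    also have "\<dots> \<le> real (card I) * X" by (rule sum_bounded_above) (rule X(1))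
    finally show ?thesis using that by simp
  qed
  have "?m \<le> (\<Sum>J\<in>?F. exp (2 * y J))" using es by (simp add: esym_def P2)
  also have "\<dots> \<le> (\<Sum>J\<in>?F. 1 + 2 * y J + 4 * (real k * X)^2)"
  proof (rule sum_mono)
    fix J assume "J \<in> ?F"
    hence J: "\<bar>y J\<bar> \<le> real k * X" using yb by simp
    hence "\<bar>2 * y J\<bar> \<le> 1" using X(2) by simp
    hence "exp (2 * y J) \<le> 1 + 2 * y J + (2 * y J)^2" by (rule exp_le_quadratic)
    also have "(2 * y J)^2 = 4 * \<bar>y J\<bar>^2" by (simp add: power2_eq_square)
    also have "\<bar>y J\<bar>^2 \<le> (real k * X)^2" using J by (intro power_mono) auto
    finally show "exp (2 * y J) \<le> 1 + 2 * y J + 4 * (real k * X)^2" by simp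
  qed
  also have "\<dots> = ?m + 2 * (\<Sum>J\<in>?F. y J) + ?m * (4 * (real k * X)^2)"
    by (simp add: sum.distrib card_subsets_type sum_distrib_left)
  also have "(\<Sum>J\<in>?F. y J) = real ((?n - 1) choose (k - 1)) * (\<Sum>i\<in>UNIV. ln (d i))"
    using sum_over_subsets[of "UNIV :: 'n set" k "\<lambda>i. ln (d i)"] k(1) by (simp add: y_def)
  finally have "0 \<le> real ((?n - 1) choose (k - 1)) * (\<Sum>i\<in>UNIV. ln (d i)) + ?m * (2 * (real k * X)^2)"
    by simp
  hence "0 \<le> real k * (real ((?n - 1) choose (k - 1)) * (\<Sum>i\<in>UNIV. ln (d i)) + ?m * (2 * (real k * X)^2))"
    by simp
  also have "\<dots> = real k * real ((?n - 1) choose (k - 1)) * (\<Sum>i\<in>UNIV. ln (d i))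
      + (real k * ?m) * (2 * (real k * X)^2)" by (simp add: distrib_left)
  also have "real k * ?m = real ?n * real ((?n - 1) choose (k - 1))"
  proof -
    have "k * (?n choose k) = ?n * ((?n - 1) choose (k - 1))"
      using binomial_absorption[of "k - 1" ?n] k by simp
    thus ?thesis by (metis of_nat_mult)
  qed
  also have "real k * real ((?n - 1) choose (k - 1)) * (\<Sum>i\<in>UNIV. ln (d i))
      + real ?n * real ((?n - 1) choose (k - 1)) * (2 * (real k * X)^2)
     = (real k * real ((?n - 1) choose (k - 1))) * ((\<Sum>i\<in>UNIV. ln (d i)) + 2 * real ?n * real k * X^2)"
    by (simp add: algebra_simps power2_eq_square)
  finally have "0 \<le> (real k * real ((?n - 1) choose (k - 1))) * ((\<Sum>i\<in>UNIV. ln (d i)) + 2 * real ?n * real k * X^2)" .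
  moreover have "real k * real ((?n - 1) choose (k - 1)) > 0"
    using k by (simp add: binomial_eq_0_iff)
  ultimately have "0 \<le> (\<Sum>i\<in>UNIV. ln (d i)) + 2 * real ?n * real k * X^2"
    by (metis not_less mult_pos_neg)
  thus ?thesis by simp
qed

text \<open>Since k < n, averaging over the k-subsets that avoid i bounds the sum of all other
  entries from above, so the lower bound on the total keeps \<open>l i\<close> from being very
  negative. For the upper bound, take a k-set containing i and insert the lower bounds for its other
  entries.\<close>

lemma abs_le_of_subset_sums:
  fixes l :: "'n::finite \<Rightarrow> real"
  assumes k: "1 \<le> k" "k < CARD('n)" and \<eta>: "0 \<le> \<eta>" and \<kappa>: "0 \<le> \<kappa>"
    and le: "\<And>I. card I = k \<Longrightarrow> (\<Sum>i\<in>I. l i) \<le> \<eta>" and ge: "(\<Sum>i\<in>UNIV. l i) \<ge> - \<kappa>"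
  shows "\<bar>l i\<bar> \<le> (real CARD('n)^2 + 1) * (\<eta> + \<kappa>)"
proof -
  let ?n = "real CARD('n)"
  have n1: "?n \<ge> 1" by (simp add: Suc_le_eq)
  have lower: "- (?n * (\<eta> + \<kappa>)) \<le> l i" for i
  proof -
    let ?T = "UNIV - {i}"
    have cT: "card ?T = CARD('n) - 1" by (simp add: card_Diff_subset)
    have "real k * (\<Sum>i\<in>?T. l i) \<le> real (card ?T) * \<eta>"
      by (rule sum_le_of_subset_sums) (use k cT le in auto)
    also have "\<dots> \<le> ?n * \<eta>" using \<eta> by (intro mult_right_mono) (auto simp: cT)
    also have "\<dots> \<le> real k * (?n * \<eta>)" using mult_right_mono[of 1 "real k" "?n * \<eta>"] k \<eta> by simp
    finally have "(\<Sum>i\<in>?T. l i) \<le> ?n * \<eta>" using k by simp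
    moreover have "(\<Sum>i\<in>UNIV. l i) = l i + (\<Sum>i\<in>?T. l i)" by (rule sum.remove) auto
    moreover have "\<kappa> \<le> ?n * \<kappa>" using n1 \<kappa> by (simp add: mult_le_cancel_right1)
    ultimately show ?thesis using ge by (simp add: distrib_left)
  qed
  have upper: "l i \<le> (?n^2 + 1) * (\<eta> + \<kappa>)"
  proof -
    have "card (UNIV - {i}) = CARD('n) - 1" by (simp add: card_Diff_subset)
    hence "k - 1 \<le> card (UNIV - {i})" using k by simp
    then obtain T where T: "T \<subseteq> UNIV - {i}" "card T = k - 1" "finite T"
      by (rule obtain_subset_with_card_n)
    have "i \<notin> T" using T by auto
    have "card (insert i T) = k" using T k \<open>i \<notin> T\<close> by simp
    from le[OF this] have "l i + (\<Sum>i\<in>T. l i) \<le> \<eta>" using T \<open>i \<notin> T\<close> by simp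
    moreover have "real (card T) * (- (?n * (\<eta> + \<kappa>))) \<le> (\<Sum>i\<in>T. l i)"
      by (rule sum_bounded_below) (rule lower)
    moreover have "real (card T) * (?n * (\<eta> + \<kappa>)) \<le> ?n * (?n * (\<eta> + \<kappa>))"
      using T k \<eta> \<kappa> by (intro mult_right_mono) auto
    ultimately show ?thesis using \<kappa> by (simp add: algebra_simps power2_eq_square)
  qed
  have "?n * (\<eta> + \<kappa>) \<le> (?n^2 + 1) * (\<eta> + \<kappa>)"
  proof (intro mult_right_mono)
    have "?n * 1 \<le> ?n * ?n" using n1 by (intro mult_left_mono) auto
    thus "?n \<le> ?n^2 + 1" unfolding power2_eq_square by linarith
  qed (use \<eta> \<kappa> in auto)
  thus ?thesis using lower[of i] upper by linarith
qed

section \<open>The quantity d - 1/d near d = 1, and reciprocals of eigenvalues\<close>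

lemma abs_diff_inverse_ge:
  fixes d :: real
  assumes "d > 0"
  shows "\<bar>ln d\<bar> \<le> \<bar>d - 1 / d\<bar>"
proof -
  have *: "ln d \<le> d - 1 / d" if "d \<ge> 1" for d :: real
  proof -
    have "ln (1 / d) \<le> 1 / d - 1" "ln d \<le> d - 1" using that by (auto intro: ln_le_minus_one)
    moreover have "1 / d \<le> 1" using that by simp
    ultimately show ?thesis by linarith
  qed
  show ?thesis
  proof (cases "d \<ge> 1")
    case True
    thus ?thesis using *[OF True] by simp
  next
    case False
    hence "1 / d \<ge> 1" using assms by simp
    from *[OF this] have "- ln d \<le> 1 / d - d" using assms by (simp add: ln_div)
    moreover have "ln d \<le> 0" using False assms by simp
    ultimately show ?thesis by linarith
  qed
qed

lemma abs_diff_inverse_le: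
  fixes d :: real
  assumes "d > 0" "\<bar>ln d\<bar> \<le> 1"
  shows "\<bar>d - 1 / d\<bar> \<le> 3 * \<bar>ln d\<bar>"
proof -
  have *: "exp v - exp (- v) \<le> 3 * v" if "0 \<le> v" "v \<le> 1" for v :: real
  proof -
    have "exp v \<le> 1 + v + v^2" using that by (intro exp_le_quadratic) auto
    moreover have "v^2 \<le> v" using that by (simp add: power2_eq_square mult_left_le)
    moreover have "exp (- v) \<ge> 1 - v" using exp_ge_add_one_self[of "-v"] by simp
    ultimately show ?thesis by linarith
  qed
  have d: "d = exp (ln d)" "1 / d = exp (- ln d)" using assms by (auto simp: exp_minus field_simps)
  show ?thesis
  proof (cases "ln d \<ge> 0")
    case True
    have "exp (- ln d) \<le> exp (ln d)" using True by simp
    thus ?thesis using *[of "ln d"] True assms d by simp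
  next
    case False
    have "exp (ln d) \<le> exp (- ln d)" using False by simp
    thus ?thesis using *[of "- ln d"] False assms d by simp
  qed
qed

lemma esym_CARD_minus_1:
  fixes z :: "'n::finite \<Rightarrow> 'a::field"
  assumes "\<And>i. z i \<noteq> 0"
  shows "esym (CARD('n) - 1) z = (\<Prod>i\<in>UNIV. z i) * (\<Sum>i\<in>UNIV. 1 / z i)"
proof -
  have "{I :: 'n set. card I = CARD('n) - 1} = range (\<lambda>i. UNIV - {i})"
  proof (intro set_eqI iffI)
    fix I :: "'n set" assume "I \<in> {I. card I = CARD('n) - 1}"
    hence I: "card I = CARD('n) - 1" by simp
    have "CARD('n) > 0" by simp
    hence "card (UNIV - I) = 1" using I by (subst card_Diff_subset) auto
    then obtain i where "UNIV - I = {i}" by (auto simp: card_1_singleton_iff)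
    hence "I = UNIV - {i}" by auto
    thus "I \<in> range (\<lambda>i. UNIV - {i})" by auto
  qed (auto simp: card_Diff_subset)
  moreover have "inj (\<lambda>i :: 'n. UNIV - {i})" by (auto simp: inj_on_def)
  ultimately have "esym (CARD('n) - 1) z = (\<Sum>i\<in>UNIV. \<Prod>j\<in>UNIV - {i}. z j)"
    by (simp add: esym_def sum.reindex)
  also have "\<dots> = (\<Sum>i\<in>UNIV. (\<Prod>j\<in>UNIV. z j) * (1 / z i))"
  proof (intro sum.cong refl)
    fix i
    have "(\<Prod>j\<in>UNIV. z j) = z i * (\<Prod>j\<in>UNIV - {i}. z j)" by (rule prod.remove) auto
    thus "(\<Prod>j\<in>UNIV - {i}. z j) = (\<Prod>j\<in>UNIV. z j) * (1 / z i)" using assms by simp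
  qed
  finally show ?thesis by (simp add: sum_distrib_left)
qed

text \<open>Evaluate e_(n-1) twice: on the eigenvalues it is their product times the sum of the
  reciprocals, on the matrix it is the determinant times the trace of the inverse.\<close>

lemma eigvals_trace_inverse:
  fixes A B :: "real ^ 'n ^ 'n"
  assumes z: "eigvals A z" and AB: "A ** B = mat 1"
  shows "(\<Sum>i\<in>UNIV. 1 / z i) = of_real (trace B)"
proof -
  have "invertible A" using AB by (metis invertible_def matrix_left_right_inverse)
  hence nz: "z i \<noteq> 0" for i by (rule eigvals_nonzero[OF z])
  have n: "1 \<le> CARD('n)" by (simp add: Suc_le_eq)
  have "pminor_sum (CARD('n) - 1) A = det A * trace B"
    using pminor_sum_inverse[OF AB n] unfolding pminor_sum_1 .
  hence "esym (CARD('n) - 1) z = of_real (det A) * of_real (trace B)"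
    using z unfolding eigvals_def by (metis of_real_mult)
  hence "(\<Prod>i\<in>UNIV. z i) * (\<Sum>i\<in>UNIV. 1 / z i) = (\<Prod>i\<in>UNIV. z i) * of_real (trace B)"
    unfolding esym_CARD_minus_1[OF nz] eigvals_prod[OF z] .
  moreover have "(\<Prod>i\<in>UNIV. z i) \<noteq> 0" using nz by simp
  ultimately show ?thesis by (metis mult_left_cancel)
qed

text \<open>\<open>1 / cnj z\<close> is the reflection of z in the unit circle. It lies on the same
  ray as z, so the distance between them is a difference of moduli.\<close>

lemma cmod_diff_inverse_cnj:
  assumes "z \<noteq> 0"
  shows "cmod (z - 1 / cnj z) = \<bar>cmod z - 1 / cmod z\<bar>"
proof -
  have "z - 1 / cnj z = (z * cnj z - 1) / cnj z" using assms by (simp add: field_simps)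
  also have "z * cnj z - 1 = of_real ((cmod z)^2 - 1)" by (simp flip: complex_norm_square)
  finally have "cmod (z - 1 / cnj z) = \<bar>(cmod z)^2 - 1\<bar> / cmod z"
    by (simp only: norm_divide norm_of_real complex_mod_cnj)
  also have "\<dots> = \<bar>((cmod z)^2 - 1) / cmod z\<bar>" by (simp add: abs_divide)
  also have "((cmod z)^2 - 1) / cmod z = cmod z - 1 / cmod z"
    using assms by (simp add: field_simps power2_eq_square)
  finally show ?thesis .
qed

text \<open>If all eigenvalues of $B$ lie near the unit circle then $\overline{\lambda} \approx 1/\lambda$, so
  $\mathrm{tr}\, B \approx \mathrm{tr}\, B^{-1}$. For $B = R\, \mathrm{diag}(d)$ the difference of these
  traces is linear in $R$ and controls every $d_i$.\<close>

lemma near_orthogonal_bound: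
  fixes R :: "real ^ 'n ^ 'n"
  assumes R: "orthogonal_matrix R" and d: "\<And>i. d i > 0" and d1: "\<And>i. \<bar>ln (d i)\<bar> \<le> 1"
    and sgn: "\<And>i. \<bar>d i - 1 / d i\<bar> \<le> 2 * (R $ i $ i * (d i - 1 / d i))"
    and z: "eigvals (R ** diag_mat d) z"
    and k: "1 \<le> k" "k < CARD('n)" and \<eta>: "0 \<le> \<eta>" and \<kappa>: "0 \<le> \<kappa>"
    and le: "ln (top_prod k (\<lambda>i. cmod (z i))) \<le> \<eta>" and ge: "(\<Sum>i\<in>UNIV. ln (d i)) \<ge> - \<kappa>"
  shows "\<bar>ln (d i)\<bar> \<le> 6 * real CARD('n) * (real CARD('n)^2 + 1) * (\<eta> + \<kappa>)"
proof -
  let ?n = "real CARD('n)" and ?B = "R ** diag_mat d"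
  let ?K = "?n^2 + 1"
  let ?B' = "diag_mat (\<lambda>i. 1 / d i) ** transpose R"
  have n1: "?n \<ge> 1" by (simp add: Suc_le_eq)
  have dn: "d i \<noteq> 0" for i using d[of i] by simp
  have "?B ** ?B' = R ** (diag_mat d ** diag_mat (\<lambda>i. 1 / d i)) ** transpose R"
    by (simp add: matrix_mul_assoc)
  hence BB': "?B ** ?B' = mat 1"
    using dn by (simp add: diag_mat_mult diag_mat_one orthogonal_matrixD[OF R])
  have inv: "invertible ?B" using BB' by (metis invertible_def matrix_left_right_inverse)
  have nz: "z i \<noteq> 0" for i by (rule eigvals_nonzero[OF z inv])
  define l where "l = (\<lambda>i. ln (cmod (z i)))"
  have "(\<Sum>i\<in>UNIV. l i) = ln (\<Prod>i\<in>UNIV. cmod (z i))"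
    unfolding l_def using nz by (intro ln_prod[symmetric]) auto
  also have "(\<Prod>i\<in>UNIV. cmod (z i)) = \<bar>det ?B\<bar>"
    using arg_cong[OF eigvals_prod[OF z], of cmod] by (simp add: prod_norm)
  also have "\<bar>det ?B\<bar> = (\<Prod>i\<in>UNIV. d i)"
  proof -
    have "\<bar>det R\<bar> = 1" using det_orthogonal_matrix[OF R] by auto
    moreover have "(\<Prod>i\<in>UNIV. d i) > 0" using d by (intro prod_pos) auto
    ultimately show ?thesis by (simp add: det_mul det_diag_mat abs_mult)
  qed
  also have "ln \<dots> = (\<Sum>i\<in>UNIV. ln (d i))" using dn by (intro ln_prod) auto
  finally have sum_l: "(\<Sum>i\<in>UNIV. l i) \<ge> - \<kappa>" using ge by simp
  have l_le: "(\<Sum>i\<in>I. l i) \<le> \<eta>" if "card I = k" for I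
  proof -
    have pos: "(\<Prod>i\<in>I. cmod (z i)) > 0" using nz by (intro prod_pos) auto
    have "(\<Sum>i\<in>I. l i) = ln (\<Prod>i\<in>I. cmod (z i))"
      unfolding l_def using nz by (intro ln_prod[symmetric]) auto
    also have "\<dots> \<le> ln (top_prod k (\<lambda>i. cmod (z i)))"
      using top_prod_ge[OF that, of "\<lambda>i. cmod (z i)"] pos by (intro ln_mono) auto
    finally show ?thesis using le by simp
  qed
  have l: "\<bar>l j\<bar> \<le> ?K * (\<eta> + \<kappa>)" for j
    by (rule abs_le_of_subset_sums[OF k \<eta> \<kappa> l_le sum_l])
  have Kpos: "?K * (\<eta> + \<kappa>) \<ge> 0" using \<eta> \<kappa> by simp
  show ?thesis
  \<comment> \<open>If this fails, the claim is weaker than the hypothesis \<open>d1\<close>.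
    Otherwise all \<open>l j\<close> have absolute value at most 1, the range in which |x - 1/x| is
    bounded by 3 |ln x|.\<close>
  proof (cases "?K * (\<eta> + \<kappa>) \<le> 1")
    case False
    have "1 \<le> 1 * (?K * (\<eta> + \<kappa>))" using False by simp
    also have "\<dots> \<le> (6 * ?n) * (?K * (\<eta> + \<kappa>))" by (intro mult_right_mono Kpos) (use n1 in linarith)
    finally show ?thesis using d1[of i] by (simp add: mult.assoc)
  next
    case True
    have tB: "trace ?B = (\<Sum>i\<in>UNIV. R $ i $ i * d i)"
      by (simp add: trace_def mult_diag_mat_nth)
    have tB': "trace ?B' = (\<Sum>i\<in>UNIV. R $ i $ i * (1 / d i))"
      by (simp add: trace_def diag_mat_mult_nth transpose_def)
    have s1: "(\<Sum>i\<in>UNIV. z i) = of_real (trace ?B)"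
      using z unfolding eigvals_def by (metis esym_1 pminor_sum_1)
    \<comment> \<open>Conjugation changes nothing on the right, since the trace is real, and makes
      each summand comparable with \<open>z i\<close>.\<close>
    have s2: "(\<Sum>i\<in>UNIV. 1 / cnj (z i)) = of_real (trace ?B')"
      using arg_cong[OF eigvals_trace_inverse[OF z BB'], of cnj] by simp
    \<comment> \<open>Hypothesis \<open>sgn\<close> excludes cancellation in the difference of the
      traces: each diagonal term is at least half of |d_j - 1/d_j|. This bounds every single
      d_i.\<close>
    have "\<bar>d i - 1 / d i\<bar> \<le> (\<Sum>j\<in>UNIV. \<bar>d j - 1 / d j\<bar>)"
      by (rule member_le_sum) auto
    also have "\<dots> \<le> (\<Sum>j\<in>UNIV. 2 * (R $ j $ j * (d j - 1 / d j)))"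
      by (intro sum_mono sgn)
    also have "\<dots> = 2 * (trace ?B - trace ?B')"
      by (simp add: tB tB' sum_distrib_left right_diff_distrib sum_subtractf)
    also have "\<dots> \<le> 2 * cmod (of_real (trace ?B - trace ?B'))"
      unfolding norm_of_real by (intro mult_left_mono abs_ge_self) auto
    also have "of_real (trace ?B - trace ?B') = (\<Sum>j\<in>UNIV. z j - 1 / cnj (z j))"
      by (simp add: sum_subtractf s1 s2)
    also have "cmod \<dots> \<le> (\<Sum>j\<in>(UNIV :: 'n set). 3 * (?K * (\<eta> + \<kappa>)))"
    proof (intro order_trans[OF norm_sum] sum_mono)
      fix j
      have "cmod (z j - 1 / cnj (z j)) = \<bar>cmod (z j) - 1 / cmod (z j)\<bar>"
        by (rule cmod_diff_inverse_cnj[OF nz])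
      also have "\<dots> \<le> 3 * \<bar>l j\<bar>"
        unfolding l_def by (rule abs_diff_inverse_le) (use nz l[of j] True in \<open>auto simp: l_def\<close>)
      also have "\<dots> \<le> 3 * (?K * (\<eta> + \<kappa>))" using l by simp
      finally show "cmod (z j - 1 / cnj (z j)) \<le> 3 * (?K * (\<eta> + \<kappa>))" .
    qed
    finally have "\<bar>d i - 1 / d i\<bar> \<le> 2 * (?n * (3 * (?K * (\<eta> + \<kappa>))))" by simp
    with abs_diff_inverse_ge[OF d, of i] show ?thesis by simp
  qed
qed

text \<open>The function Phi of the overview. For invertible A and k \<le> n it is the logarithm of
  the Frobenius norm of the k-th exterior power of A, normalized to vanish at orthogonal
  matrices.\<close>

definition mean_log_growth :: "nat \<Rightarrow> real ^ 'n ^ 'n \<Rightarrow> real" where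
  "mean_log_growth k A = ln (pminor_sum k (transpose A ** A) / real (CARD('n) choose k)) / 2"

lemma pminor_sum_gram_svd:
  fixes U V :: "real ^ 'n ^ 'n"
  assumes U: "orthogonal_matrix U" and V: "orthogonal_matrix V" and A: "A = U ** diag_mat d ** V"
  shows "pminor_sum k (transpose A ** A) = esym k (\<lambda>i. d i ^ 2)"
proof -
  have "transpose A ** A = transpose V ** (diag_mat d ** (transpose U ** U) ** diag_mat d) ** V"
    by (simp add: A matrix_transpose_mul matrix_mul_assoc)
  also have "\<dots> = transpose V ** diag_mat (\<lambda>i. d i ^ 2) ** V"
    by (simp add: orthogonal_matrixD[OF U] diag_mat_mult power2_eq_square)
  finally show ?thesis by (simp add: pminor_sum_orthogonal_conj[OF V] pminor_sum_diag)
qed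

lemma pminor_sum_gram_pos:
  fixes A :: "real ^ 'n ^ 'n"
  assumes "invertible A" "k \<le> CARD('n)"
  shows "pminor_sum k (transpose A ** A) > 0"
proof -
  obtain U V d where UV: "orthogonal_matrix U" "orthogonal_matrix V" "\<And>i. d i > 0" "A = U ** diag_mat d ** V"
    using singular_value_decomposition[OF assms(1)] by metis
  have "0 < top_prod k (\<lambda>i. d i ^ 2)" 
    using UV(3) by (intro top_prod_pos assms zero_less_power) auto
  also have "\<dots> \<le> esym k (\<lambda>i. d i ^ 2)" by (intro top_prod_le_esym assms) auto
  also have "\<dots> = pminor_sum k (transpose A ** A)" using pminor_sum_gram_svd[OF UV(1,2,4)] by simp
  finally show ?thesis .
qed

text \<open>Conjugation by V moves it to the front. Choosing Q thus amounts to choosing the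
  orthogonal factor V Q U in front of the diagonal matrix of singular values.\<close>

lemma eigvals_orthogonal_svd:
  fixes Q U V :: "real ^ 'n ^ 'n"
  assumes V: "orthogonal_matrix V" and A: "A = U ** diag_mat d ** V"
  shows "eigvals (Q ** A) z \<longleftrightarrow> eigvals ((V ** Q ** U) ** diag_mat d) z"
proof -
  have "transpose V ** ((V ** Q ** U) ** diag_mat d) ** V = (transpose V ** V) ** Q ** A"
    by (simp add: A matrix_mul_assoc)
  hence "Q ** A = transpose V ** ((V ** Q ** U) ** diag_mat d) ** V"
    by (simp add: orthogonal_matrixD[OF V])
  thus ?thesis using eigvals_orthogonal_conj[OF V] by metis
qed

lemma mean_log_growth_le_top:
  fixes d :: "'n::finite \<Rightarrow> real"
  assumes k: "k \<le> CARD('n)" and d: "\<And>i. d i > 0"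
  shows "ln (esym k (\<lambda>i. d i ^ 2) / real (CARD('n) choose k)) / 2 \<le> ln (top_prod k d)"
proof -
  have C: "real (CARD('n) choose k) > 0" using k by simp
  have t: "top_prod k d > 0" by (rule top_prod_pos[OF k d])
  have "esym k (\<lambda>i. d i ^ 2) \<le> real (CARD('n) choose k) * top_prod k (\<lambda>i. d i ^ 2)"
    using norm_esym_le[of k "\<lambda>i. d i ^ 2"] by simp
  also have "top_prod k (\<lambda>i. d i ^ 2) = top_prod k d ^ 2"
    by (rule top_prod_power[OF k]) (simp add: d less_imp_le)
  finally have le: "esym k (\<lambda>i. d i ^ 2) / real (CARD('n) choose k) \<le> top_prod k d ^ 2"
    using C by (simp add: field_simps)
  have "0 < top_prod k (\<lambda>i. d i ^ 2)" using d by (intro top_prod_pos k zero_less_power)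
  also have "\<dots> \<le> esym k (\<lambda>i. d i ^ 2)" by (intro top_prod_le_esym k) auto
  finally have "ln (esym k (\<lambda>i. d i ^ 2) / real (CARD('n) choose k)) \<le> ln (top_prod k d ^ 2)"
    using le C by (intro ln_mono divide_pos_pos) auto
  also have "\<dots> = 2 * ln (top_prod k d)" using t by (simp add: ln_realpow)
  finally show ?thesis by simp
qed

lemma eig_prod_ge_mean_log_growth_proper:
  assumes k: "1 \<le> k" "k < CARD('n)"
  shows "\<exists>(S :: (real ^ 'n ^ 'n) set) c. finite S \<and> (\<forall>Q\<in>S. orthogonal_matrix Q) \<and> c > 0 \<and>
    (\<forall>A. invertible A \<longrightarrow> (\<exists>Q\<in>S. c * pos_part (mean_log_growth k A) \<le> pos_part (ln (eig_prod k (Q ** A)))))"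
proof -
  let ?n = "real CARD('n)"
  have k': "k \<le> CARD('n)" using k by simp
  have n1: "?n \<ge> 1" by (simp add: Suc_le_eq)
  have k1: "real k \<ge> 1" using k by simp
  \<comment> \<open>The factor in front of \<open>\<eta> + \<kappa>\<close> in
    \<open>near_orthogonal_bound\<close>.\<close>
  define K where "K = 6 * ?n * (?n^2 + 1)"
  have "1 \<le> 6 * ?n" using n1 by linarith
  moreover have "1 \<le> ?n^2 + 1" by simp
  ultimately have "1 * 1 \<le> (6 * ?n) * (?n^2 + 1)" by (rule mult_mono) auto
  hence K1: "K \<ge> 1" by (simp add: K_def)
  \<comment> \<open>With X the largest |ln d_i| and \<kappa> = 2 n k X^2 the possible determinant
    deficit, X \<le> X0 gives K \<kappa> \<le> X / 2. This half is absorbed into the left side of X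
    \<le> K (\<eta> + \<kappa>).\<close>
  define X0 where "X0 = 1 / (4 * ?n * real k * K)"
  have big: "4 * ?n * real k * K \<ge> 4 * real k"
  proof -
    have "1 * 1 \<le> ?n * K" using n1 K1 by (intro mult_mono) auto
    hence "4 * real k * 1 \<le> 4 * real k * (?n * K)" by (intro mult_left_mono) auto
    thus ?thesis by (simp add: ac_simps)
  qed
  have D0: "4 * ?n * real k * K > 0" using big k1 by linarith
  have X0: "X0 > 0" unfolding X0_def using D0 by (rule divide_pos_pos[OF zero_less_one])
  have kX0: "2 * real k * X0 \<le> 1"
  proof -
    have "2 * real k * X0 = 2 * real k / (4 * ?n * real k * K)" by (simp add: X0_def)
    also have "\<dots> \<le> 1" unfolding pos_divide_le_eq[OF D0] using big by linarith
    finally show ?thesis .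
  qed
  have "1 * X0 \<le> 2 * real k * X0" using k1 X0 by (intro mult_right_mono) auto
  hence X01: "X0 \<le> 1" using kX0 by simp
  obtain \<delta> where \<delta>: "\<delta> > 0" "\<And>(d :: 'n \<Rightarrow> real) i. (\<And>i. d i > 0) \<Longrightarrow>
      real (CARD('n) choose k) \<le> esym k (\<lambda>i. d i ^ 2) \<Longrightarrow> ln (top_prod k d) \<le> \<delta> \<Longrightarrow> \<bar>ln (d i)\<bar> \<le> X0"
    using esym_squares_close_imp_near_one[OF k X0] by metis
  \<comment> \<open>A loss of \<delta> / 2 in the logarithm costs at most half of
    \<open>ln (top_prod k d)\<close> as soon as that exceeds \<delta>.\<close>
  define t where "t = exp (- \<delta> / 2)"
  have t: "0 < t" "t < 1" using \<delta>(1) by (auto simp: t_def)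
  obtain r1 where r1: "r1 > 0" "\<And>(R :: real ^ 'n ^ 'n) d z k. norm (R - mat 1) < r1 \<Longrightarrow> (\<And>i. d i > 0) \<Longrightarrow>
      eigvals (R ** diag_mat d) z \<Longrightarrow> k \<le> CARD('n) \<Longrightarrow> t * top_prod k d \<le> top_prod k (\<lambda>i. cmod (z i))"
    using top_prod_of_eigvals_close[OF t] by metis
  \<comment> \<open>The bound 1/2 keeps the diagonal entries of V Q U within 1/2 of the target signs
    in the nearly orthogonal case.\<close>
  define r where "r = min r1 (1/2)"
  have r: "r > 0" using r1 by (simp add: r_def)
  obtain S :: "(real ^ 'n ^ 'n) set" where S: "finite S" "\<And>Q. Q \<in> S \<Longrightarrow> orthogonal_matrix Q"
    "\<And>U V T. orthogonal_matrix U \<Longrightarrow> orthogonal_matrix V \<Longrightarrow> orthogonal_matrix T \<Longrightarrow>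
        \<exists>Q\<in>S. norm (V ** Q ** U - T) < r"
    by (rule orthogonal_net[OF r]) blast
  \<comment> \<open>The first term is the constant for large singular products, the second the one
    for nearly orthogonal matrices.\<close>
  define c where "c = min (1/2) (1 / (2 * real k * K))"
  have c: "c > 0" "c \<le> 1/2" "c \<le> 1 / (2 * real k * K)" using k1 K1 by (auto simp: c_def)
  show ?thesis
  proof (intro exI[of _ S] exI[of _ c] conjI ballI allI impI S(1) S(2) c(1))
    fix A :: "real ^ 'n ^ 'n" assume A: "invertible A"
    obtain U V d where U: "orthogonal_matrix U" and V: "orthogonal_matrix V"
      and d: "\<And>i. d i > 0" and svd: "A = U ** diag_mat d ** V"
      using singular_value_decomposition[OF A] by metis
    let ?P = "mean_log_growth k A" and ?E = "esym k (\<lambda>i. d i ^ 2)" and ?C = "real (CARD('n) choose k)"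
    have Pd: "?P = ln (?E / ?C) / 2"
      by (simp add: mean_log_growth_def pminor_sum_gram_svd[OF U V svd])
    have Ple: "?P \<le> ln (top_prod k d)" unfolding Pd by (rule mean_log_growth_le_top[OF k' d])
    have lnE: "ln (eig_prod k (Q ** A)) = ln (top_prod k (\<lambda>i. cmod (z i)))"
      if "eigvals ((V ** Q ** U) ** diag_mat d) z" for Q z
      using eig_prod_eq[OF _ k'] that eigvals_orthogonal_svd[OF V svd] by metis
    show "\<exists>Q\<in>S. c * pos_part ?P \<le> pos_part (ln (eig_prod k (Q ** A)))"
    proof (cases "?P > 0")
      case False
      obtain Q where "Q \<in> S" using S(3)[OF U V orthogonal_matrix_id] by blast
      thus ?thesis using False by (intro bexI[of _ Q]) (auto simp: pos_part_def)
    next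
      case True
      have C0: "?C > 0" using k' by simp
      have "?C \<le> ?E"
      proof (rule ccontr)
        assume "\<not> ?C \<le> ?E"
        hence "?E / ?C \<le> 1" using C0 by (simp add: field_simps)
        moreover have "?E / ?C > 0"
          using pminor_sum_gram_pos[OF A k'] C0 by (simp add: pminor_sum_gram_svd[OF U V svd])
        ultimately have "ln (?E / ?C) \<le> 0" by simp
        thus False using True by (simp add: Pd)
      qed
      note CE = this
      show ?thesis
      proof (cases "ln (top_prod k d) \<le> \<delta>")
        case False
        obtain Q where Q: "Q \<in> S" "norm (V ** Q ** U - mat 1) < r"
          using S(3)[OF U V orthogonal_matrix_id] by blast
        obtain z where z: "eigvals ((V ** Q ** U) ** diag_mat d) z" using eigvals_exist by blast
        have tp: "top_prod k d > 0" by (rule top_prod_pos[OF k' d])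
        have "t * top_prod k d \<le> top_prod k (\<lambda>i. cmod (z i))"
          using Q(2) by (intro r1(2)[OF _ d z k']) (simp add: r_def)
        hence "ln (t * top_prod k d) \<le> ln (top_prod k (\<lambda>i. cmod (z i)))"
          using t tp by (intro ln_mono) auto
        moreover have "ln (t * top_prod k d) = ln (top_prod k d) - \<delta> / 2"
          using t tp by (simp add: ln_mult t_def)
        ultimately have "ln (top_prod k d) / 2 \<le> ln (eig_prod k (Q ** A))"
          using False lnE[OF z] by simp
        moreover have "c * ?P \<le> 1/2 * ?P" using True c by (intro mult_right_mono) auto
        ultimately have "c * ?P \<le> ln (eig_prod k (Q ** A))" using Ple by simp
        thus ?thesis using Q(1) True by (intro bexI[of _ Q]) (auto simp: pos_part_def)
      next
        case near: True
        have dX0: "\<bar>ln (d i)\<bar> \<le> X0" for i by (rule \<delta>(2)[OF d CE near])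
        define X where "X = Max (range (\<lambda>i. \<bar>ln (d i)\<bar>))"
        have dX: "\<bar>ln (d i)\<bar> \<le> X" for i unfolding X_def by (rule Max_ge) auto
        have "X \<in> range (\<lambda>i. \<bar>ln (d i)\<bar>)" unfolding X_def by (rule Max_in) auto
        then obtain i0 where i0: "X = \<bar>ln (d i0)\<bar>" by blast
        have XX0: "X \<le> X0" "0 \<le> X" using i0 dX0 by auto
        have kX: "2 * real k * X \<le> 1"
          using kX0 mult_left_mono[OF XX0(1), of "2 * real k"] by simp
        define \<kappa> where "\<kappa> = 2 * ?n * real k * X^2"
        have \<kappa>: "\<kappa> \<ge> 0" by (simp add: \<kappa>_def)
        have sumge: "(\<Sum>i\<in>UNIV. ln (d i)) \<ge> - \<kappa>"
          unfolding \<kappa>_def by (rule sum_ln_ge[OF k(1) k' d CE dX kX])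
        \<comment> \<open>The target is the matrix of the signs of the ln d_i rather than the
          identity, so that all terms of the trace difference have the same sign.\<close>
        define s where "s = (\<lambda>i. if d i \<ge> 1 then 1 else - 1 :: real)"
        have "orthogonal_matrix (diag_mat s)"
        proof -
          have "diag_mat s ** diag_mat s = mat 1"
            unfolding diag_mat_mult diag_mat_one[symmetric]
            by (intro arg_cong[of _ _ diag_mat]) (auto simp: s_def)
          thus ?thesis by (simp add: orthogonal_matrix)
        qed
        then obtain Q where Q: "Q \<in> S" "norm (V ** Q ** U - diag_mat s) < r"
          using S(3)[OF U V] by blast
        let ?R = "V ** Q ** U"
        have R: "orthogonal_matrix ?R" using U V S(2)[OF Q(1)] by (simp add: orthogonal_matrix_mul)
        have sgn: "\<bar>d i - 1 / d i\<bar> \<le> 2 * (?R $ i $ i * (d i - 1 / d i))" for i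
        proof -
          have "\<bar>(?R - diag_mat s) $ i $ i\<bar> \<le> norm ((?R - diag_mat s) $ i)" by (rule component_le_norm_cart)
          also have "\<dots> \<le> norm (?R - diag_mat s)" by (rule Finite_Cartesian_Product.norm_nth_le)
          also have "\<dots> < 1/2" using Q(2) by (simp add: r_def)
          finally have near': "\<bar>?R $ i $ i - s i\<bar> < 1/2" by (simp add: diag_mat_nth)
          show ?thesis
          proof (cases "d i \<ge> 1")
            case True
            have "d i - 1 / d i \<ge> 0" using True by (simp add: order_trans[of "1 / d i" 1])
            moreover have "1/2 \<le> ?R $ i $ i" using near' True by (simp add: s_def abs_if split: if_splits)
            ultimately show ?thesis using mult_right_mono[of "1/2" "?R $ i $ i" "d i - 1 / d i"]
              by (simp add: algebra_simps)
          next
            case False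
            have "1 / d i \<ge> 1" using False d[of i] by simp
            hence "1 / d i - d i \<ge> 0" using False by simp
            moreover have "1/2 \<le> - ?R $ i $ i" using near' False by (simp add: s_def abs_if split: if_splits)
            ultimately show ?thesis using mult_right_mono[of "1/2" "- ?R $ i $ i" "1 / d i - d i"]
              by (simp add: algebra_simps)
          qed
        qed
        obtain z where z: "eigvals (?R ** diag_mat d) z" using eigvals_exist by blast
        define \<eta> where "\<eta> = pos_part (ln (eig_prod k (Q ** A)))"
        have \<eta>: "\<eta> \<ge> 0" "ln (top_prod k (\<lambda>i. cmod (z i))) \<le> \<eta>"
          using lnE[OF z] by (auto simp: \<eta>_def pos_part_def)
        have "\<bar>ln (d i0)\<bar> \<le> 6 * ?n * (?n^2 + 1) * (\<eta> + \<kappa>)"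
          by (rule near_orthogonal_bound[OF R d _ sgn z k \<eta>(1) \<kappa> \<eta>(2) sumge])
             (use dX0 X01 order_trans in blast)
        hence "X \<le> K * (\<eta> + \<kappa>)" by (simp add: i0 K_def)
        moreover have "K * \<kappa> \<le> X / 2"
        proof -
          have "K * \<kappa> = (2 * ?n * real k * K * X) * X" by (simp add: \<kappa>_def power2_eq_square)
          also have "\<dots> \<le> (2 * ?n * real k * K * X0) * X"
            using XX0 K1 by (intro mult_right_mono mult_left_mono) auto
          also have "2 * ?n * real k * K * X0 = 1/2" using n1 k1 K1 by (simp add: X0_def)
          finally show ?thesis by simp
        qed
        ultimately have X: "X \<le> 2 * K * \<eta>" by (simp add: distrib_left)
        note Ple
        also have "ln (top_prod k d) \<le> real k * X" by (rule ln_top_prod_le[OF d k' dX])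
        also have "\<dots> \<le> real k * (2 * K * \<eta>)" using X by (intro mult_left_mono) auto
        finally have "?P \<le> (2 * real k * K) * \<eta>" by (simp add: ac_simps)
        hence "1 / (2 * real k * K) * ?P \<le> \<eta>"
          using k1 K1 by (simp add: field_simps)
        moreover have "c * ?P \<le> 1 / (2 * real k * K) * ?P"
          using True c by (intro mult_right_mono) auto
        ultimately have "c * ?P \<le> \<eta>" by simp
        thus ?thesis using Q(1) True unfolding \<eta>_def by (intro bexI[of _ Q]) (auto simp: pos_part_def)
      qed
    qed
  qed
qed

lemma eig_prod_CARD:
  fixes A :: "real ^ 'n ^ 'n"
  shows "eig_prod CARD('n) A = \<bar>det A\<bar>"
proof -
  obtain z where z: "eigvals A z" using eigvals_exist by blast
  have "top_prod CARD('n) (\<lambda>i. cmod (z i)) = (\<Prod>i\<in>UNIV. cmod (z i))"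
  proof -
    obtain I :: "'n set" where I: "card I = CARD('n)" "top_prod CARD('n) (\<lambda>i. cmod (z i)) = (\<Prod>i\<in>I. cmod (z i))"
      using top_prod_attained[of "CARD('n)" "\<lambda>i. cmod (z i)"] by auto
    moreover have "I = UNIV" using card_subset_eq[of UNIV I] I by simp
    ultimately show ?thesis by simp
  qed
  also have "\<dots> = \<bar>det A\<bar>"
    using arg_cong[OF eigvals_prod[OF z], of cmod] by (simp add: prod_norm)
  finally show ?thesis using eig_prod_eq[OF z] by simp
qed

text \<open>What remains is k = n, where \<open>mean_log_growth k A\<close> and
  \<open>ln (eig_prod k A)\<close> both equal ln |det A|; the identity matrix alone serves as the
  net, with c = 1.\<close>

lemma eig_prod_ge_mean_log_growth:
  assumes k: "1 \<le> k" "k \<le> CARD('n)"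
  shows "\<exists>(S :: (real ^ 'n ^ 'n) set) c. finite S \<and> (\<forall>Q\<in>S. orthogonal_matrix Q) \<and> c > 0 \<and>
    (\<forall>A. invertible A \<longrightarrow> (\<exists>Q\<in>S. c * pos_part (mean_log_growth k A) \<le> pos_part (ln (eig_prod k (Q ** A)))))"
proof (cases "k = CARD('n)")
  case False
  thus ?thesis using k by (intro eig_prod_ge_mean_log_growth_proper) auto
next
  case True
  have "mean_log_growth k A = ln (eig_prod k A)" if "invertible A" for A :: "real ^ 'n ^ 'n"
  proof -
    have d: "det A \<noteq> 0" using that by (simp add: invertible_det_nz)
    have "pminor_sum k (transpose A ** A) = \<bar>det A\<bar>^2"
      unfolding True pminor_sum_CARD by (simp add: det_mul power2_eq_square)
    hence "mean_log_growth k A = ln (\<bar>det A\<bar>^2) / 2" by (simp add: mean_log_growth_def True)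
    also have "\<dots> = ln \<bar>det A\<bar>" using d by (subst ln_realpow) auto
    finally show ?thesis by (simp add: True eig_prod_CARD)
  qed
  thus ?thesis
    by (intro exI[of _ "{mat 1}"] exI[of _ 1]) (auto simp: orthogonal_matrix_id)
qed

section \<open>The random product\<close>

locale orthogonally_invariant_prob = prob_space M for M :: "(real ^ 'n ^ 'n) measure" +
  assumes on_GL: "measure_on_GL M" and inv: "orthogonally_invariant M"

sublocale orthogonally_invariant_prob \<subseteq> S: sequence_space M ..

context orthogonally_invariant_prob
begin

abbreviation seqs :: "(nat \<Rightarrow> real ^ 'n ^ 'n) measure" where
  "seqs \<equiv> \<Pi>\<^sub>M j\<in>(UNIV :: nat set). M"

lemma sets_M: "sets M = sets (restrict_space borel GL)"
  using on_GL by (simp add: measure_on_GL_def)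

lemma space_M: "space M = GL"
  using sets_eq_imp_space_eq[OF sets_M] by (simp add: space_restrict_space)

lemma in_space_M: "A \<in> space M \<longleftrightarrow> invertible A"
  by (simp add: space_M GL_def)

lemma measurable_M: "f \<in> measurable borel N \<Longrightarrow> f \<in> measurable M N"
  using measurable_restrict_space1[of f borel N GL] measurable_cong_sets[OF sets_M refl] by blast

lemma measurable_into_M:
  assumes "f \<in> borel_measurable N" "\<And>x. x \<in> space N \<Longrightarrow> invertible (f x)"
  shows "f \<in> measurable N M"
proof -
  have "f \<in> measurable N (restrict_space borel GL)"
    using assms by (intro measurable_restrict_space2) (auto simp: GL_def)
  thus ?thesis using measurable_cong_sets[OF refl sets_M] by blast
qed

lemma id_measurable [measurable]: "(\<lambda>A. A) \<in> measurable M borel"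
  by (rule measurable_M) simp

end

section \<open>Measurability of matrix operations\<close>

lemma continuous_on_matrix_mult:
  "continuous_on UNIV (\<lambda>p. (fst p :: real ^ 'n ^ 'm) ** (snd p :: real ^ 'k ^ 'n))"
  unfolding matrix_matrix_mult_def by (intro continuous_intros continuous_on_vec_lambda)

lemma borel_measurable_matrix_mult [measurable]:
  fixes f :: "'a \<Rightarrow> real ^ 'n ^ 'm" and g :: "'a \<Rightarrow> real ^ 'k ^ 'n"
  assumes "f \<in> borel_measurable N" "g \<in> borel_measurable N"
  shows "(\<lambda>x. f x ** g x) \<in> borel_measurable N"
  by (rule borel_measurable_continuous_Pair[OF assms continuous_on_matrix_mult])

lemma borel_measurable_transpose [measurable]:
  fixes f :: "'a \<Rightarrow> real ^ 'n ^ 'm"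
  assumes "f \<in> borel_measurable N"
  shows "(\<lambda>x. transpose (f x)) \<in> borel_measurable N"
proof -
  have "continuous_on UNIV (transpose :: real ^ 'n ^ 'm \<Rightarrow> real ^ 'm ^ 'n)"
    unfolding transpose_def by (intro continuous_intros continuous_on_vec_lambda)
  hence "transpose \<in> borel_measurable (borel :: (real ^ 'n ^ 'm) measure)"
    by (rule borel_measurable_continuous_onI)
  with assms show ?thesis by (rule measurable_compose)
qed

lemma borel_measurable_pminor [measurable]:
  assumes "f \<in> borel_measurable N"
  shows "(\<lambda>x. pminor (f x :: real ^ 'n ^ 'n) I) \<in> borel_measurable N"
proof -
  have "(\<lambda>A :: real ^ 'n ^ 'n. pminor A I) \<in> borel_measurable borel"
    by (intro borel_measurable_continuous_onI continuous_intros)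
  with assms show ?thesis by (rule measurable_compose)
qed

lemma borel_measurable_pminor_sum [measurable]:
  assumes "f \<in> borel_measurable N"
  shows "(\<lambda>x. pminor_sum k (f x :: real ^ 'n ^ 'n)) \<in> borel_measurable N"
  unfolding pminor_sum_def using assms by measurable

section \<open>Permutation matrices and their action on principal minors\<close>

definition permutation_mat :: "('n \<Rightarrow> 'n) \<Rightarrow> real ^ 'n ^ 'n" where
  "permutation_mat \<pi> = (\<chi> i j. if j = \<pi> i then 1 else 0)"

lemma permutation_mat_conj_nth:
  "(permutation_mat \<pi> ** A ** transpose (permutation_mat \<pi>)) $ i $ j = A $ \<pi> i $ \<pi> j"
proof -
  have 1: "(permutation_mat \<pi> ** A) $ i $ l = A $ \<pi> i $ l" for i l
  proof -
    have "(permutation_mat \<pi> ** A) $ i $ l = (\<Sum>k\<in>UNIV. if k = \<pi> i then A $ k $ l else 0)"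
    proof -
      have "(permutation_mat \<pi> ** A) $ i $ l = (\<Sum>k\<in>UNIV. permutation_mat \<pi> $ i $ k * A $ k $ l)"
        by (simp add: matrix_matrix_mult_def)
      also have "\<dots> = (\<Sum>k\<in>UNIV. if k = \<pi> i then A $ k $ l else 0)"
        by (intro sum.cong) (auto simp: permutation_mat_def)
      finally show ?thesis .
    qed
    thus ?thesis by simp
  qed
  have "(permutation_mat \<pi> ** A ** transpose (permutation_mat \<pi>)) $ i $ j
      = (\<Sum>k\<in>UNIV. (permutation_mat \<pi> ** A) $ i $ k * permutation_mat \<pi> $ j $ k)"
    by (simp add: matrix_matrix_mult_def[of "permutation_mat \<pi> ** A"] transpose_def)
  also have "\<dots> = (\<Sum>k\<in>UNIV. if k = \<pi> j then A $ \<pi> i $ k else 0)"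
    unfolding 1 by (intro sum.cong) (auto simp: permutation_mat_def)
  finally show ?thesis by simp
qed

lemma orthogonal_permutation_mat:
  assumes "inj \<pi>"
  shows "orthogonal_matrix (permutation_mat \<pi>)"
proof -
  have "permutation_mat \<pi> ** mat 1 ** transpose (permutation_mat \<pi>) = mat 1"
    using assms by (auto simp: vec_eq_iff permutation_mat_conj_nth mat_def inj_def)
  hence "permutation_mat \<pi> ** transpose (permutation_mat \<pi>) = mat 1" by simp
  thus ?thesis by (metis matrix_left_right_inverse orthogonal_matrix)
qed

lemma pminor_permutation_mat:
  assumes "inj \<pi>"
  shows "pminor (permutation_mat \<pi> ** A ** transpose (permutation_mat \<pi>)) I = pminor A (\<pi> ` I)"
proof -
  let ?P = "permutation_mat \<pi>"
  let ?N = "\<chi> i j. if i \<in> \<pi> ` I \<and> j \<in> \<pi> ` I then A $ i $ j else if i = j then 1 else 0"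
  have "(\<chi> i j. if i \<in> I \<and> j \<in> I then (?P ** A ** transpose ?P) $ i $ j else if i = j then 1 else 0)
      = ?P ** ?N ** transpose ?P"
    using assms by (auto simp: vec_eq_iff permutation_mat_conj_nth inj_eq inj_image_mem_iff)
  hence "pminor (?P ** A ** transpose ?P) I = det ?P * pminor A (\<pi> ` I) * det ?P"
    by (simp add: pminor_def det_mul)
  moreover have "det ?P * det ?P = 1"
    using orthogonal_matrixD(1)[OF orthogonal_permutation_mat[OF assms]]
    by (metis det_I det_mul det_transpose)
  ultimately show ?thesis by (simp add: ac_simps)
qed

lemma exists_bij_mapping:
  fixes I J :: "'n::finite set"
  assumes "card I = card J"
  obtains \<pi> where "bij \<pi>" "\<pi> ` I = J"
proof -
  obtain f where f: "bij_betw f I J" using assms finite_same_card_bij[of I J] by auto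
  have "card (-I) = card (-J)" using assms by (simp add: card_Diff_subset Compl_eq_Diff_UNIV)
  then obtain g where g: "bij_betw g (-I) (-J)" using finite_same_card_bij[of "-I" "-J"] by auto
  let ?h = "\<lambda>x. if x \<in> I then f x else g x"
  have h1: "bij_betw ?h I J" using f by (rule bij_betw_cong[THEN iffD1, rotated]) simp
  have h2: "bij_betw ?h (-I) (-J)" using g by (rule bij_betw_cong[THEN iffD1, rotated]) simp
  have "bij_betw ?h (I \<union> -I) (J \<union> -J)" by (rule bij_betw_combine[OF h1 h2]) auto
  hence "bij ?h" by (simp add: Compl_partition)
  moreover have "?h ` I = J" using h1 by (rule bij_betw_imp_surj_on)
  ultimately show ?thesis by (rule that)
qed

context orthogonally_invariant_prob
begin

lemma left_mult_measurable:
  assumes "orthogonal_matrix Q"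
  shows "(\<lambda>A. Q ** A) \<in> measurable M M"
proof (rule measurable_into_M)
  show "(\<lambda>A. Q ** A) \<in> borel_measurable M" by measurable
  fix A assume "A \<in> space M"
  thus "invertible (Q ** A)"
    using det_orthogonal_matrix[OF assms] by (auto simp: in_space_M invertible_det_nz det_mul)
qed

lemma nn_integral_left_mult:
  assumes Q: "orthogonal_matrix Q" and F: "F \<in> borel_measurable M"
  shows "(\<integral>\<^sup>+A. F (Q ** A) \<partial>M) = (\<integral>\<^sup>+A. F A \<partial>M)"
proof -
  have d: "distr M M (\<lambda>A. Q ** A) = M" using inv Q by (simp add: orthogonally_invariant_def)
  have "(\<integral>\<^sup>+A. F A \<partial>M) = (\<integral>\<^sup>+A. F A \<partial>(distr M M (\<lambda>A. Q ** A)))" by (simp only: d)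
  also have "\<dots> = (\<integral>\<^sup>+A. F (Q ** A) \<partial>M)"
    by (rule nn_integral_distr[OF left_mult_measurable[OF Q]]) (use F d in simp)
  finally show ?thesis by simp
qed

text \<open>The factor exp(2 Phi(k, A)) of the overview when A is invertible and k \<le> n. The
  averaging identities are multiplicative in it.\<close>

definition wt :: "nat \<Rightarrow> real ^ 'n ^ 'n \<Rightarrow> real" where
  "wt k A = pminor_sum k (transpose A ** A) / real (CARD('n) choose k)"

lemma wt_measurable [measurable]:
  fixes f :: "'b \<Rightarrow> real ^ 'n ^ 'n"
  assumes "f \<in> borel_measurable N"
  shows "(\<lambda>x. wt k (f x)) \<in> borel_measurable N"
proof -
  have "(\<lambda>x. pminor_sum k (transpose (f x) ** f x)) \<in> borel_measurable N"
    by (intro borel_measurable_pminor_sum borel_measurable_matrix_mult borel_measurable_transpose assms)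
  thus ?thesis unfolding wt_def by measurable
qed

lemma wt_pos: "invertible A \<Longrightarrow> k \<le> CARD('n) \<Longrightarrow> wt k A > 0"
  unfolding wt_def by (intro divide_pos_pos pminor_sum_gram_pos) auto

lemma wt_orthogonal: "orthogonal_matrix Q \<Longrightarrow> wt k (Q ** A) = wt k A"
proof -
  assume Q: "orthogonal_matrix Q"
  have "transpose (Q ** A) ** (Q ** A) = transpose A ** (transpose Q ** Q) ** A"
    by (simp add: matrix_transpose_mul matrix_mul_assoc)
  thus ?thesis by (simp add: wt_def orthogonal_matrixD[OF Q])
qed

lemma mean_log_growth_wt: "mean_log_growth k A = ln (wt k A) / 2"
  by (simp add: mean_log_growth_def wt_def)

text \<open>Permutation matrices are orthogonal, so the average is the same for all I of size k.
  Summed over I, the integrand is e_k(B B^T) / \<open>wt k B\<close>, which is constantly n choose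
  k.\<close>

lemma pminor_average_eq_1:
  fixes I :: "'n set"
  assumes k: "k \<le> CARD('n)" and I: "card I = k"
  shows "(\<integral>\<^sup>+B. ennreal (pminor (B ** transpose B) I / wt k B) \<partial>M) = 1"
proof -
  define c where "c = (\<lambda>I :: 'n set. \<integral>\<^sup>+B. ennreal (pminor (B ** transpose B) I / wt k B) \<partial>M)"
  let ?F = "{J :: 'n set. card J = k}"
  have nn: "pminor (B ** transpose B) J / wt k B \<ge> 0" if "B \<in> space M" for B J
    using that wt_pos[of B k] k by (intro divide_nonneg_nonneg pminor_gram_nonneg) (auto simp: in_space_M less_imp_le)
  have same: "c I = c J" if J: "card J = k" for J
  proof -
    obtain \<pi> where \<pi>: "bij \<pi>" "\<pi> ` I = J" using exists_bij_mapping[of I J] I J by metis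
    let ?P = "permutation_mat \<pi>"
    have O: "orthogonal_matrix ?P" using \<pi> by (intro orthogonal_permutation_mat) (simp add: bij_is_inj)
    have "c I = (\<integral>\<^sup>+B. ennreal (pminor ((?P ** B) ** transpose (?P ** B)) I / wt k (?P ** B)) \<partial>M)"
      unfolding c_def by (rule nn_integral_left_mult[OF O, symmetric]) measurable
    also have "\<dots> = (\<integral>\<^sup>+B. ennreal (pminor (B ** transpose B) J / wt k B) \<partial>M)"
    proof (intro nn_integral_cong)
      fix B :: "real ^ 'n ^ 'n"
      have "(?P ** B) ** transpose (?P ** B) = ?P ** (B ** transpose B) ** transpose ?P"
        by (simp add: matrix_transpose_mul matrix_mul_assoc)
      thus "ennreal (pminor ((?P ** B) ** transpose (?P ** B)) I / wt k (?P ** B))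
          = ennreal (pminor (B ** transpose B) J / wt k B)"
        using \<pi> by (simp add: pminor_permutation_mat bij_is_inj wt_orthogonal[OF O])
    qed
    finally show ?thesis by (simp add: c_def)
  qed
  have Cpos: "real (CARD('n) choose k) > 0" using k by simp
  have "(\<Sum>J\<in>?F. c J) = (\<integral>\<^sup>+B. (\<Sum>J\<in>?F. ennreal (pminor (B ** transpose B) J / wt k B)) \<partial>M)"
    unfolding c_def by (rule nn_integral_sum[symmetric]) measurable
  also have "\<dots> = (\<integral>\<^sup>+B. ennreal (real (CARD('n) choose k)) \<partial>M)"
  proof (rule nn_integral_cong)
    fix B assume B: "B \<in> space M"
    hence iB: "invertible B" by (simp add: in_space_M)
    have "(\<Sum>J\<in>?F. ennreal (pminor (B ** transpose B) J / wt k B))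
        = ennreal (\<Sum>J\<in>?F. pminor (B ** transpose B) J / wt k B)"
      using nn[OF B] by (intro sum_ennreal) auto
    also have "(\<Sum>J\<in>?F. pminor (B ** transpose B) J / wt k B) = pminor_sum k (B ** transpose B) / wt k B"
      by (simp add: pminor_sum_def sum_divide_distrib)
    also have "pminor_sum k (B ** transpose B) = pminor_sum k (transpose B ** B)"
      by (rule pminor_sum_commute[OF iB])
    also have "\<dots> / wt k B = real (CARD('n) choose k)"
      using wt_pos[OF iB k] Cpos by (simp add: wt_def field_simps)
    finally show "(\<Sum>J\<in>?F. ennreal (pminor (B ** transpose B) J / wt k B)) = ennreal (real (CARD('n) choose k))" .
  qed
  also have "\<dots> = ennreal (real (CARD('n) choose k))" by (simp add: emeasure_space_1)
  also have "(\<Sum>J\<in>?F. c J) = (\<Sum>J\<in>?F. c I)" by (intro sum.cong) (auto simp: same)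
  also have "\<dots> = ennreal (real (CARD('n) choose k)) * c I"
    by (simp add: card_subsets_type ennreal_of_nat_eq_real_of_nat)
  finally have "ennreal (real (CARD('n) choose k)) * c I = ennreal (real (CARD('n) choose k)) * 1" by simp
  hence "c I = 1" using Cpos by (subst (asm) ennreal_mult_cancel_left) auto
  thus ?thesis by (simp add: c_def)
qed

text \<open>Write G^T G = V^T H V with H diagonal. Invariance absorbs V into A, and e_k(H B B^T) is
  a combination of the minors of B B^T with the k-fold products of the entries of H as coefficients.
  Every normalized minor averages to 1, which leaves e_k(H).\<close>

lemma pminor_sum_gram_average:
  fixes G :: "real ^ 'n ^ 'n"
  assumes k: "k \<le> CARD('n)" and G: "invertible G"
  shows "(\<integral>\<^sup>+A. ennreal (pminor_sum k (transpose (G ** A) ** (G ** A)) / wt k A) \<partial>M)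
       = ennreal (pminor_sum k (transpose G ** G))"
proof -
  obtain V h where V: "orthogonal_matrix V" and h: "\<And>i. h i \<ge> 0"
    and eq: "transpose G ** G = transpose V ** diag_mat h ** V"
    using gram_diagonalization[of G] by metis
  let ?F = "{I :: 'n set. card I = k}"
  define f where "f = (\<lambda>B. \<Sum>I\<in>?F. ennreal (\<Prod>i\<in>I. h i) * ennreal (pminor (B ** transpose B) I / wt k B))"
  have hp: "(\<Prod>i\<in>I. h i) \<ge> 0" for I using h by (intro prod_nonneg) auto
  have f: "f \<in> borel_measurable M" unfolding f_def by measurable
  have "(\<integral>\<^sup>+A. ennreal (pminor_sum k (transpose (G ** A) ** (G ** A)) / wt k A) \<partial>M) = (\<integral>\<^sup>+A. f (V ** A) \<partial>M)"
  proof (rule nn_integral_cong)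
    fix A assume "A \<in> space M"
    hence iA: "invertible A" by (simp add: in_space_M)
    let ?B = "V ** A"
    have iB: "invertible ?B"
      using det_orthogonal_matrix[OF V] iA by (auto simp: invertible_det_nz det_mul)
    have w: "wt k ?B = wt k A" by (rule wt_orthogonal[OF V])
    have "transpose (G ** A) ** (G ** A) = transpose A ** (transpose G ** G) ** A"
      by (simp add: matrix_transpose_mul matrix_mul_assoc)
    also have "\<dots> = transpose ?B ** (diag_mat h ** ?B)"
      unfolding eq by (simp add: matrix_transpose_mul matrix_mul_assoc)
    finally have "pminor_sum k (transpose (G ** A) ** (G ** A)) = pminor_sum k (transpose ?B ** (diag_mat h ** ?B))"
      by simp
    also have "\<dots> = pminor_sum k ((diag_mat h ** ?B) ** transpose ?B)"
      using iB by (intro pminor_sum_commute) (simp add: invertible_det_nz)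
    also have "(diag_mat h ** ?B) ** transpose ?B = diag_mat h ** (?B ** transpose ?B)"
      by (simp add: matrix_mul_assoc)
    also have "pminor_sum k \<dots> = pminor_sum k ((?B ** transpose ?B) ** diag_mat h)"
      using iB by (intro pminor_sum_commute[symmetric]) (simp add: invertible_det_nz det_mul)
    also have "\<dots> = (\<Sum>I\<in>?F. (\<Prod>i\<in>I. h i) * pminor (?B ** transpose ?B) I)"
      unfolding pminor_sum_diag_right by (simp add: mult.commute)
    finally have "pminor_sum k (transpose (G ** A) ** (G ** A)) / wt k A
        = (\<Sum>I\<in>?F. (\<Prod>i\<in>I. h i) * (pminor (?B ** transpose ?B) I / wt k ?B))"
      by (simp add: w sum_divide_distrib)
    hence "ennreal (pminor_sum k (transpose (G ** A) ** (G ** A)) / wt k A)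
        = ennreal (\<Sum>I\<in>?F. (\<Prod>i\<in>I. h i) * (pminor (?B ** transpose ?B) I / wt k ?B))" by simp
    also have "\<dots> = (\<Sum>I\<in>?F. ennreal ((\<Prod>i\<in>I. h i) * (pminor (?B ** transpose ?B) I / wt k ?B)))"
      using wt_pos[OF iB k] pminor_gram_nonneg[OF iB] hp
      by (intro sum_ennreal[symmetric] mult_nonneg_nonneg divide_nonneg_nonneg) (auto simp: less_imp_le)
    also have "\<dots> = f ?B"
      unfolding f_def by (intro sum.cong refl ennreal_mult' hp)
    finally show "ennreal (pminor_sum k (transpose (G ** A) ** (G ** A)) / wt k A) = f ?B" .
  qed
  also have "\<dots> = (\<integral>\<^sup>+A. f A \<partial>M)" by (rule nn_integral_left_mult[OF V f])
  also have "\<dots> = (\<Sum>I\<in>?F. \<integral>\<^sup>+B. ennreal (\<Prod>i\<in>I. h i) * ennreal (pminor (B ** transpose B) I / wt k B) \<partial>M)"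
    unfolding f_def by (rule nn_integral_sum) measurable
  also have "\<dots> = (\<Sum>I\<in>?F. ennreal (\<Prod>i\<in>I. h i))"
  proof (intro sum.cong refl)
    fix I assume "I \<in> ?F"
    hence I: "card I = k" by simp
    have "(\<integral>\<^sup>+B. ennreal (\<Prod>i\<in>I. h i) * ennreal (pminor (B ** transpose B) I / wt k B) \<partial>M)
        = ennreal (\<Prod>i\<in>I. h i) * (\<integral>\<^sup>+B. ennreal (pminor (B ** transpose B) I / wt k B) \<partial>M)"
      by (rule nn_integral_cmult) measurable
    thus "(\<integral>\<^sup>+B. ennreal (\<Prod>i\<in>I. h i) * ennreal (pminor (B ** transpose B) I / wt k B) \<partial>M)
        = ennreal (\<Prod>i\<in>I. h i)" by (simp add: pminor_average_eq_1[OF k I])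
  qed
  also have "\<dots> = ennreal (esym k h)" using hp by (simp add: esym_def sum_ennreal)
  also have "esym k h = pminor_sum k (transpose G ** G)"
    unfolding eq pminor_sum_orthogonal_conj[OF V] pminor_sum_diag ..
  finally show ?thesis .
qed

text \<open>A matrix prepended at index 0 becomes the rightmost factor of the product.\<close>

lemma left_product_case_nat:
  "left_product (case_nat s g) (Suc m) = left_product g m ** s"
  by (induction m) (simp_all add: matrix_mul_assoc)

lemma invertible_left_product:
  fixes g :: "nat \<Rightarrow> real ^ 'n ^ 'n"
  assumes "\<And>j. invertible (g j)"
  shows "invertible (left_product g m)"
  using assms by (induction m) (auto simp: det_mul invertible_det_nz)

lemma component_measurable [measurable]: "(\<lambda>g. g j) \<in> borel_measurable seqs"
  by (rule measurable_compose[OF measurable_component_singleton[of j UNIV "\<lambda>_. M"] id_measurable]) simp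

lemma left_product_measurable [measurable]: "(\<lambda>g. left_product g m) \<in> borel_measurable seqs"
proof (induction m)
  case (Suc m)
  have "(\<lambda>g. g m ** left_product g m) \<in> borel_measurable seqs"
    by (rule borel_measurable_matrix_mult[OF component_measurable Suc])
  thus ?case by simp
qed simp

lemma space_seqs: "g \<in> space seqs \<Longrightarrow> invertible (g j)"
  by (auto simp: space_PiM PiE_iff simp flip: in_space_M)

definition normalized :: "nat \<Rightarrow> nat \<Rightarrow> (nat \<Rightarrow> real ^ 'n ^ 'n) \<Rightarrow> real" where
  "normalized k m g = pminor_sum k (transpose (left_product g m) ** left_product g m) / (\<Prod>j<m. wt k (g j))"

lemma normalized_measurable [measurable]: "normalized k m \<in> borel_measurable seqs"
  unfolding normalized_def by measurable

text \<open>The induction splits off index 0, the rightmost factor s, and integrates over it first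
  with the remaining product G fixed. Left invariance acts exactly between G and s, so the average
  over s replaces G s by G and cancels the weight of s.\<close>

lemma nn_integral_normalized:
  assumes k: "k \<le> CARD('n)"
  shows "(\<integral>\<^sup>+g. ennreal (normalized k m g) \<partial>seqs) = ennreal (real (CARD('n) choose k))"
proof (induction m)
  case 0
  have "pminor_sum k (mat 1 :: real ^ 'n ^ 'n) = real (CARD('n) choose k)"
    by (simp add: pminor_sum_def card_subsets_type)
  thus ?case by (simp add: normalized_def S.emeasure_space_1 transpose_mat)
next
  case (Suc m)
  let ?h = "\<lambda>(s, \<omega>). case_nat s \<omega> :: nat \<Rightarrow> real ^ 'n ^ 'n"
  interpret P: pair_sigma_finite M seqs ..
  have hm: "?h \<in> measurable (M \<Otimes>\<^sub>M seqs) seqs" by measurable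
  have nm: "(\<lambda>g. ennreal (normalized k (Suc m) g)) \<in> borel_measurable seqs" by measurable
  have "(\<integral>\<^sup>+g. ennreal (normalized k (Suc m) g) \<partial>seqs)
      = (\<integral>\<^sup>+g. ennreal (normalized k (Suc m) g) \<partial>(distr (M \<Otimes>\<^sub>M seqs) seqs ?h))"
    by (simp only: S.PiM_iter)
  also have "\<dots> = (\<integral>\<^sup>+p. ennreal (normalized k (Suc m) (?h p)) \<partial>(M \<Otimes>\<^sub>M seqs))"
    by (rule nn_integral_distr[OF hm]) (use nm in simp)
  also have "\<dots> = (\<integral>\<^sup>+\<omega>. \<integral>\<^sup>+s. ennreal (normalized k (Suc m) (case_nat s \<omega>)) \<partial>M \<partial>seqs)"
    using P.nn_integral_snd[of "\<lambda>p. ennreal (normalized k (Suc m) (?h p))"] measurable_compose[OF hm nm] by simp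
  also have "\<dots> = (\<integral>\<^sup>+\<omega>. ennreal (normalized k m \<omega>) \<partial>seqs)"
  proof (rule nn_integral_cong)
    fix \<omega> assume \<omega>: "\<omega> \<in> space seqs"
    let ?G = "left_product \<omega> m" and ?W = "\<Prod>j<m. wt k (\<omega> j)"
    have iG: "invertible ?G" using space_seqs[OF \<omega>] by (intro invertible_left_product)
    have W: "?W > 0" using space_seqs[OF \<omega>] wt_pos k by (intro prod_pos) auto
    have "(\<integral>\<^sup>+s. ennreal (normalized k (Suc m) (case_nat s \<omega>)) \<partial>M)
        = (\<integral>\<^sup>+s. ennreal (1 / ?W) * ennreal (pminor_sum k (transpose (?G ** s) ** (?G ** s)) / wt k s) \<partial>M)"
    proof (rule nn_integral_cong)
      fix s
      have "normalized k (Suc m) (case_nat s \<omega>)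
          = (1 / ?W) * (pminor_sum k (transpose (?G ** s) ** (?G ** s)) / wt k s)"
        unfolding normalized_def left_product_case_nat prod.lessThan_Suc_shift by simp
      thus "ennreal (normalized k (Suc m) (case_nat s \<omega>))
          = ennreal (1 / ?W) * ennreal (pminor_sum k (transpose (?G ** s) ** (?G ** s)) / wt k s)"
        using W by (simp only:) (rule ennreal_mult', simp)
    qed
    also have "\<dots> = ennreal (1 / ?W) * ennreal (pminor_sum k (transpose ?G ** ?G))"
      by (subst nn_integral_cmult) (simp_all add: pminor_sum_gram_average[OF k iG])
    also have "\<dots> = ennreal (normalized k m \<omega>)"
      using W by (simp add: normalized_def flip: ennreal_mult')
    finally show "(\<integral>\<^sup>+s. ennreal (normalized k (Suc m) (case_nat s \<omega>)) \<partial>M) = ennreal (normalized k m \<omega>)" .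
  qed
  finally show ?case using Suc by simp
qed

text \<open>Take logarithms of e_k(P_m^T P_m) = \<open>normalized k m g\<close> times the weights.
  The crude bound ln Y / 2 \<le> Y is enough: the integral of Y does not depend on m and disappears
  after division by m.\<close>

lemma pos_part_growth_le:
  fixes g :: "nat \<Rightarrow> real ^ 'n ^ 'n"
  assumes k: "k \<le> CARD('n)" and g: "\<And>j. invertible (g j)"
  shows "pos_part (ln (pminor_sum k (transpose (left_product g m) ** left_product g m)) / 2)
     \<le> normalized k m g + (\<Sum>j<m. pos_part (mean_log_growth k (g j)))"
proof -
  let ?X = "pminor_sum k (transpose (left_product g m) ** left_product g m)" and ?W = "\<Prod>j<m. wt k (g j)"
  have W: "?W > 0" using g wt_pos k by (intro prod_pos) auto
  have X: "?X > 0" using g by (intro pminor_sum_gram_pos k invertible_left_product)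
  have Y: "normalized k m g > 0" using W X by (simp add: normalized_def)
  have "normalized k m g * ?W = ?X"
    unfolding normalized_def
    by (rule nonzero_eq_divide_eq[THEN iffD1, OF less_imp_neq[OF W, THEN not_sym] refl])
  hence "ln ?X = ln (normalized k m g * ?W)" by (simp only:)
  also have "\<dots> = ln (normalized k m g) + ln ?W" by (rule ln_mult_pos[OF Y W])
  also have "ln ?W = (\<Sum>j<m. ln (wt k (g j)))"
    by (rule ln_prod[OF finite_lessThan]) (metis g k wt_pos less_irrefl)
  also have "\<dots> = 2 * (\<Sum>j<m. mean_log_growth k (g j))"
    by (simp add: mean_log_growth_wt sum_distrib_left)
  finally have "ln ?X / 2 = ln (normalized k m g) / 2 + (\<Sum>j<m. mean_log_growth k (g j))" by simp
  also have "\<dots> \<le> normalized k m g + (\<Sum>j<m. pos_part (mean_log_growth k (g j)))"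
  proof (rule add_mono)
    show "ln (normalized k m g) / 2 \<le> normalized k m g"
      using ln_le_minus_one[OF Y] Y by linarith
    show "(\<Sum>j<m. mean_log_growth k (g j)) \<le> (\<Sum>j<m. pos_part (mean_log_growth k (g j)))"
      by (intro sum_mono) (simp add: pos_part_def)
  qed
  finally have "ln ?X / 2 \<le> normalized k m g + (\<Sum>j<m. pos_part (mean_log_growth k (g j)))" .
  moreover have "0 \<le> normalized k m g + (\<Sum>j<m. pos_part (mean_log_growth k (g j)))"
    using Y by (intro add_nonneg_nonneg sum_nonneg) (auto simp: pos_part_def)
  ultimately show ?thesis by (simp add: pos_part_def)
qed

lemma mean_log_growth_measurable [measurable]:
  fixes f :: "'b \<Rightarrow> real ^ 'n ^ 'n"
  assumes "f \<in> borel_measurable N"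
  shows "(\<lambda>x. pos_part (mean_log_growth k (f x))) \<in> borel_measurable N"
proof -
  have "(\<lambda>x. wt k (f x)) \<in> borel_measurable N" by (rule wt_measurable[OF assms])
  thus ?thesis unfolding pos_part_def mean_log_growth_wt by measurable
qed

lemma nn_integral_component:
  assumes "F \<in> borel_measurable M"
  shows "(\<integral>\<^sup>+g. F (g j) \<partial>seqs) = (\<integral>\<^sup>+A. F A \<partial>M)"
proof -
  have d: "distr seqs M (\<lambda>g. g j) = M" by (rule S.PiM_component) simp
  have "(\<integral>\<^sup>+A. F A \<partial>M) = (\<integral>\<^sup>+A. F A \<partial>(distr seqs M (\<lambda>g. g j)))" by (simp only: d)
  also have "\<dots> = (\<integral>\<^sup>+g. F (g j) \<partial>seqs)"
    by (rule nn_integral_distr[OF measurable_component_singleton]) (use assms d in simp_all)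
  finally show ?thesis by simp
qed

text \<open>Positive parts are taken before the limit, so that Fatou's lemma applies to nonnegative
  functions. The m summands have equal integrals because every coordinate has law M.\<close>

lemma sum_exponents_le:
  assumes r: "random_Lyapunov_exponents M r" and k: "k \<le> CARD('n)"
  shows "ennreal (pos_part (\<Sum>i=1..k. r i)) \<le> (\<integral>\<^sup>+A. ennreal (pos_part (mean_log_growth k A)) \<partial>M)"
proof -
  let ?R = "\<Sum>i=1..k. r i" and ?I = "\<integral>\<^sup>+A. ennreal (pos_part (mean_log_growth k A)) \<partial>M"
  let ?C = "real (CARD('n) choose k)"
  define X where "X = (\<lambda>m (g :: nat \<Rightarrow> real ^ 'n ^ 'n). pminor_sum k (transpose (left_product g m) ** left_product g m))"
  define u where "u = (\<lambda>m g. ennreal (pos_part (ln (X m g) / 2) / real m))"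
  have um [measurable]: "u m \<in> borel_measurable seqs" for m
    unfolding u_def X_def pos_part_def by measurable
  have "AE g in seqs. ennreal (pos_part ?R) \<le> liminf (\<lambda>m. u m g)"
    using r[unfolded random_Lyapunov_exponents_def] AE_space
  proof eventually_elim
    case (elim g)
    let ?v = "\<lambda>m. (\<Sum>i=1..k. ln (singular_value i (left_product g m)) / real m)"
    have "?v \<longlonglongrightarrow> ?R" using elim(1) k by (intro tendsto_sum) auto
    hence "(\<lambda>m. ennreal (pos_part (?v m))) \<longlonglongrightarrow> ennreal (pos_part ?R)"
      unfolding pos_part_def by (intro tendsto_ennrealI tendsto_max tendsto_const)
    hence "ennreal (pos_part ?R) = liminf (\<lambda>m. ennreal (pos_part (?v m)))"
      by (intro lim_imp_Liminf[symmetric]) auto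
    also have "\<dots> \<le> liminf (\<lambda>m. u m g)"
    \<comment> \<open>At m = 0 both sides are 0, since division by 0 yields 0.\<close>
    proof (rule Liminf_mono, rule always_eventually, rule allI)
      fix m
      have inv: "invertible (left_product g m)"
        using space_seqs[OF elim(2)] by (intro invertible_left_product)
      have "?v m = (\<Sum>i=1..k. ln (singular_value i (left_product g m))) / real m"
        by (simp add: sum_divide_distrib)
      also have "\<dots> \<le> (ln (X m g) / 2) / real m"
        unfolding X_def by (intro divide_right_mono sum_ln_singular_value_le inv k) auto
      also have "\<dots> \<le> pos_part (ln (X m g) / 2) / real m"
        by (intro divide_right_mono) (auto simp: pos_part_def)
      finally have "?v m \<le> pos_part (ln (X m g) / 2) / real m" .
      moreover have "0 \<le> pos_part (ln (X m g) / 2) / real m" by (auto simp: pos_part_def)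
      ultimately show "ennreal (pos_part (?v m)) \<le> u m g"
        unfolding u_def by (intro ennreal_leI) (simp add: pos_part_def)
    qed
    finally show ?case .
  qed
  hence "(\<integral>\<^sup>+g. ennreal (pos_part ?R) \<partial>seqs) \<le> (\<integral>\<^sup>+g. liminf (\<lambda>m. u m g) \<partial>seqs)"
    by (rule nn_integral_mono_AE)
  also have "\<dots> \<le> liminf (\<lambda>m. \<integral>\<^sup>+g. u m g \<partial>seqs)" by (rule nn_integral_liminf) (rule um)
  also have "\<dots> \<le> liminf (\<lambda>m. ennreal (?C / real m) + ?I)"
  proof (rule Liminf_mono)
    show "\<forall>\<^sub>F m in sequentially. (\<integral>\<^sup>+g. u m g \<partial>seqs) \<le> ennreal (?C / real m) + ?I"
      using eventually_gt_at_top[of 0]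
    proof eventually_elim
      case (elim m)
      have "(\<integral>\<^sup>+g. u m g \<partial>seqs) \<le> (\<integral>\<^sup>+g. ennreal (1 / real m) *
          (ennreal (normalized k m g) + (\<Sum>j<m. ennreal (pos_part (mean_log_growth k (g j))))) \<partial>seqs)"
      proof (rule nn_integral_mono)
        fix g assume g: "g \<in> space seqs"
        note ig = space_seqs[OF g]
        have Y: "normalized k m g \<ge> 0"
          unfolding normalized_def using wt_pos[OF ig k]
          by (intro divide_nonneg_nonneg pminor_sum_gram_nonneg prod_nonneg) (auto simp: less_imp_le)
        have P: "0 \<le> pos_part x" for x by (simp add: pos_part_def)
        have "u m g \<le> ennreal ((1 / real m) * (normalized k m g + (\<Sum>j<m. pos_part (mean_log_growth k (g j)))))"
          unfolding u_def X_def using pos_part_growth_le[OF k ig, where m = m]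
          by (intro ennreal_leI) (simp add: divide_right_mono)
        also have "\<dots> = ennreal (1 / real m) *
          (ennreal (normalized k m g) + (\<Sum>j<m. ennreal (pos_part (mean_log_growth k (g j)))))"
          using Y P by (subst ennreal_mult') (auto simp: ennreal_plus sum_nonneg sum_ennreal)
        finally show "u m g \<le> ennreal (1 / real m) *
          (ennreal (normalized k m g) + (\<Sum>j<m. ennreal (pos_part (mean_log_growth k (g j)))))" .
      qed
      also have "\<dots> = ennreal (1 / real m) * (\<integral>\<^sup>+g. (ennreal (normalized k m g)
            + (\<Sum>j<m. ennreal (pos_part (mean_log_growth k (g j))))) \<partial>seqs)"
        by (rule nn_integral_cmult) measurable
      also have "(\<integral>\<^sup>+g. (ennreal (normalized k m g) + (\<Sum>j<m. ennreal (pos_part (mean_log_growth k (g j))))) \<partial>seqs)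
          = (\<integral>\<^sup>+g. ennreal (normalized k m g) \<partial>seqs)
            + (\<integral>\<^sup>+g. (\<Sum>j<m. ennreal (pos_part (mean_log_growth k (g j)))) \<partial>seqs)"
        by (rule nn_integral_add) measurable
      also have "(\<integral>\<^sup>+g. (\<Sum>j<m. ennreal (pos_part (mean_log_growth k (g j)))) \<partial>seqs)
          = (\<Sum>j<m. \<integral>\<^sup>+g. ennreal (pos_part (mean_log_growth k (g j))) \<partial>seqs)"
        by (rule nn_integral_sum) measurable
      also have "\<dots> = (\<Sum>j<m. ?I)"
        by (intro sum.cong refl nn_integral_component) measurable
      also have "(\<integral>\<^sup>+g. ennreal (normalized k m g) \<partial>seqs) = ennreal ?C" by (rule nn_integral_normalized[OF k])
      also have "ennreal (1 / real m) * (ennreal ?C + (\<Sum>j<m. ?I)) = ennreal (?C / real m) + ?I"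
      proof -
        have "ennreal (1 / real m) * ennreal ?C = ennreal (?C / real m)"
          by (simp flip: ennreal_mult')
        moreover have "ennreal (1 / real m) * (\<Sum>j<m. ?I) = (ennreal (1 / real m) * ennreal (real m)) * ?I"
          by (simp add: ennreal_of_nat_eq_real_of_nat mult.assoc)
        moreover have "ennreal (1 / real m) * ennreal (real m) = 1"
          using elim by (simp flip: ennreal_mult')
        ultimately show ?thesis by (simp add: distrib_left)
      qed
      finally show ?case .
    qed
  qed
  also have "\<dots> = ennreal 0 + ?I"
  proof (rule lim_imp_Liminf)
    have "(\<lambda>m. ?C / real m) \<longlonglongrightarrow> 0" by (rule lim_const_over_n)
    thus "(\<lambda>m. ennreal (?C / real m) + ?I) \<longlonglongrightarrow> ennreal 0 + ?I"
      by (intro tendsto_add tendsto_ennrealI tendsto_const)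
  qed auto
  finally show ?thesis by (simp add: S.emeasure_space_1)
qed

text \<open>Eigenvalue moduli are at most the operator norm, so k times its positive logarithm
  dominates. Integrability identifies the Bochner integral, which would default to 0 otherwise, with
  the extended integral in which the estimates are made.\<close>

lemma eig_prod_integrable:
  assumes k: "k \<le> CARD('n)" and int: "integrable M (\<lambda>A. log_plus (onorm ((*v) A)))"
  shows "integrable M (\<lambda>A. pos_part (ln (eig_prod k A)))"
proof (rule Bochner_Integration.integrable_bound)
  show "integrable M (\<lambda>A. real k * log_plus (onorm ((*v) A)))" using int by simp
  show "(\<lambda>A. pos_part (ln (eig_prod k A))) \<in> borel_measurable M"
    using measurable_M[OF eig_prod_measurable[OF k]] unfolding pos_part_def by measurable
  show "AE A in M. norm (pos_part (ln (eig_prod k A))) \<le> norm (real k * log_plus (onorm ((*v) A)))"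
  proof (rule AE_I2)
    fix A assume "A \<in> space M"
    hence A: "invertible A" by (simp add: in_space_M)
    let ?o = "onorm ((*v) A)"
    have "ln (eig_prod k A) \<le> ln (?o ^ k)"
      by (intro ln_mono eig_prod_le_onorm k eig_prod_pos A)
    also have "\<dots> \<le> real k * log_plus ?o"
    proof (cases "?o > 0")
      case True
      thus ?thesis by (simp add: ln_realpow log_plus_def pos_part_def mult_left_mono)
    next
      \<comment> \<open>The degenerate case is closed by the convention
        \<open>ln 0 = 0\<close>.\<close>
      case False
      moreover have "?o \<ge> 0" by (rule onorm_pos_le[OF matrix_vector_mul_bounded_linear])
      ultimately have "?o = 0" by simp
      thus ?thesis by (cases k) (auto simp: log_plus_def pos_part_def)
    qed
    finally show "norm (pos_part (ln (eig_prod k A))) \<le> norm (real k * log_plus ?o)"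
      by (auto simp: pos_part_def log_plus_def)
  qed
qed

text \<open>The matrix Q supplied by \<open>dom\<close> depends on A. The sum over S avoids a
  measurable choice of it, and by invariance each summand has the same integral, at the cost of a
  factor card S.\<close>

lemma integral_eig_prod_ge:
  fixes S :: "(real ^ 'n ^ 'n) set"
  assumes k: "k \<le> CARD('n)" and int: "integrable M (\<lambda>A. log_plus (onorm ((*v) A)))"
    and r: "random_Lyapunov_exponents M r"
    and S: "finite S" "\<And>Q. Q \<in> S \<Longrightarrow> orthogonal_matrix Q" and c: "c > 0"
    and dom: "\<And>A. invertible A \<Longrightarrow> \<exists>Q\<in>S. c * pos_part (mean_log_growth k A) \<le> pos_part (ln (eig_prod k (Q ** A)))"
  shows "c * pos_part (\<Sum>i=1..k. r i) \<le> real (card S) * (\<integral>A. pos_part (\<Sum>i=1..k. ln (cmod (eigenvalue i A))) \<partial>M)"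
proof -
  let ?f = "\<lambda>A. pos_part (ln (eig_prod k A))"
  have P: "0 \<le> pos_part x" for x by (simp add: pos_part_def)
  have fm: "(\<lambda>A. ennreal (?f A)) \<in> borel_measurable M"
    using borel_measurable_integrable[OF eig_prod_integrable[OF k int]] by measurable
  have "ennreal (c * pos_part (\<Sum>i=1..k. r i)) = ennreal c * ennreal (pos_part (\<Sum>i=1..k. r i))"
    using c by (intro ennreal_mult') simp
  also have "\<dots> \<le> ennreal c * (\<integral>\<^sup>+A. ennreal (pos_part (mean_log_growth k A)) \<partial>M)"
    by (intro mult_left_mono sum_exponents_le r k) simp
  also have "\<dots> = (\<integral>\<^sup>+A. ennreal c * ennreal (pos_part (mean_log_growth k A)) \<partial>M)"
    by (rule nn_integral_cmult[symmetric]) measurable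
  also have "\<dots> \<le> (\<integral>\<^sup>+A. (\<Sum>Q\<in>S. ennreal (?f (Q ** A))) \<partial>M)"
  proof (rule nn_integral_mono)
    fix A assume "A \<in> space M"
    hence "invertible A" by (simp add: in_space_M)
    from dom[OF this] obtain Q where Q: "Q \<in> S" "c * pos_part (mean_log_growth k A) \<le> ?f (Q ** A)" by blast
    have "ennreal c * ennreal (pos_part (mean_log_growth k A)) = ennreal (c * pos_part (mean_log_growth k A))"
      using c by (intro ennreal_mult'[symmetric]) simp
    also have "\<dots> \<le> ennreal (?f (Q ** A))" by (rule ennreal_leI[OF Q(2)])
    also have "\<dots> \<le> (\<Sum>Q\<in>S. ennreal (?f (Q ** A)))"
      using Q(1) S(1) by (intro member_le_sum) auto
    finally show "ennreal c * ennreal (pos_part (mean_log_growth k A)) \<le> (\<Sum>Q\<in>S. ennreal (?f (Q ** A)))" .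
  qed
  also have "\<dots> = (\<Sum>Q\<in>S. \<integral>\<^sup>+A. ennreal (?f (Q ** A)) \<partial>M)"
    using measurable_compose[OF left_mult_measurable fm] S(2) by (intro nn_integral_sum) auto
  also have "\<dots> = (\<Sum>Q\<in>S. \<integral>\<^sup>+A. ennreal (?f A) \<partial>M)"
    by (intro sum.cong refl nn_integral_left_mult[OF S(2) fm])
  also have "\<dots> = of_nat (card S) * (\<integral>\<^sup>+A. ennreal (?f A) \<partial>M)" by simp
  also have "(\<integral>\<^sup>+A. ennreal (?f A) \<partial>M) = ennreal (\<integral>A. ?f A \<partial>M)"
    by (rule nn_integral_eq_integral[OF eig_prod_integrable[OF k int]]) (simp add: P)
  also have "of_nat (card S) * ennreal (\<integral>A. ?f A \<partial>M) = ennreal (real (card S) * (\<integral>A. ?f A \<partial>M))"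
    by (simp add: ennreal_of_nat_eq_real_of_nat ennreal_mult')
  finally have "c * pos_part (\<Sum>i=1..k. r i) \<le> real (card S) * (\<integral>A. ?f A \<partial>M)"
    by (rule ennreal_le_iff[THEN iffD1, rotated]) (intro mult_nonneg_nonneg Bochner_Integration.integral_nonneg P of_nat_0_le_iff)
  also have "(\<integral>A. ?f A \<partial>M) = (\<integral>A. pos_part (\<Sum>i=1..k. ln (cmod (eigenvalue i A))) \<partial>M)"
  proof (rule Bochner_Integration.integral_cong[OF refl])
    fix A assume "A \<in> space M"
    hence "invertible A" by (simp add: in_space_M)
    thus "?f A = pos_part (\<Sum>i=1..k. ln (cmod (eigenvalue i A)))"
      by (simp only: sum_ln_cmod_eigenvalue[OF _ k])
  qed
  finally show ?thesis .
qed

end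

theorem theorem1:
  "\<exists>c>0. \<forall>(M :: (real ^ 'n ^ 'n) measure) (r :: nat \<Rightarrow> real) (k :: nat).
     measure_on_GL M \<longrightarrow> prob_space M \<longrightarrow> orthogonally_invariant M \<longrightarrow>
     integrable M (\<lambda>A. log_plus (onorm ((*v) A))) \<longrightarrow>
     integrable M (\<lambda>A. log_plus (onorm ((*v) (matrix_inv A)))) \<longrightarrow>
     random_Lyapunov_exponents M r \<longrightarrow>
     1 \<le> k \<longrightarrow> k \<le> CARD('n) \<longrightarrow>
     (\<integral>A. pos_part (\<Sum>i=1..k. ln (cmod (eigenvalue i A))) \<partial>M)
       \<ge> c * pos_part (\<Sum>i=1..k. r i)"
proof -
  define good where "good = (\<lambda>k (S :: (real ^ 'n ^ 'n) set) c. finite S \<and> (\<forall>Q\<in>S. orthogonal_matrix Q) \<and> c > 0 \<and>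
    (\<forall>A. invertible A \<longrightarrow> (\<exists>Q\<in>S. c * pos_part (mean_log_growth k A) \<le> pos_part (ln (eig_prod k (Q ** A))))))"
  have "\<forall>k\<in>{1..CARD('n)}. \<exists>S c. good k S c"
  proof
    fix k assume "k \<in> {1..CARD('n)}"
    hence "1 \<le> k" "k \<le> CARD('n)" by simp_all
    thus "\<exists>S c. good k S c" unfolding good_def by (rule eig_prod_ge_mean_log_growth)
  qed
  then obtain S c where good: "\<And>k. k \<in> {1..CARD('n)} \<Longrightarrow> good k (S k) (c k)" by metis
  \<comment> \<open>A minimum over the finitely many k; S and c were chosen before any measure, so
    the constant depends only on the dimension.\<close>
  define c0 where "c0 = Min ((\<lambda>k. c k / real (card (S k))) ` {1..CARD('n)})"
  have ne: "(\<lambda>k. c k / real (card (S k))) ` {1..CARD('n)} \<noteq> {}" by (simp add: Suc_le_eq)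
  \<comment> \<open>Each net is nonempty, since it provides a matrix Q for A = 1.\<close>
  have card: "card (S k) > 0" if "k \<in> {1..CARD('n)}" for k
  proof -
    have "invertible (mat 1 :: real ^ 'n ^ 'n)" by (simp add: invertible_det_nz)
    hence "S k \<noteq> {}" using good[OF that] unfolding good_def by blast
    thus ?thesis using good[OF that] unfolding good_def by (simp add: card_gt_0_iff)
  qed
  show ?thesis
  proof (intro exI[of _ c0] conjI allI impI)
    show "c0 > 0"
      unfolding c0_def using ne
    proof (subst Min_gr_iff)
      show "\<forall>a\<in>(\<lambda>k. c k / real (card (S k))) ` {1..CARD('n)}. 0 < a"
        using card good by (auto simp: good_def)
    qed auto
    fix M :: "(real ^ 'n ^ 'n) measure" and r :: "nat \<Rightarrow> real" and k :: nat
    assume M: "measure_on_GL M" "prob_space M" "orthogonally_invariant M"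
      and int: "integrable M (\<lambda>A. log_plus (onorm ((*v) A)))"
      and r: "random_Lyapunov_exponents M r" and k: "1 \<le> k" "k \<le> CARD('n)"
    interpret prob_space M by (rule M(2))
    interpret orthogonally_invariant_prob M by unfold_locales (rule M)+
    have kk: "k \<in> {1..CARD('n)}" using k by simp
    let ?J = "\<integral>A. pos_part (\<Sum>i=1..k. ln (cmod (eigenvalue i A))) \<partial>M"
    have "c k * pos_part (\<Sum>i=1..k. r i) \<le> real (card (S k)) * ?J"
      using good[OF kk] unfolding good_def by (intro integral_eig_prod_ge[OF k(2) int r]) auto
    hence "c k / real (card (S k)) * pos_part (\<Sum>i=1..k. r i) \<le> ?J"
      using card[OF kk] by (simp add: field_simps)
    moreover have "c0 * pos_part (\<Sum>i=1..k. r i) \<le> c k / real (card (S k)) * pos_part (\<Sum>i=1..k. r i)"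
      unfolding c0_def using kk by (intro mult_right_mono Min_le) (auto simp: pos_part_def)
    ultimately show "?J \<ge> c0 * pos_part (\<Sum>i=1..k. r i)" by linarith
  qed
qed

end
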